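(* For every odd integer $r\geq 3$ and every integer $s\geq 3$ there exists $\varepsilon=\varepsilon(s)>0$, depending only on $s$, such that for every positive integer $t$, $$\mathrm{ex}\big(n,K^{(r)}_{s,t}\big)=O_{r,s,t}\Big(n^{\,r-\frac{1}{s-1}-\varepsilon}\Big),$$ i.e. there is a constant $C=C(r,s,t)$ such that every $n$-vertex $r$-uniform hypergraph containing no copy of $K^{(r)}_{s,t}$ has at most $C\,n^{r-\frac{1}{s-1}-\varepsilon}$ edges.
   Context: For positive integers $r,s,t$, $K^{(r)}_{s,t}$ denotes the $r$-uniform hypergraph with vertex set $\left(\bigcup_{i\in[t]}X_i\right)\cup Y$ and edge set $\{X_i\cup\{y\}: i\in[t],\,y\in Y\}$, where $X_1,\dots,X_t$ are pairwise disjoint sets of size $r-1$ and $Y$ is a set of size $s$ disjoint from each $X_i$. For an $r$-uniform hypergraph $H$, $\mathrm{ex}(n,H)$ is the maximum number of edges in an $n$-vertex $r$-uniform hypergraph containing no copy of $H$ as a subgraph. *)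

theory Defs
  imports Complex_Main
begin

type_synonym 'a hypergraph = "'a set \<times> 'a set set"

abbreviation verts :: "'a hypergraph \<Rightarrow> 'a set" where
  "verts G \<equiv> fst G"

abbreviation edges :: "'a hypergraph \<Rightarrow> 'a set set" where
  "edges G \<equiv> snd G"

definition uniform_hypergraph :: "nat \<Rightarrow> 'a hypergraph \<Rightarrow> bool" where
  "uniform_hypergraph r G \<longleftrightarrow>
     finite (verts G) \<and> (\<forall>e\<in>edges G. e \<subseteq> verts G \<and> card e = r)"

text \<open>Copies are as subgraphs, not necessarily induced.\<close>

definition contains_copy :: "'a hypergraph \<Rightarrow> 'b hypergraph \<Rightarrow> bool" where
  "contains_copy G H \<longleftrightarrow>
     (\<exists>f. inj_on f (verts H) \<and> f ` verts H \<subseteq> verts G \<and> (\<forall>e\<in>edges H. f ` e \<in> edges G))"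

text \<open>Vertices are taken from \<^typ>\<open>nat\<close>; by \<open>card_edges_le_extremal_number\<close> below, the
  resulting bound applies to finite hypergraphs over any vertex type, and by
  \<open>extremal_number_attained\<close> the maximum is over a nonempty set whenever \<open>H\<close> has an edge.\<close>

definition extremal_number :: "nat \<Rightarrow> nat \<Rightarrow> 'b hypergraph \<Rightarrow> nat" where
  "extremal_number r n H =
     Max {card (edges G) | G :: nat hypergraph.
            uniform_hypergraph r G \<and> card (verts G) = n \<and> \<not> contains_copy G H}"

text \<open>The vertices \<open>Inl (i, j)\<close> with \<open>j < r - 1\<close> form \<open>X\<^sub>i\<close>, and the vertices \<open>Inr y\<close> form \<open>Y\<close>.\<close>

definition K_part :: "nat \<Rightarrow> nat \<Rightarrow> (nat \<times> nat + nat) set" where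
  "K_part r i = {Inl (i, j) | j. j < r - 1}"

definition K_hyp :: "nat \<Rightarrow> nat \<Rightarrow> nat \<Rightarrow> (nat \<times> nat + nat) hypergraph" where
  "K_hyp r s t =
     ((\<Union>i<t. K_part r i) \<union> Inr ` {..<s},
      {K_part r i \<union> {Inr y} | i y. i < t \<and> y < s})"

lemma card_edges_le_two_power:
  assumes "uniform_hypergraph r G"
  shows "card (edges G) \<le> 2 ^ card (verts G)"
proof -
  have "finite (verts G)" "edges G \<subseteq> Pow (verts G)"
    using assms by (auto simp: uniform_hypergraph_def)
  then show ?thesis
    by (metis card_Pow card_mono finite_Pow_iff)
qed

lemma finite_extremal_candidates:
  "finite {card (edges G) | G :: nat hypergraph.
            uniform_hypergraph r G \<and> card (verts G) = n \<and> \<not> contains_copy G H}"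
  by (rule finite_subset[of _ "{..2 ^ n}"]) (auto dest: card_edges_le_two_power)

lemma extremal_number_attained:
  assumes "edges H \<noteq> {}"
  obtains G :: "nat hypergraph" where "uniform_hypergraph r G" "card (verts G) = n"
    "\<not> contains_copy G H" "card (edges G) = extremal_number r n H"
proof -
  let ?S = "{card (edges G) | G :: nat hypergraph.
            uniform_hypergraph r G \<and> card (verts G) = n \<and> \<not> contains_copy G H}"
  have "uniform_hypergraph r ({..<n}, {}) \<and> card (verts ({..<n}, {} :: nat set set)) = n
      \<and> \<not> contains_copy ({..<n}, {}) H"
    using assms by (auto simp: uniform_hypergraph_def contains_copy_def)
  then have "?S \<noteq> {}" by blast
  then have "extremal_number r n H \<in> ?S"
    unfolding extremal_number_def using finite_extremal_candidates by (rule Max_in[rotated])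
  then show ?thesis using that by auto
qed

lemma card_edges_le_extremal_number:
  fixes G :: "'a hypergraph"
  assumes G: "uniform_hypergraph r G" "card (verts G) = n" "\<not> contains_copy G H"
  shows "card (edges G) \<le> extremal_number r n H"
proof -
  have fin: "finite (verts G)" and sub: "edges G \<subseteq> Pow (verts G)"
    using G(1) by (auto simp: uniform_hypergraph_def)
  obtain h :: "'a \<Rightarrow> nat" where h: "inj_on h (verts G)"
    using finite_imp_inj_to_nat_seg[OF fin] by blast
  let ?G = "(h ` verts G, (`) h ` edges G)"
  have inj: "inj_on ((`) h) (edges G)"
    using inj_on_subset[OF inj_on_image_Pow[OF h] sub] .
  have "uniform_hypergraph r ?G"
    using G(1) h unfolding uniform_hypergraph_def
    by (auto simp: card_image inj_on_subset)
  moreover have "card (verts ?G) = n" using G(2) h by (simp add: card_image)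
  moreover have "\<not> contains_copy ?G H"
  proof
    assume "contains_copy ?G H"
    then obtain f where f: "inj_on f (verts H)" "f ` verts H \<subseteq> h ` verts G"
      "\<And>e. e \<in> edges H \<Longrightarrow> f ` e \<in> (`) h ` edges G"
      by (auto simp: contains_copy_def)
    let ?k = "inv_into (verts G) h"
    have "inj_on (?k \<circ> f) (verts H)"
      using f(1,2) by (intro comp_inj_on) (auto intro: inj_on_subset[OF inj_on_inv_into])
    moreover have "(?k \<circ> f) ` verts H \<subseteq> verts G"
      using f(2) by (auto simp: image_subset_iff intro: inv_into_into)
    moreover have "(?k \<circ> f) ` e \<in> edges G" if e: "e \<in> edges H" for e
    proof -
      obtain d where d: "d \<in> edges G" "f ` e = h ` d" using f(3)[OF e] by auto
      have "(?k \<circ> f) ` e = ?k ` (h ` d)" using d(2) by (metis image_comp)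
      also have "\<dots> = d" using d(1) sub h by (intro inv_into_image_cancel) auto
      finally show ?thesis using d(1) by simp
    qed
    ultimately show False using G(3) unfolding contains_copy_def by blast
  qed
  ultimately have "card (edges ?G) \<le> extremal_number r n H"
    unfolding extremal_number_def
    by (intro Max_ge finite_extremal_candidates) blast
  then show ?thesis using inj by (simp add: card_image)
qed

lemma uniform_hypergraph_K_hyp:
  assumes "r \<ge> 1"
  shows "uniform_hypergraph r (K_hyp r s t)"
proof -
  have K: "K_part r i = (\<lambda>j. Inl (i, j)) ` {..<r - 1}" for i
    by (auto simp: K_part_def)
  have "finite (K_part r i)" "card (K_part r i) = r - 1" "Inr y \<notin> K_part r i" for i y
    by (auto simp: K card_image inj_on_def)
  then show ?thesis
    using assms by (auto simp: uniform_hypergraph_def K_hyp_def)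
qed

end

theory Submission
  imports Defs "HOL-Library.FuncSet"
begin

text \<open>Encode the edges as a set \<open>G\<close> of \<open>r\<close>-tuples over a vertex set of size \<open>N\<close> and write
  \<open>N\<^bsup>r - 1\<^esup> D\<close> for the claimed bound on \<open>|G|\<close>. If \<open>G\<close> has no copy of the forbidden hypergraph, the common
  link of any \<open>s\<close>-list \<open>Y\<close> placed in coordinate \<open>i\<close> has a cover \<open>S i Y\<close> of bounded size. Counting the pairs
  \<open>(Y, v)\<close> with \<open>v \<in> S i Y\<close> against the extensions of each edge shows that all codegrees and pair degrees
  of \<open>G\<close> are essentially as in a regular system, up to factors \<open>Q\<^bsup>O(1)\<^esup>\<close> with \<open>Q = N\<^bsup>\<epsilon>\<^esup>\<close>.

  By pigeonhole there is a fixed-point-free map \<open>\<pi>\<close> on the coordinates such that, for typical edges and every \<open>i\<close>,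
  the link of an \<open>s\<close>-list in coordinate \<open>i\<close> is concentrated on a vertex in coordinate \<open>\<pi> i\<close>. Since \<open>r\<close> is odd,
  \<open>\<pi>\<close> is not an involution, so there are distinct \<open>i\<close>, \<open>j = \<pi> i\<close>, \<open>k = \<pi> j\<close>. A random choice of centres yields a dense
  subsystem in which every neighbourhood in coordinate \<open>i\<close> lies in one class of a partition into sets of size about \<open>D\<close>
  that depends only on the \<open>j\<close>-th entry, and similarly for \<open>j\<close> and \<open>k\<close>. The two structures together force typical
  \<open>s\<close>-lists in coordinate \<open>i\<close> to have links larger than average by a factor \<open>D\<close>, hence there are few such lists,
  contradicting the count of pairs \<open>(Y, v)\<close>. Only boundedly many steps lose a power of \<open>Q\<close>; the losses depending on
  \<open>r\<close> and \<open>t\<close> are constants, which is why \<open>\<epsilon>\<close> depends on \<open>s\<close> only.\<close>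

section \<open>Counting\<close>

lemma of_nat_le_mult: "a \<le> b * c \<Longrightarrow> real a \<le> real b * real c"
  by (metis of_nat_le_iff of_nat_mult)

lemma card_le_fibres:
  fixes m :: real
  assumes "finite B" "f ` A \<subseteq> B" "\<And>b. b \<in> B \<Longrightarrow> real (card {a \<in> A. f a = b}) \<le> m"
  shows "real (card A) \<le> real (card B) * m"
proof (cases "finite A")
  case True
  have "card A = (\<Sum>b\<in>B. card {a \<in> A. f a = b})"
    using sum.group[OF True assms(1,2), of "\<lambda>_. 1::nat"] by simp
  then have "real (card A) = (\<Sum>b\<in>B. real (card {a \<in> A. f a = b}))" by simp
  also have "\<dots> \<le> (\<Sum>b\<in>B. m)" by (intro sum_mono assms(3))
  finally show ?thesis by simp
next
  \<comment> \<open>An infinite \<open>A\<close> has \<open>card A = 0\<close>, so it suffices that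
    \<open>m\<close> is nonnegative, which the bound on any one fibre shows.\<close>
  case False
  then obtain b where "b \<in> B" using assms(2) by fastforce
  then have "0 \<le> m" using assms(3)[of b] by (meson of_nat_0_le_iff order_trans)
  then show ?thesis using False by simp
qed

lemma card_ge_fibres:
  fixes m :: real
  assumes "finite A" "finite B" "\<And>b. b \<in> B \<Longrightarrow> m \<le> real (card {a \<in> A. f a = b})"
  shows "real (card B) * m \<le> real (card A)"
proof -
  have "real (card B) * m = (\<Sum>b\<in>B. m)" by simp
  also have "\<dots> \<le> (\<Sum>b\<in>B. real (card {a \<in> A. f a = b}))" by (intro sum_mono assms(3))
  also have "\<dots> = real (\<Sum>b\<in>B. card {a \<in> A. f a = b})" by simp
  also have "(\<Sum>b\<in>B. card {a \<in> A. f a = b}) = (\<Sum>b\<in>B. card {a \<in> {a \<in> A. f a \<in> B}. f a = b})"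
    by (intro sum.cong refl arg_cong[where f=card]) auto
  also have "\<dots> = card {a \<in> A. f a \<in> B}"
    using sum.group[of "{a \<in> A. f a \<in> B}" B f "\<lambda>_. 1::nat"] assms(1,2) by fastforce
  also have "\<dots> \<le> card A" using assms(1) by (intro card_mono) auto
  finally show ?thesis by simp
qed

lemma card_Sigma_le:
  fixes m :: real
  assumes "finite A" "\<And>a. a \<in> A \<Longrightarrow> real (card (B a)) \<le> m"
  shows "real (card (Sigma A B)) \<le> real (card A) * m"
proof (rule card_le_fibres[of _ fst])
  fix a assume a: "a \<in> A"
  have "{p \<in> Sigma A B. fst p = a} = Pair a ` B a" using a by auto
  then show "real (card {p \<in> Sigma A B. fst p = a}) \<le> m"
    using assms(2)[OF a] by (simp add: card_image inj_on_def)
qed (use assms in auto)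

lemma card_Sigma_ge:
  fixes m :: real
  assumes "finite A" "\<And>a. a \<in> A \<Longrightarrow> finite (B a)" "\<And>a. a \<in> A \<Longrightarrow> m \<le> real (card (B a))"
  shows "real (card A) * m \<le> real (card (Sigma A B))"
proof (rule card_ge_fibres[of _ _ _ fst])
  fix a assume a: "a \<in> A"
  have "{p \<in> Sigma A B. fst p = a} = Pair a ` B a" using a by auto
  then show "m \<le> real (card {p \<in> Sigma A B. fst p = a})"
    using assms(3)[OF a] by (simp add: card_image inj_on_def)
qed (use assms in auto)

text \<open>A Markov inequality: \<open>f\<close> charges at least \<open>m\<close> elements of
  \<open>P\<close> to every element of \<open>A\<close>.\<close>

lemma card_heavy_le:
  fixes m :: real
  assumes "finite A" "finite P" "m > 0" "\<And>a. a \<in> A \<Longrightarrow> m \<le> real (card {p \<in> P. f p = a})"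
  shows "real (card A) \<le> real (card P) / m"
  using card_ge_fibres[OF assms(2,1,4)] assms(3) by (simp add: field_simps)

text \<open>If every \<open>j\<close> fell short, the union bound summed over \<open>J\<close> would
  contradict itself. The conclusion is multiplicative in order to stay in the natural
  numbers.\<close>

lemma pigeonhole_cover:
  assumes "finite A" "finite J" "J \<noteq> {}" "\<And>a. a \<in> A \<Longrightarrow> \<exists>j\<in>J. P a j"
  shows "\<exists>j\<in>J. card A \<le> card J * card {a \<in> A. P a j}"
proof (rule ccontr)
  assume "\<not> ?thesis"
  then have *: "\<And>j. j \<in> J \<Longrightarrow> card J * card {a \<in> A. P a j} < card A" by force
  have "card A \<le> card (\<Union>j\<in>J. {a \<in> A. P a j})" using assms(1,2,4) by (intro card_mono) auto
  also have "\<dots> \<le> (\<Sum>j\<in>J. card {a \<in> A. P a j})" by (rule card_UN_le) fact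
  finally have "card J * card A \<le> card J * (\<Sum>j\<in>J. card {a \<in> A. P a j})" by simp
  also have "\<dots> = (\<Sum>j\<in>J. card J * card {a \<in> A. P a j})" by (simp add: sum_distrib_left)
  also have "\<dots> < (\<Sum>j\<in>J. card A)" by (rule sum_strict_mono) (use assms * in auto)
  finally show False by simp
qed

text \<open>The count is a falling factorial with \<open>k\<close> factors, and setting aside fewer
  than \<open>k <= d / 2\<close> of at least \<open>d\<close> elements leaves every factor at least
  \<open>d / 2\<close>.\<close>

lemma card_distinct_lists_ge:
  fixes d :: real
  assumes "finite A" "d \<le> real (card A)" "real k \<le> d / 2" "k \<ge> 1"
  shows "(d / 2) ^ k \<le> real (card {Y. length Y = k \<and> distinct Y \<and> set Y \<subseteq> A})"
proof -
  have k: "k \<le> card A" using assms by linarith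
  have "(d / 2) ^ k = (\<Prod>m\<in>{card A - k + 1..card A}. d / 2)" using k by simp
  also have "\<dots> \<le> (\<Prod>m\<in>{card A - k + 1..card A}. real m)"
  proof (rule prod_mono)
    fix m assume m: "m \<in> {card A - k + 1..card A}"
    then have "card A + 1 \<le> m + k" using k by auto
    then have "real (card A) + 1 \<le> real m + real k" by linarith
    then show "0 \<le> d / 2 \<and> d / 2 \<le> real m" using assms by linarith
  qed
  also have "\<dots> = real (card {Y. length Y = k \<and> distinct Y \<and> set Y \<subseteq> A})"
    using card_lists_distinct_length_eq[OF assms(1) k] by simp
  finally show ?thesis .
qed

lemma finite_bounded_lists: "finite A \<Longrightarrow> finite {Y. length Y = k \<and> distinct Y \<and> set Y \<subseteq> A}"
  by (rule finite_subset[OF _ finite_lists_length_eq[of A k]]) auto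

lemma card_bounded_lists_le:
  fixes m :: real
  assumes "finite A" "real (card A) \<le> m"
  shows "real (card {Y. length Y = k \<and> distinct Y \<and> set Y \<subseteq> A}) \<le> m ^ k"
proof -
  have "card {Y. length Y = k \<and> distinct Y \<and> set Y \<subseteq> A} \<le> card {Y. set Y \<subseteq> A \<and> length Y = k}"
    by (intro card_mono finite_lists_length_eq assms) auto
  also have "\<dots> = card A ^ k" by (rule card_lists_length_eq) fact
  finally have "real (card {Y. length Y = k \<and> distinct Y \<and> set Y \<subseteq> A}) \<le> real (card A) ^ k"
    by (metis of_nat_le_iff of_nat_power)
  also have "\<dots> \<le> m ^ k" using assms(2) by (intro power_mono) auto
  finally show ?thesis .
qed

text \<open>The induction removes one orbit \<open>{x, f x}\<close> at a time. The parity of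
  \<open>r\<close> enters the argument only through this lemma.\<close>

lemma even_card_involution:
  assumes "finite A" "\<And>x. x \<in> A \<Longrightarrow> f x \<in> A" "\<And>x. x \<in> A \<Longrightarrow> f (f x) = x"
    "\<And>x. x \<in> A \<Longrightarrow> f x \<noteq> x"
  shows "even (card A)"
  using assms
proof (induction "card A" arbitrary: A rule: less_induct)
  case less
  show ?case
  proof (cases "A = {}")
    case False
    then obtain x where x: "x \<in> A" by auto
    let ?B = "A - {x, f x}"
    have c: "card A = card ?B + 2"
    proof -
      have "card {x, f x} = 2" "{x, f x} \<subseteq> A" using x less.prems(2,4) by fastforce+
      then show ?thesis using less.prems(1)
        by (metis card_Diff_subset card_mono finite_subset le_add_diff_inverse2)
    qed
    have "even (card ?B)"
    proof (rule less.hyps)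
      show "card ?B < card A" using c by simp
      show "f y \<in> ?B" if "y \<in> ?B" for y
        using that less.prems(2,3) x by (metis Diff_iff insert_iff empty_iff)
    qed (use less.prems in auto)
    then show ?thesis using c by simp
  qed simp
qed

text \<open>Pairwise independence of a uniformly random subset is all that is needed: the expected
  number of items isolated by a random set of density \<open>1 / M\<close> is bounded below by
  Bonferroni's inequality.\<close>

lemma isolating_set_exists:
  fixes U Tg :: "'e \<Rightarrow> 'a set" and m :: real and M :: nat
  assumes "finite V" "finite E" "M > 0"
    and U: "\<And>e. e \<in> E \<Longrightarrow> U e \<subseteq> V" "\<And>e. e \<in> E \<Longrightarrow> 2 * card (U e) \<le> M"
    and Tg: "\<And>e. e \<in> E \<Longrightarrow> Tg e \<subseteq> U e" "\<And>e. e \<in> E \<Longrightarrow> m \<le> real (card (Tg e))"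
  shows "\<exists>P\<subseteq>V. real (card E) * m / (2 * real M) \<le> real (card {e \<in> E. \<exists>b\<in>Tg e. P \<inter> U e = {b}})"
proof -
  \<comment> \<open>The zero set \<open>?P f\<close> of a uniform \<open>f\<close> in
    \<open>?\<Omega>\<close> contains each vertex independently with probability 1/M. Probabilities
    appear as counts, scaled by the size \<open>?c\<close> of \<open>?\<Omega>\<close>.\<close>
  let ?\<Omega> = "PiE V (\<lambda>_. {..<M})"
  let ?P = "\<lambda>f. {v \<in> V. f v = (0::nat)}"
  have fin\<Omega>: "finite ?\<Omega>" using assms by (intro finite_PiE) auto
  let ?c = "real M ^ card V"
  have card\<Omega>: "real (card ?\<Omega>) = ?c" using assms by (simp add: card_PiE)
  have card_event: "real (card {f \<in> ?\<Omega>. \<forall>v\<in>B. f v = 0}) * real M ^ card B = ?c"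
    if B: "B \<subseteq> V" for B
  proof -
    have "{f \<in> ?\<Omega>. \<forall>v\<in>B. f v = 0} = PiE V (\<lambda>v. if v \<in> B then {0} else {..<M})"
    proof (intro set_eqI iffI)
      fix f assume "f \<in> PiE V (\<lambda>v. if v \<in> B then {0} else {..<M})"
      then show "f \<in> {f \<in> ?\<Omega>. \<forall>v\<in>B. f v = 0}"
        using B \<open>M > 0\<close> by (auto simp: PiE_iff subset_iff split: if_splits)
    qed (auto simp: PiE_iff)
    moreover have "card (PiE V (\<lambda>v. if v \<in> B then {0} else {..<M})) = M ^ card (V - B)"
    proof -
      have "card (PiE V (\<lambda>v. if v \<in> B then {0} else {..<M})) = (\<Prod>v\<in>V. if v \<in> B then 1 else M)"
        using assms(1) by (subst card_PiE) (auto intro: prod.cong)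
      also have "\<dots> = (\<Prod>v\<in>V - B. M)"
        using assms(1) B by (intro prod.mono_neutral_cong_right) auto
      finally show ?thesis by simp
    qed
    moreover have "card V = card (V - B) + card B"
      using B assms(1) by (metis card_Diff_subset card_mono finite_subset le_add_diff_inverse2)
    ultimately show ?thesis by (simp add: power_add)
  qed
  have isolated: "?c * m / (2 * real M) \<le> real (card {f \<in> ?\<Omega>. \<exists>b\<in>Tg e. ?P f \<inter> U e = {b}})"
    if e: "e \<in> E" for e
  proof -
    let ?I = "\<lambda>b. {f \<in> ?\<Omega>. ?P f \<inter> U e = {b}}"
    have UV: "U e \<subseteq> V" and TU: "Tg e \<subseteq> U e" using e U Tg by auto
    have finU: "finite (U e)" using UV assms(1) finite_subset by blast
    have finT: "finite (Tg e)" using TU finU finite_subset by blast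
    \<comment> \<open>\<open>b\<close> is isolated when it is chosen and no other \<open>u\<close>
      in \<open>U e\<close> is: probability 1/M minus at most M/2 pair events of probability 1/M^2
      leaves 1/(2M).\<close>
    have one: "?c / (2 * real M) \<le> real (card (?I b))" if b: "b \<in> Tg e" for b
    proof -
      have bV: "b \<in> V" "b \<in> U e" using b TU UV by auto
      let ?A = "{f \<in> ?\<Omega>. f b = 0}"
      have A: "real (card ?A) * real M = ?c" using card_event[of "{b}"] bV by simp
      have sub: "?A \<subseteq> ?I b \<union> (\<Union>u\<in>U e - {b}. {f \<in> ?\<Omega>. f b = 0 \<and> f u = 0})"
        using bV UV by auto
      have "card ?A \<le> card (?I b \<union> (\<Union>u\<in>U e - {b}. {f \<in> ?\<Omega>. f b = 0 \<and> f u = 0}))"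
        using sub fin\<Omega> finU by (intro card_mono) auto
      also have "\<dots> \<le> card (?I b) + card (\<Union>u\<in>U e - {b}. {f \<in> ?\<Omega>. f b = 0 \<and> f u = 0})"
        by (rule card_Un_le)
      also have "card (\<Union>u\<in>U e - {b}. {f \<in> ?\<Omega>. f b = 0 \<and> f u = 0})
          \<le> (\<Sum>u\<in>U e - {b}. card {f \<in> ?\<Omega>. f b = 0 \<and> f u = 0})"
        using finU by (intro card_UN_le) auto
      finally have "card ?A \<le> card (?I b) + (\<Sum>u\<in>U e - {b}. card {f \<in> ?\<Omega>. f b = 0 \<and> f u = 0})"
        by simp
      then have "real (card ?A) \<le> real (card (?I b) + (\<Sum>u\<in>U e - {b}. card {f \<in> ?\<Omega>. f b = 0 \<and> f u = 0}))"
        by (rule of_nat_mono)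
      also have "\<dots> = real (card (?I b)) +
          (\<Sum>u\<in>U e - {b}. real (card {f \<in> ?\<Omega>. f b = 0 \<and> f u = 0}))" by simp
      also have "(\<Sum>u\<in>U e - {b}. real (card {f \<in> ?\<Omega>. f b = 0 \<and> f u = 0}))
          = (\<Sum>u\<in>U e - {b}. ?c / real M ^ 2)"
      proof (intro sum.cong refl)
        fix u assume u: "u \<in> U e - {b}"
        then have "card {b, u} = 2" by auto
        moreover have "{b, u} \<subseteq> V" using u bV UV by auto
        ultimately show "real (card {f \<in> ?\<Omega>. f b = 0 \<and> f u = 0}) = ?c / real M ^ 2"
          using card_event[of "{b, u}"] \<open>M > 0\<close> by (simp add: field_simps)
      qed
      also have "\<dots> = real (card (U e - {b})) * (?c / real M ^ 2)" by simp
      also have "\<dots> \<le> (real M / 2) * (?c / real M ^ 2)"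
      proof (rule mult_right_mono)
        have "card (U e - {b}) \<le> card (U e)" using finU by (intro card_mono) auto
        then show "real (card (U e - {b})) \<le> real M / 2" using U(2)[OF e] by linarith
      qed simp
      also have "\<dots> = ?c / (2 * real M)" using \<open>M > 0\<close> by (simp add: power2_eq_square)
      finally have "real (card ?A) \<le> real (card (?I b)) + ?c / (2 * real M)" by simp
      moreover have "real (card ?A) = 2 * (?c / (2 * real M))" using A \<open>M > 0\<close> by (simp add: field_simps)
      ultimately show ?thesis by linarith
    qed
    have "?c * m / (2 * real M) \<le> real (card (Tg e)) * (?c / (2 * real M))"
      using mult_right_mono[OF Tg(2)[OF e], of "?c / (2 * real M)"] by (simp add: mult.commute)
    also have "\<dots> = (\<Sum>b\<in>Tg e. ?c / (2 * real M))" by simp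
    also have "\<dots> \<le> (\<Sum>b\<in>Tg e. real (card (?I b)))" by (intro sum_mono one)
    \<comment> \<open>The events for different \<open>b\<close> exclude each other, so their counts
      add up.\<close>
    also have "\<dots> = real (card (\<Union>b\<in>Tg e. ?I b))"
      using finT fin\<Omega> by (subst card_UN_disjoint) auto
    also have "(\<Union>b\<in>Tg e. ?I b) = {f \<in> ?\<Omega>. \<exists>b\<in>Tg e. ?P f \<inter> U e = {b}}" by auto
    finally show ?thesis .
  qed
  let ?good = "\<lambda>f. {e \<in> E. \<exists>b\<in>Tg e. ?P f \<inter> U e = {b}}"
  have "?c * (real (card E) * m / (2 * real M)) = (\<Sum>e\<in>E. ?c * m / (2 * real M))" by simp
  also have "\<dots> \<le> (\<Sum>e\<in>E. real (card {f \<in> ?\<Omega>. \<exists>b\<in>Tg e. ?P f \<inter> U e = {b}}))"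
    by (intro sum_mono isolated)
  also have "\<dots> = (\<Sum>e\<in>E. \<Sum>f\<in>?\<Omega>. if \<exists>b\<in>Tg e. ?P f \<inter> U e = {b} then 1 else 0)"
    using fin\<Omega> by (intro sum.cong refl) (simp add: sum.If_cases Int_def)
  also have "\<dots> = (\<Sum>f\<in>?\<Omega>. \<Sum>e\<in>E. if \<exists>b\<in>Tg e. ?P f \<inter> U e = {b} then 1 else 0)"
    by (rule sum.swap)
  also have "\<dots> = (\<Sum>f\<in>?\<Omega>. real (card (?good f)))"
    using assms(2) by (intro sum.cong refl) (simp add: sum.If_cases Int_def)
  finally have total: "?c * (real (card E) * m / (2 * real M)) \<le> (\<Sum>f\<in>?\<Omega>. real (card (?good f)))" .
  have "\<exists>f\<in>?\<Omega>. real (card E) * m / (2 * real M) \<le> real (card (?good f))"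
  proof (rule ccontr)
    assume "\<not> ?thesis"
    then have "\<And>f. f \<in> ?\<Omega> \<Longrightarrow> real (card (?good f)) < real (card E) * m / (2 * real M)" by force
    moreover have "?\<Omega> \<noteq> {}" using \<open>M > 0\<close> by (auto simp: PiE_eq_empty_iff)
    ultimately have "(\<Sum>f\<in>?\<Omega>. real (card (?good f))) < (\<Sum>f\<in>?\<Omega>. real (card E) * m / (2 * real M))"
      using fin\<Omega> by (intro sum_strict_mono) auto
    then show False using total card\<Omega> by simp
  qed
  then obtain f where "f \<in> ?\<Omega>" "real (card E) * m / (2 * real M) \<le> real (card (?good f))" by blast
  then show ?thesis by (intro exI[of _ "?P f"]) auto
qed

section \<open>Systems of tuples\<close>

text \<open>The entries on the line through \<open>x\<close> in direction \<open>i\<close>; their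
  number is a codegree. The value \<open>x i\<close> is immaterial, so \<open>x\<close> may also be
  a point of a shadow.\<close>

definition nbrs :: "(nat \<Rightarrow> 'a) set \<Rightarrow> nat \<Rightarrow> (nat \<Rightarrow> 'a) \<Rightarrow> 'a set" where
  "nbrs F i x = {y. x(i := y) \<in> F}"

text \<open>Projection along coordinate \<open>i\<close>. Overwriting with \<open>undefined\<close>
  gives every line in direction \<open>i\<close> exactly one representative.\<close>

definition shadow :: "nat \<Rightarrow> (nat \<Rightarrow> 'a) set \<Rightarrow> (nat \<Rightarrow> 'a) set" where
  "shadow i F = (\<lambda>x. x(i := undefined)) ` F"

definition pair_shadow :: "nat \<Rightarrow> nat \<Rightarrow> (nat \<Rightarrow> 'a) set \<Rightarrow> ('a \<times> 'a) set" where
  "pair_shadow i j F = (\<lambda>x. (x i, x j)) ` F"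

text \<open>Links consist of shadow points, so that they count lines in direction \<open>i\<close>
  rather than tuples.\<close>

definition common_link :: "(nat \<Rightarrow> 'a) set \<Rightarrow> nat \<Rightarrow> 'a list \<Rightarrow> (nat \<Rightarrow> 'a) set" where
  "common_link F i Y = {w \<in> shadow i F. \<forall>y\<in>set Y. w(i := y) \<in> F}"

lemma nbrs_upd [simp]: "nbrs F i (x(i := y)) = nbrs F i x"
  by (simp add: nbrs_def)

lemma nbrs_mono: "F \<subseteq> F' \<Longrightarrow> nbrs F i x \<subseteq> nbrs F' i x"
  by (auto simp: nbrs_def)

lemma self_in_nbrs: "x \<in> F \<Longrightarrow> x i \<in> nbrs F i x"
  by (simp add: nbrs_def)

lemma card_shadow_fibre:
  assumes "w \<in> shadow i F"
  shows "card {x \<in> F. x(i := undefined) = w} = card (nbrs F i w)"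
proof -
  have w: "w i = undefined" using assms by (auto simp: shadow_def)
  have "{x \<in> F. x(i := undefined) = w} = (\<lambda>y. w(i := y)) ` nbrs F i w"
  proof (intro set_eqI iffI)
    fix x assume "x \<in> {x \<in> F. x(i := undefined) = w}"
    then have "x \<in> F" "x = w(i := x i)" by auto
    then show "x \<in> (\<lambda>y. w(i := y)) ` nbrs F i w" unfolding nbrs_def by (metis imageI mem_Collect_eq)
  qed (use w in \<open>auto simp: nbrs_def fun_upd_idem\<close>)
  moreover have "inj_on (\<lambda>y. w(i := y)) (nbrs F i w)" by (metis fun_upd_eqD inj_onI)
  ultimately show ?thesis by (simp add: card_image)
qed

locale tuple_space =
  fixes V :: "'a set" and r :: nat
  assumes finV: "finite V" and r3: "r \<ge> 3"
begin

abbreviation tuples :: "(nat \<Rightarrow> 'a) set" where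
  "tuples \<equiv> PiE {..<r} (\<lambda>_. V)"

abbreviation N :: real where
  "N \<equiv> real (card V)"

lemma fin_tuples: "finite tuples"
  using finV by (intro finite_PiE) auto

lemma fin_sub: "F \<subseteq> tuples \<Longrightarrow> finite F"
  using fin_tuples finite_subset by blast

lemma fin_shadow: "F \<subseteq> tuples \<Longrightarrow> finite (shadow i F)"
  unfolding shadow_def using fin_sub by blast

lemma fin_pair_shadow: "F \<subseteq> tuples \<Longrightarrow> finite (pair_shadow i j F)"
  unfolding pair_shadow_def using fin_sub by blast

lemma tuple_mem: "F \<subseteq> tuples \<Longrightarrow> x \<in> F \<Longrightarrow> i < r \<Longrightarrow> x i \<in> V"
  by (auto simp: PiE_iff)

lemma nbrs_sub: "F \<subseteq> tuples \<Longrightarrow> i < r \<Longrightarrow> nbrs F i x \<subseteq> V"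
proof
  fix y assume F: "F \<subseteq> tuples" "i < r" and "y \<in> nbrs F i x"
  then have "x(i := y) \<in> F" by (simp add: nbrs_def)
  from tuple_mem[OF F(1) this F(2)] show "y \<in> V" by simp
qed

lemma fin_nbrs: "F \<subseteq> tuples \<Longrightarrow> i < r \<Longrightarrow> finite (nbrs F i x)"
  using nbrs_sub finV finite_subset by metis

lemma card_partial_tuples:
  assumes "J \<subseteq> {..<r}"
  shows "real (card (PiE ({..<r} - J) (\<lambda>_. V))) = N ^ (r - card J)"
proof -
  have "card ({..<r} - J) = r - card J"
    using assms by (simp add: card_Diff_subset finite_subset)
  then show ?thesis by (simp add: card_PiE)
qed

lemma shadow_sub: "F \<subseteq> tuples \<Longrightarrow> shadow i F \<subseteq> PiE ({..<r} - {i}) (\<lambda>_. V)"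
proof
  fix w assume F: "F \<subseteq> tuples" "w \<in> shadow i F"
  then obtain x where x: "x \<in> tuples" "w = x(i := undefined)" by (auto simp: shadow_def)
  then show "w \<in> PiE ({..<r} - {i}) (\<lambda>_. V)"
    by (intro PiE_I) (auto simp: PiE_iff extensional_def)
qed

lemma card_shadow_le:
  assumes "F \<subseteq> tuples" "i < r"
  shows "real (card (shadow i F)) \<le> N ^ (r - 1)"
proof -
  have "card (shadow i F) \<le> card (PiE ({..<r} - {i}) (\<lambda>_. V))"
    using shadow_sub[OF assms(1)] finV by (intro card_mono finite_PiE) auto
  then show ?thesis using card_partial_tuples[of "{i}"] assms(2) by simp
qed

lemma card_le_shadow:
  assumes "F \<subseteq> tuples" "\<And>x. x \<in> F \<Longrightarrow> real (card (nbrs F i x)) \<le> m"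
  shows "real (card F) \<le> real (card (shadow i F)) * m"
proof (rule card_le_fibres[of _ "\<lambda>x. x(i := undefined)"])
  fix w assume w: "w \<in> shadow i F"
  then obtain x where "x \<in> F" "w = x(i := undefined)" by (auto simp: shadow_def)
  then show "real (card {x \<in> F. x(i := undefined) = w}) \<le> m"
    using card_shadow_fibre[OF w] assms(2) by simp
qed (use fin_shadow[OF assms(1)] in \<open>auto simp: shadow_def\<close>)

lemma card_shadow_heavy:
  assumes "F' \<subseteq> tuples" "F \<subseteq> F'" "\<And>x. x \<in> F \<Longrightarrow> m \<le> real (card (nbrs F' i x))"
  shows "real (card (shadow i F)) * m \<le> real (card F')"
proof (rule card_ge_fibres[of _ _ _ "\<lambda>x. x(i := undefined)"])
  fix w assume w: "w \<in> shadow i F"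
  then obtain x where "x \<in> F" "w = x(i := undefined)" by (auto simp: shadow_def)
  moreover have "w \<in> shadow i F'" using w assms(2) by (auto simp: shadow_def)
  ultimately show "m \<le> real (card {x \<in> F'. x(i := undefined) = w})"
    using card_shadow_fibre[of w i F'] assms(3) by simp
qed (use fin_shadow fin_sub assms in blast)+

lemma card_pair_shadow_heavy:
  assumes "F' \<subseteq> tuples" "F \<subseteq> F'"
    "\<And>x. x \<in> F \<Longrightarrow> m \<le> real (card {x' \<in> F'. x' i = x i \<and> x' j = x j})"
  shows "real (card (pair_shadow i j F)) * m \<le> real (card F')"
proof (rule card_ge_fibres[of _ _ _ "\<lambda>x. (x i, x j)"])
  fix p assume "p \<in> pair_shadow i j F"
  then obtain x where x: "x \<in> F" "p = (x i, x j)" by (auto simp: pair_shadow_def)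
  then show "m \<le> real (card {x \<in> F'. (x i, x j) = p})" using assms(3)[OF x(1)] by simp
qed (use fin_pair_shadow fin_sub assms in blast)+

lemma card_le_pair_shadow:
  assumes "F \<subseteq> tuples"
    "\<And>x. x \<in> F \<Longrightarrow> real (card {x' \<in> F. x' i = x i \<and> x' j = x j}) \<le> m"
  shows "real (card F) \<le> real (card (pair_shadow i j F)) * m"
proof (rule card_le_fibres[of _ "\<lambda>x. (x i, x j)"])
  fix p assume "p \<in> pair_shadow i j F"
  then obtain x where x: "x \<in> F" "p = (x i, x j)" by (auto simp: pair_shadow_def)
  then show "real (card {x \<in> F. (x i, x j) = p}) \<le> m" using assms(2)[OF x(1)] by simp
qed (use fin_pair_shadow[OF assms(1)] in \<open>auto simp: pair_shadow_def\<close>)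

text \<open>A shadow point carries no information in coordinate \<open>k\<close>, so its entries at
  \<open>i\<close>, \<open>j\<close> and the other \<open>r - 3\<close> coordinates determine it.
  This transfers bounds on pair shadows to shadows in a third direction.\<close>

lemma card_shadow_le_pair_shadow:
  assumes F: "F \<subseteq> tuples" and ijk: "i < r" "j < r" "k < r" "i \<noteq> j" "i \<noteq> k" "j \<noteq> k"
  shows "real (card (shadow k F)) \<le> real (card (pair_shadow i j F)) * N ^ (r - 3)"
proof -
  let ?I = "{..<r} - {i, j, k}"
  let ?f = "\<lambda>w. ((w i, w j), restrict w ?I)"
  let ?B = "pair_shadow i j F \<times> PiE ?I (\<lambda>_. V)"
  have "inj_on ?f (shadow k F)"
  proof (rule inj_onI, rule ext)
    fix w w' l assume w: "w \<in> shadow k F" "w' \<in> shadow k F" and eq: "?f w = ?f w'"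
    then have e: "w \<in> PiE ({..<r} - {k}) (\<lambda>_. V)" "w' \<in> PiE ({..<r} - {k}) (\<lambda>_. V)"
      using shadow_sub[OF F] by auto
    have r: "restrict w ?I l = restrict w' ?I l" "w i = w' i" "w j = w' j" using eq by auto
    consider "l = i" | "l = j" | "l \<in> ?I" | "l \<notin> {..<r} - {k}" by blast
    then show "w l = w' l"
    proof cases
      case 3
      then show ?thesis using r(1) by simp
    next
      case 4
      then show ?thesis using PiE_arb[OF e(1)] PiE_arb[OF e(2)] by simp
    qed (use r in simp_all)
  qed
  moreover have "?f ` shadow k F \<subseteq> ?B"
  proof (rule image_subsetI)
    fix w assume w: "w \<in> shadow k F"
    then obtain x where x: "x \<in> F" "w = x(k := undefined)" by (auto simp: shadow_def)
    have "(w i, w j) \<in> pair_shadow i j F"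
      using x ijk by (auto simp: pair_shadow_def)
    moreover have "restrict w ?I \<in> PiE ?I (\<lambda>_. V)"
      using x tuple_mem[OF F x(1)] by (intro restrict_PiE_iff[THEN iffD2]) auto
    ultimately show "?f w \<in> ?B" by simp
  qed
  moreover have "finite ?B"
    using fin_pair_shadow[OF F] finV by (intro finite_cartesian_product finite_PiE) auto
  ultimately have "card (shadow k F) \<le> card ?B" by (rule card_inj_on_le)
  then have "real (card (shadow k F)) \<le> real (card ?B)" by simp
  also have "\<dots> = real (card (pair_shadow i j F)) * N ^ (r - 3)"
    using card_partial_tuples[of "{i, j, k}"] ijk by (simp add: card_cartesian_product numeral_3_eq_3)
  finally show ?thesis .
qed

text \<open>A subset maximising \<open>|F| - \<tau> \<Sum>\<^sub>i |shadow i F|\<close> has all codegrees at least \<open>\<tau>\<close>, because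
  deleting a whole line of fewer than \<open>\<tau>\<close> tuples would increase this quantity.\<close>

lemma min_codegree_subset:
  fixes \<tau> :: real
  assumes F: "F \<subseteq> tuples" and \<tau>: "\<tau> \<ge> 0"
  shows "\<exists>F'\<subseteq>F. (\<forall>x\<in>F'. \<forall>i<r. \<tau> \<le> real (card (nbrs F' i x))) \<and>
           real (card F) - \<tau> * real r * N ^ (r - 1) \<le> real (card F')"
proof -
  let ?\<Phi> = "\<lambda>F'. real (card F') - \<tau> * (\<Sum>i<r. real (card (shadow i F')))"
  have "finite (?\<Phi> ` Pow F)" using fin_sub[OF F] by simp
  moreover have "?\<Phi> ` Pow F \<noteq> {}" by blast
  ultimately have "Max (?\<Phi> ` Pow F) \<in> ?\<Phi> ` Pow F" by (rule Max_in)
  then obtain F' where F': "F' \<subseteq> F" "?\<Phi> F' = Max (?\<Phi> ` Pow F)" by auto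
  have max: "?\<Phi> F'' \<le> ?\<Phi> F'" if "F'' \<subseteq> F" for F''
    unfolding F'(2) using that fin_sub[OF F] by (intro Max_ge) auto
  have tF': "F' \<subseteq> tuples" using F' F by blast
  have "\<tau> \<le> real (card (nbrs F' i x))" if x: "x \<in> F'" "i < r" for x i
  proof (rule ccontr)
    assume neg: "\<not> ?thesis"
    let ?w = "x(i := undefined)"
    let ?L = "{x' \<in> F'. x'(i := undefined) = ?w}"
    let ?F = "F' - ?L"
    have w: "?w \<in> shadow i F'" using x by (auto simp: shadow_def)
    have cL: "real (card ?L) < \<tau>" using neg card_shadow_fibre[OF w] by simp
    have "card F' = card ?F + card ?L"
      using fin_sub[OF tF'] by (metis (no_types, lifting) Collect_subset card_Diff_subset card_mono
          finite_subset le_add_diff_inverse2 mem_Collect_eq subsetI)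
    then have c1: "real (card ?F) = real (card F') - real (card ?L)" by simp
    have mono: "card (shadow l ?F) \<le> card (shadow l F')" for l
      using fin_shadow[OF tF'] by (intro card_mono) (auto simp: shadow_def)
    have "shadow i ?F \<subseteq> shadow i F' - {?w}" by (auto simp: shadow_def)
    then have "card (shadow i ?F) \<le> card (shadow i F' - {?w})"
      using fin_shadow[OF tF'] by (intro card_mono) auto
    also have "\<dots> < card (shadow i F')"
      using w fin_shadow[OF tF'] by (meson card_Diff1_less)
    \<comment> \<open>Deleting the line removes \<open>?w\<close> from the shadow in direction
      \<open>i\<close> and enlarges no other shadow, so the penalty drops by at least \<tau>, which
      is more than the number of tuples lost.\<close>
    finally have si: "real (card (shadow i ?F)) + 1 \<le> real (card (shadow i F'))" by linarith
    have "(\<Sum>l<r. real (card (shadow l ?F)) + (if l = i then 1 else 0)) \<le> (\<Sum>l<r. real (card (shadow l F')))"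
      using si mono by (intro sum_mono) auto
    then have "(\<Sum>l<r. real (card (shadow l ?F))) + 1 \<le> (\<Sum>l<r. real (card (shadow l F')))"
      using x(2) by (simp add: sum.distrib)
    from mult_left_mono[OF this \<tau>]
    have "\<tau> * (\<Sum>l<r. real (card (shadow l ?F))) + \<tau> \<le> \<tau> * (\<Sum>l<r. real (card (shadow l F')))"
      by (simp add: algebra_simps)
    then have "?\<Phi> F' < ?\<Phi> ?F" using c1 cL by linarith
    moreover have "?\<Phi> ?F \<le> ?\<Phi> F'" using F' by (intro max) auto
    ultimately show False by linarith
  qed
  moreover have "real (card F) - \<tau> * real r * N ^ (r - 1) \<le> real (card F')"
  proof -
    \<comment> \<open>The maximiser is compared with \<open>F\<close> itself, each of whose shadows
      has at most N^(r-1) points.\<close>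
    have "(\<Sum>i<r. real (card (shadow i F))) \<le> (\<Sum>i<r. N ^ (r - 1))"
      using card_shadow_le[OF F] by (intro sum_mono) auto
    from mult_left_mono[OF this \<tau>]
    have "\<tau> * (\<Sum>i<r. real (card (shadow i F))) \<le> \<tau> * real r * N ^ (r - 1)" by simp
    moreover have "0 \<le> \<tau> * (\<Sum>i<r. real (card (shadow i F')))" using \<tau> by (intro mult_nonneg_nonneg sum_nonneg) auto
    ultimately show ?thesis using max[of F] by simp
  qed
  ultimately show ?thesis using F'(1) by blast
qed

end

text \<open>Every common link of \<open>s\<close> vertices placed in coordinate \<open>i\<close> is covered by a set of at most \<open>T\<close>
  vertices. This is what the absence of the forbidden configuration provides.\<close>

locale covered_system = tuple_space V r for V :: "'a set" and r :: nat +
  fixes s T :: nat and S :: "nat \<Rightarrow> 'a list \<Rightarrow> 'a set" and G :: "(nat \<Rightarrow> 'a) set"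
  assumes s3: "s \<ge> 3" and T1: "T \<ge> 1" and G_sub: "G \<subseteq> tuples"
    and S_fin: "i < r \<Longrightarrow> length Y = s \<Longrightarrow> distinct Y \<Longrightarrow> set Y \<subseteq> V \<Longrightarrow> finite (S i Y)"
    and S_card: "i < r \<Longrightarrow> length Y = s \<Longrightarrow> distinct Y \<Longrightarrow> set Y \<subseteq> V \<Longrightarrow> card (S i Y) \<le> T"
    and S_cover: "i < r \<Longrightarrow> length Y = s \<Longrightarrow> distinct Y \<Longrightarrow> (\<And>y. y \<in> set Y \<Longrightarrow> x(i := y) \<in> G) \<Longrightarrow>
      \<exists>j<r. j \<noteq> i \<and> x j \<in> S i Y"
begin

text \<open>The ways to complete \<open>x i\<close> to an \<open>s\<close>-list
  \<open>x i # Y\<close> on its line. With ordered lists the vertex \<open>x i\<close> can be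
  recovered as the head.\<close>

definition ext_lists :: "(nat \<Rightarrow> 'a) set \<Rightarrow> nat \<Rightarrow> (nat \<Rightarrow> 'a) \<Rightarrow> 'a list set" where
  "ext_lists F i x = {Y. length Y = s - 1 \<and> distinct Y \<and> set Y \<subseteq> nbrs F i x - {x i}}"

definition vlists :: "'a list set" where
  "vlists = {Y. length Y = s \<and> distinct Y \<and> set Y \<subseteq> V}"

lemma fin_vlists: "finite vlists"
  unfolding vlists_def by (rule finite_bounded_lists[OF finV])

lemma card_vlists: "real (card vlists) \<le> N ^ s"
  unfolding vlists_def by (rule card_bounded_lists_le[OF finV]) simp

lemma fin_ext_lists: "F \<subseteq> tuples \<Longrightarrow> i < r \<Longrightarrow> finite (ext_lists F i x)"
  unfolding ext_lists_def using fin_nbrs by (intro finite_bounded_lists) auto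

lemma ext_lists_cons:
  assumes "F \<subseteq> G" "x \<in> F" "i < r" "Y \<in> ext_lists F i x"
  shows "x i # Y \<in> vlists" "\<And>y. y \<in> set (x i # Y) \<Longrightarrow> x(i := y) \<in> F"
proof -
  have Ft: "F \<subseteq> tuples" using assms(1) G_sub by blast
  show "x(i := y) \<in> F" if "y \<in> set (x i # Y)" for y
    using that assms by (auto simp: ext_lists_def nbrs_def)
  have "set Y \<subseteq> V" using assms(4) nbrs_sub[OF Ft assms(3), of x] by (auto simp: ext_lists_def)
  moreover have "x i \<in> V" using tuple_mem[OF Ft assms(2,3)] .
  ultimately show "x i # Y \<in> vlists"
    using assms(4) s3 by (auto simp: ext_lists_def vlists_def)
qed

lemma ext_lists_cover:
  assumes "F \<subseteq> G" "x \<in> F" "i < r" "Y \<in> ext_lists F i x"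
  shows "\<exists>j\<in>{..<r}. j \<noteq> i \<and> x j \<in> S i (x i # Y)"
proof -
  have "x(i := y) \<in> G" if "y \<in> set (x i # Y)" for y
    using ext_lists_cons(2)[OF assms that] assms(1) by blast
  then show ?thesis
    using S_cover[of i "x i # Y" x] ext_lists_cons(1)[OF assms] assms(3) by (auto simp: vlists_def)
qed

text \<open>One factor 2 pays for leaving out \<open>x i\<close>, the other for the distinctness of
  the entries.\<close>

lemma card_ext_lists_ge:
  fixes d :: real
  assumes "F \<subseteq> tuples" "i < r" "x \<in> F" "4 * real s \<le> d" "d \<le> real (card (nbrs F i x))"
  shows "(d / 4) ^ (s - 1) \<le> real (card (ext_lists F i x))"
proof -
  have fin: "finite (nbrs F i x)" using fin_nbrs assms by blast
  have "d / 2 \<le> real (card (nbrs F i x - {x i}))"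
    using assms s3 fin self_in_nbrs[OF assms(3), of i] by (simp add: card_Diff_singleton)
  then have "(d / 2 / 2) ^ (s - 1) \<le> real (card (ext_lists F i x))"
    unfolding ext_lists_def
  proof (rule card_distinct_lists_ge[rotated])
    show "real (s - 1) \<le> d / 2 / 2" using assms(4) s3 by linarith
  qed (use fin s3 in auto)
  then show ?thesis by simp
qed

text \<open>Double counting of the pairs \<open>(Y, v)\<close> with \<open>v\<close> in
  \<open>S i Y\<close>. Every list of \<open>A\<close> is in at most \<open>T\<close> of them, while
  \<open>(x i, x j)\<close> receives \<open>(x i # Y, x j)\<close> for at least \<mu> extensions
  \<open>Y\<close>; head and second component tell from which element of the pair shadow such a pair
  comes.\<close>

lemma pair_shadow_ext_count:
  fixes \<mu> :: real
  assumes F: "F \<subseteq> F'" "F' \<subseteq> G" and i: "i < r" and A: "A \<subseteq> vlists"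
    and \<mu>: "\<And>x. x \<in> F \<Longrightarrow> \<mu> \<le> real (card {Y \<in> ext_lists F' i x. x i # Y \<in> A \<and> x j \<in> S i (x i # Y)})"
  shows "real (card (pair_shadow i j F)) * \<mu> \<le> real T * real (card A)"
proof -
  let ?B = "SIGMA Y:A. S i Y"
  have Ft: "F \<subseteq> tuples" "F' \<subseteq> tuples" using F G_sub by blast+
  have finA: "finite A" using A fin_vlists finite_subset by blast
  have finS: "finite (S i Y)" "real (card (S i Y)) \<le> real T" if "Y \<in> A" for Y
    using that A S_fin[OF i, of Y] S_card[OF i, of Y] by (auto simp: vlists_def)
  have finB: "finite ?B" using finA finS by auto
  have "real (card (pair_shadow i j F)) * \<mu> \<le> real (card ?B)"
  proof (rule card_ge_fibres[of _ _ _ "\<lambda>p. (hd (fst p), snd p)"])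
    fix p assume "p \<in> pair_shadow i j F"
    then obtain x where x: "x \<in> F" "p = (x i, x j)" by (auto simp: pair_shadow_def)
    let ?L = "{Y \<in> ext_lists F' i x. x i # Y \<in> A \<and> x j \<in> S i (x i # Y)}"
    have "card ?L = card ((\<lambda>Y. (x i # Y, x j)) ` ?L)" by (simp add: card_image inj_on_def)
    also have "\<dots> \<le> card {q \<in> ?B. (hd (fst q), snd q) = p}"
      using finB x(2) by (intro card_mono) auto
    finally show "\<mu> \<le> real (card {q \<in> ?B. (hd (fst q), snd q) = p})" using \<mu>[OF x(1)] by linarith
  qed (use finB fin_pair_shadow[OF Ft(1)] in auto)
  also have "\<dots> \<le> real (card A) * real T" using finA finS by (intro card_Sigma_le) auto
  finally show ?thesis by (simp add: mult.commute)
qed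

end

section \<open>Regularity of dense systems\<close>

text \<open>With \<open>Q = N\<^bsup>\<epsilon>\<^esup>\<close> the first assumption says \<open>D = N\<^bsup>1 - 1/(s-1) - \<epsilon>\<^esup>\<close>. The exponent \<open>306\<close> is the total
  loss, in powers of \<open>Q\<^bsup>s*s\<^esup>\<close>, of the final estimate in \<open>no_consecutive_clusters\<close>.\<close>

locale dense_system = covered_system V r s T S G
  for V :: "'a set" and r s T :: nat and S :: "nat \<Rightarrow> 'a list \<Rightarrow> 'a set" and G :: "(nat \<Rightarrow> 'a) set" +
  fixes D Q :: real
  assumes DQ: "(D * Q) ^ (s - 1) = N ^ (s - 2)"
    and Q_big: "real (100 * r ^ r * T * (64 * r) ^ s) \<le> Q"
    and D_big: "((Q ^ s) ^ s) ^ 306 < D"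
    and G_upper: "real (card G) \<le> N ^ (r - 1) * D"
    and G_lower: "N ^ (r - 1) * D / 2 \<le> real (card G)"
begin

abbreviation E :: real where "E \<equiv> N ^ (r - 1) * D"

lemma const_le_Q: "real k \<le> Q" if "k \<le> 100 * r ^ r * T * (64 * r) ^ s" for k
  using that Q_big of_nat_mono[OF that, where 'a=real] by linarith

lemma r_pow: "r ^ m \<le> r ^ r" if "m \<le> 3"
  using that r3 by (intro power_increasing) auto

lemma r64_pow: "(64 * r) ^ m \<le> (64 * r) ^ s" if "m \<le> s"
  using that r3 by (intro power_increasing) auto

text \<open>Constants lost later are absorbed by a factor \<open>Q\<close>. Each bound follows from
  \<open>Q_big\<close> by dominating its four factors separately.\<close>

lemma Q_ge: "4 * real r ^ 3 * real T * 8 ^ (s - 1) \<le> Q" "32 * real r ^ 2 \<le> Q" "8 * real s \<le> Q" "1000 \<le> Q"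
  "64 * real r ^ 2 * real T * (64 * real r) ^ (s - 1) \<le> Q" "100 * real r ^ r \<le> Q" "1000 * real r ^ 2 \<le> Q"
  "20 * real r * real T \<le> Q"
proof -
  have r1: "r ^ r \<ge> 1" "r ^ r \<ge> r ^ 3" "r ^ r \<ge> r ^ 2" "r \<le> r ^ r" using r3 r_pow[of 3] r_pow[of 2] r_pow[of 1] by auto
  have s1: "(64 * r) ^ s \<ge> 8 ^ (s - 1)" "(64 * r) ^ s \<ge> (64 * r) ^ (s - 1)" "(64 * r) ^ s \<ge> 64 * r" "(64 * r) ^ s \<ge> s"
  proof -
    show a: "(64 * r) ^ s \<ge> (64 * r) ^ (s - 1)" "(64 * r) ^ s \<ge> 64 * r"
      using r64_pow[of "s - 1"] r64_pow[of 1] s3 by auto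
    have "(8::nat) ^ (s - 1) \<le> (64 * r) ^ (s - 1)" using r3 by (intro power_mono) auto
    then show "(64 * r) ^ s \<ge> 8 ^ (s - 1)" using a by linarith
    have "s < 2 ^ s" by simp
    also have "(2::nat) ^ s \<le> (64 * r) ^ s" using r3 by (intro power_mono) auto
    finally show "(64 * r) ^ s \<ge> s" by simp
  qed
  have m: "a * b * c * d \<le> 100 * r ^ r * T * (64 * r) ^ s" if "a \<le> 100" "b \<le> r ^ r" "c \<le> T" "d \<le> (64 * r) ^ s" for a b c d
    using that by (intro mult_mono) auto
  show "4 * real r ^ 3 * real T * 8 ^ (s - 1) \<le> Q"
    using const_le_Q[OF m[of 4 "r ^ 3" T "8 ^ (s - 1)"]] r1 s1 by simp
  show "32 * real r ^ 2 \<le> Q"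
    using const_le_Q[OF m[of 32 "r ^ 2" 1 1]] r1 s1 T1 r3 by simp
  show "8 * real s \<le> Q"
    using const_le_Q[OF m[of 8 1 1 s]] r1 s1 T1 by simp
  have s64: "64 \<le> (64 * r) ^ s" using s1(3) r3 by linarith
  show "1000 \<le> Q"
    using const_le_Q[OF m[of 100 1 1 64]] r1 s64 T1 by simp
  show "64 * real r ^ 2 * real T * (64 * real r) ^ (s - 1) \<le> Q"
    using const_le_Q[OF m[of 64 "r ^ 2" T "(64 * r) ^ (s - 1)"]] r1 s1 by simp
  show "100 * real r ^ r \<le> Q"
    using const_le_Q[OF m[of 100 "r ^ r" 1 1]] r1 s1 T1 r3 by simp
  show "1000 * real r ^ 2 \<le> Q"
  proof -
    have "6400 * real r ^ 2 \<le> Q" using const_le_Q[OF m[of 100 "r ^ 2" 1 64]] r1 s64 T1 by simp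
    moreover have "0 \<le> real r ^ 2" by simp
    ultimately show ?thesis by linarith
  qed
  show "20 * real r * real T \<le> Q"
    using const_le_Q[OF m[of 20 "r" T 1]] r1 s1 T1 r3 by simp
qed

lemma Q_gt0: "Q > 0" "Q \<ge> 1" using Q_ge(4) by auto

lemma D_ge_Q: "Q ^ m \<le> D" if "m \<le> 100"
proof -
  have "Q ^ m \<le> Q ^ (s * s * 306)"
  proof (rule power_increasing)
    have "1 * 1 * 100 \<le> s * s * 306" using s3 by (intro mult_mono) auto
    then show "m \<le> s * s * 306" using that by simp
  qed (use Q_gt0 in auto)
  also have "\<dots> = ((Q ^ s) ^ s) ^ 306" by (simp add: power_mult)
  finally show ?thesis using D_big by simp
qed

lemma D_gt0: "D > 0" using D_ge_Q[of 1] Q_gt0 by simp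

lemma D_ge1: "D \<ge> 1" using D_ge_Q[of 1] Q_gt0 by simp

lemma N_gt0: "N > 0"
proof (rule ccontr)
  assume "\<not> N > 0"
  then have "(D * Q) ^ (s - 1) = 0" using DQ s3 by simp
  then show False using D_gt0 Q_gt0 by simp
qed

lemma E_gt0: "E > 0" using N_gt0 D_gt0 by simp

lemma card_le_G: "F \<subseteq> G \<Longrightarrow> real (card F) \<le> E"
  using G_upper card_mono[OF fin_sub[OF G_sub]] by (meson of_nat_mono order_trans)

text \<open>Take a subset and a coordinate minimising \<open>|shadow i F| / |F|\<^sup>2\<close>. If this shadow is small, the codegrees in
  coordinate \<open>i\<close> are large, so the cover count makes some pair shadow small; projecting along a third coordinate
  then gives a smaller ratio unless the asserted inequality holds.\<close>

lemma shadow_large: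
  assumes F: "F \<subseteq> G" and big: "8 * real s * N ^ (r - 1) \<le> real (card F)" and i: "i < r"
  shows "(real (card F))\<^sup>2 \<le> real (card (shadow i F)) * (E * D * Q ^ 3)"
proof -
  let ?X = "(Pow F - {{}}) \<times> {..<r}"
  let ?\<rho> = "\<lambda>(F', i'). real (card (shadow i' F')) / (real (card F'))\<^sup>2"
  have tF: "F \<subseteq> tuples" using F G_sub by blast
  have e0: "real (card F) > 0" using big s3 N_gt0
    by (smt (verit) mult_pos_pos of_nat_0_less_iff zero_less_power gr_zeroI numeral_3_eq_3 le_zero_eq nat.simps(3))
  then have Fne: "F \<noteq> {}" by auto
  have "finite (?\<rho> ` ?X)" using fin_sub[OF tF] by (intro finite_imageI finite_cartesian_product) auto
  moreover have "?\<rho> ` ?X \<noteq> {}" using Fne i by blast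
  ultimately have "Min (?\<rho> ` ?X) \<in> ?\<rho> ` ?X" by (rule Min_in)
  then obtain p where "Min (?\<rho> ` ?X) = ?\<rho> p" "p \<in> ?X" by (rule imageE)
  then have p: "p \<in> ?X" "?\<rho> p = Min (?\<rho> ` ?X)" by simp_all
  obtain F' i' where p': "p = (F', i')" by (cases p)
  have F': "F' \<subseteq> F" "F' \<noteq> {}" "i' < r" using p p' by auto
  have min: "real (card (shadow i' F')) / (real (card F'))\<^sup>2 \<le> real (card (shadow k H)) / (real (card H))\<^sup>2"
    if "H \<subseteq> F" "H \<noteq> {}" "k < r" for H k
  proof -
    have "Min (?\<rho> ` ?X) \<le> ?\<rho> (H, k)"
      using that fin_sub[OF tF] by (intro Min_le finite_imageI finite_cartesian_product) auto
    then show ?thesis using p p' by simp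
  qed
  have tF': "F' \<subseteq> tuples" and GF': "F' \<subseteq> G" using F' tF F by auto
  define e where "e = real (card F')"
  define \<sigma> where "\<sigma> = real (card (shadow i' F'))"
  have epos: "e > 0" using F'(2) fin_sub[OF tF'] by (simp add: e_def card_gt_0_iff)
  have \<sigma>pos: "\<sigma> > 0" using F'(2) fin_shadow[OF tF'] by (simp add: \<sigma>_def card_gt_0_iff shadow_def)
  have e_le: "e \<le> real (card F)" unfolding e_def using F' fin_sub[OF tF] by (simp add: card_mono)
  have eE: "e \<le> E" unfolding e_def using card_le_G[OF GF'] .
  \<comment> \<open>Comparing with \<open>(F, i)\<close> and using that \<open>e\<close> is at most
    |F| gives e/\<sigma> >= |F| / N^(r-1), so the average codegree of \<open>F'\<close> is large as
    well.\<close>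
  have d_big: "8 * real s \<le> e / \<sigma>"
  proof -
    have "\<sigma> / e\<^sup>2 \<le> real (card (shadow i F)) / (real (card F))\<^sup>2"
      unfolding e_def \<sigma>_def using min[OF _ Fne i] by simp
    also have "\<dots> \<le> N ^ (r - 1) / (real (card F))\<^sup>2"
      using card_shadow_le[OF tF i] by (intro divide_right_mono) auto
    finally have "\<sigma> * (real (card F))\<^sup>2 \<le> N ^ (r - 1) * e\<^sup>2"
      using epos e0 by (simp add: field_simps)
    also have "\<dots> \<le> N ^ (r - 1) * (e * real (card F))"
      unfolding power2_eq_square using e_le epos N_gt0 by (intro mult_left_mono) auto
    finally have "\<sigma> * real (card F) * real (card F) \<le> N ^ (r - 1) * e * real (card F)"
      by (simp add: power2_eq_square mult_ac)
    then have "\<sigma> * real (card F) \<le> N ^ (r - 1) * e" using e0 by simp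
    moreover have "\<sigma> * (8 * real s * N ^ (r - 1)) \<le> \<sigma> * real (card F)"
      using big \<sigma>pos by (intro mult_left_mono) auto
    ultimately have "(\<sigma> * (8 * real s)) * N ^ (r - 1) \<le> e * N ^ (r - 1)" by (simp add: mult_ac)
    then have "\<sigma> * (8 * real s) \<le> e" using N_gt0 by simp
    then show ?thesis using \<sigma>pos by (simp add: field_simps)
  qed
  \<comment> \<open>Half the average codegree: the lines with at most \<open>d\<close> tuples hold
    at most \<open>\<sigma> * d = e / 2\<close> tuples altogether.\<close>
  define d where "d = e / (2 * \<sigma>)"
  have d4: "4 * real s \<le> d" using d_big by (simp add: d_def)
  define F1 where "F1 = {x \<in> F'. d \<le> real (card (nbrs F' i' x))}"
  have F1: "F1 \<subseteq> F'" "F1 \<subseteq> tuples" "F1 \<subseteq> G" using tF' GF' by (auto simp: F1_def)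
  \<comment> \<open>\<open>F1\<close> is a union of whole lines in direction \<open>i'\<close>, so
    restricting to it leaves the codegrees of its tuples unchanged.\<close>
  have nb1: "nbrs F1 i' x = nbrs F' i' x" if "x \<in> F1" for x
    using that unfolding F1_def nbrs_def[of _ _ x] by auto
  have cF1: "e / 2 \<le> real (card F1)"
  proof -
    let ?H = "F' - F1"
    have tH: "?H \<subseteq> tuples" using tF' by auto
    have "real (card ?H) \<le> real (card (shadow i' ?H)) * d"
    proof (rule card_le_shadow[OF tH])
      fix x assume x: "x \<in> ?H"
      have "card (nbrs ?H i' x) \<le> card (nbrs F' i' x)"
        using fin_nbrs[OF tF' F'(3)] by (intro card_mono nbrs_mono) auto
      then show "real (card (nbrs ?H i' x)) \<le> d" using x by (auto simp: F1_def)
    qed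
    also have "\<dots> \<le> \<sigma> * d"
    proof (rule mult_right_mono)
      have "card (shadow i' ?H) \<le> card (shadow i' F')"
        using fin_shadow[OF tF'] by (intro card_mono) (auto simp: shadow_def)
      then show "real (card (shadow i' ?H)) \<le> \<sigma>" by (simp add: \<sigma>_def)
    qed (use epos \<sigma>pos in \<open>simp add: d_def\<close>)
    also have "\<dots> = e / 2" using \<sigma>pos by (simp add: d_def)
    finally have "real (card ?H) \<le> e / 2" .
    moreover have "card F' = card ?H + card F1"
      using F1(1) fin_sub[OF tF'] by (metis card_Diff_subset card_mono finite_subset le_add_diff_inverse2)
    ultimately show ?thesis by (simp add: e_def)
  qed
  \<comment> \<open>A colour \<open>j\<close> of \<open>x\<close> accounts for a 1/r share of its
    extensions. Repeating \<open>j \<noteq> i'\<close> inside the count makes it zero at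
    \<open>j = i'\<close>, which rules that colour out.\<close>
  define col where "col x j \<longleftrightarrow> j \<noteq> i' \<and>
    card (ext_lists F1 i' x) \<le> r * card {Y \<in> ext_lists F1 i' x. j \<noteq> i' \<and> x j \<in> S i' (x i' # Y)}" for x j
  have ext_big: "(d / 4) ^ (s - 1) \<le> real (card (ext_lists F1 i' x))" if "x \<in> F1" for x
    using that by (intro card_ext_lists_ge[OF F1(2) F'(3) _ d4]) (auto simp: nb1, auto simp: F1_def)
  have dpos: "(d / 4) ^ (s - 1) > 0" using d4 s3 by (intro zero_less_power) (simp add: d_def epos \<sigma>pos)
  have "\<exists>j\<in>{..<r}. col x j" if x: "x \<in> F1" for x
  proof -
    have "\<exists>j\<in>{..<r}. card (ext_lists F1 i' x) \<le> card {..<r} *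
        card {Y \<in> ext_lists F1 i' x. j \<noteq> i' \<and> x j \<in> S i' (x i' # Y)}"
      using ext_lists_cover[OF F1(3) x F'(3)] fin_ext_lists[OF F1(2) F'(3)] r3
      by (intro pigeonhole_cover) (auto simp: lessThan_empty_iff)
    then obtain j where j: "j < r" "card (ext_lists F1 i' x) \<le> r *
        card {Y \<in> ext_lists F1 i' x. j \<noteq> i' \<and> x j \<in> S i' (x i' # Y)}" by auto
    have "card (ext_lists F1 i' x) > 0" using ext_big[OF x] dpos by simp
    then have "j \<noteq> i'" using j(2) by (intro notI) simp
    then show ?thesis using j unfolding col_def by blast
  qed
  then have "\<exists>j\<in>{..<r}. card F1 \<le> card {..<r} * card {x \<in> F1. col x j}"
    using fin_sub[OF F1(2)] r3 by (intro pigeonhole_cover) (auto simp: lessThan_empty_iff)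
  then obtain j where j: "j < r" "card F1 \<le> r * card {x \<in> F1. col x j}" by auto
  define F2 where "F2 = {x \<in> F1. col x j}"
  have F2: "F2 \<subseteq> F1" "F2 \<subseteq> tuples" "F2 \<subseteq> F" using F1 F' by (auto simp: F2_def)
  have cF2: "e / (2 * real r) \<le> real (card F2)"
  proof -
    have "real (card F1) \<le> real r * real (card F2)" using j(2) unfolding F2_def by (rule of_nat_le_mult)
    then have "e \<le> real (card F2) * (2 * real r)" using cF1 by (simp add: mult_ac)
    then show ?thesis using r3 by (simp add: pos_divide_le_eq)
  qed
  have F2ne: "F2 \<noteq> {}" using cF2 epos r3 by (auto simp: divide_le_0_iff)
  then have ji: "j \<noteq> i'" by (auto simp: F2_def col_def)
  have pc: "real (card (pair_shadow i' j F2)) * ((d / 4) ^ (s - 1) / real r) \<le> real T * real (card vlists)"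
  proof (rule pair_shadow_ext_count[OF F2(1) F1(3) F'(3) subset_refl])
    fix x assume x: "x \<in> F2"
    then have x1: "x \<in> F1" by (simp add: F2_def)
    have "{Y \<in> ext_lists F1 i' x. j \<noteq> i' \<and> x j \<in> S i' (x i' # Y)} \<subseteq>
        {Y \<in> ext_lists F1 i' x. x i' # Y \<in> vlists \<and> x j \<in> S i' (x i' # Y)}"
      using ext_lists_cons(1)[OF F1(3) x1 F'(3)] by auto
    then have "card {Y \<in> ext_lists F1 i' x. j \<noteq> i' \<and> x j \<in> S i' (x i' # Y)} \<le>
        card {Y \<in> ext_lists F1 i' x. x i' # Y \<in> vlists \<and> x j \<in> S i' (x i' # Y)}"
      using fin_ext_lists[OF F1(2) F'(3)] by (intro card_mono) auto
    moreover have "card (ext_lists F1 i' x) \<le> r * card {Y \<in> ext_lists F1 i' x. j \<noteq> i' \<and> x j \<in> S i' (x i' # Y)}"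
      using x unfolding F2_def col_def by blast
    ultimately have "card (ext_lists F1 i' x) \<le> r * card {Y \<in> ext_lists F1 i' x. x i' # Y \<in> vlists \<and> x j \<in> S i' (x i' # Y)}"
      by (meson le_trans mult_le_mono2)
    then have "real (card (ext_lists F1 i' x)) \<le> real r * real (card {Y \<in> ext_lists F1 i' x. x i' # Y \<in> vlists \<and> x j \<in> S i' (x i' # Y)})"
      by (rule of_nat_le_mult)
    then show "(d / 4) ^ (s - 1) / real r \<le> real (card {Y \<in> ext_lists F1 i' x. x i' # Y \<in> vlists \<and> x j \<in> S i' (x i' # Y)})"
      using ext_big[OF x1] r3 by (simp add: divide_le_eq mult.commute)
  qed
  \<comment> \<open>A third coordinate exists by \<open>r >= 3\<close>; along it the bound on the
    pair shadow becomes a bound on \<open>shadow k F2\<close>.\<close>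
  obtain k where k: "k < r" "k \<noteq> i'" "k \<noteq> j"
  proof -
    have "card {i', j} \<le> 2" by (simp add: card_insert_if)
    then have "\<not> {..<r} \<subseteq> {i', j}" using r3 card_mono[of "{i', j}" "{..<r}"] by auto
    then show ?thesis using that by auto
  qed
  have up: "real (card (shadow k F2)) * (d / 4) ^ (s - 1) \<le> real r * real T * N ^ s * N ^ (r - 3)"
  proof -
    have "real (card (pair_shadow i' j F2)) * (d / 4) ^ (s - 1) \<le> real r * (real T * real (card vlists))"
      using pc r3 by (simp add: field_simps)
    also have "\<dots> \<le> real r * (real T * N ^ s)" using card_vlists by (intro mult_left_mono) auto
    finally have "(real (card (pair_shadow i' j F2)) * (d / 4) ^ (s - 1)) * N ^ (r - 3) \<le> real r * (real T * N ^ s) * N ^ (r - 3)"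
      by (rule mult_right_mono) simp
    moreover have "real (card (shadow k F2)) * (d / 4) ^ (s - 1) \<le> (real (card (pair_shadow i' j F2)) * N ^ (r - 3)) * (d / 4) ^ (s - 1)"
      using card_shadow_le_pair_shadow[OF F2(2) F'(3) j(1) k(1)] k ji dpos by (intro mult_right_mono) auto
    ultimately show ?thesis by (simp add: mult_ac)
  qed
  \<comment> \<open>Minimality against \<open>(F2, k)\<close>: since \<open>F2\<close> keeps a
    1/(2r) share of \<open>F'\<close>, its shadow has at least a 1/(4 r^2) share of
    \<sigma>.\<close>
  have low: "\<sigma> / (4 * (real r)\<^sup>2) \<le> real (card (shadow k F2))"
  proof -
    have "\<sigma> / e\<^sup>2 \<le> real (card (shadow k F2)) / (real (card F2))\<^sup>2"
      unfolding \<sigma>_def e_def using min[OF F2(3) F2ne k(1)] .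
    also have "\<dots> \<le> real (card (shadow k F2)) / (e / (2 * real r))\<^sup>2"
    proof (intro divide_left_mono power_mono mult_pos_pos zero_less_power)
      have "0 < e / (2 * real r)" using epos r3 by simp
      then show "0 < e / (2 * real r)" "0 \<le> e / (2 * real r)" "0 < real (card F2)" using cF2 by linarith+
    qed (use cF2 in auto)
    also have "\<dots> = real (card (shadow k F2)) * (4 * (real r)\<^sup>2) / e\<^sup>2" by (simp add: power_divide power_mult_distrib)
    finally have "\<sigma> \<le> real (card (shadow k F2)) * (4 * (real r)\<^sup>2)" using epos by (simp add: divide_le_cancel)
    then show ?thesis using r3 by (simp add: divide_le_eq)
  qed
  obtain q where q: "s = Suc (Suc q)" "q \<ge> 1" using s3 by (metis One_nat_def Suc_le_D Suc_le_mono numeral_3_eq_3)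
  let ?C = "4 * real r ^ 3 * real T * 8 ^ (s - 1)"
  have "\<sigma> * (d / 4) ^ (s - 1) \<le> 4 * (real r)\<^sup>2 * (real r * real T * N ^ s * N ^ (r - 3))"
  proof -
    have "\<sigma> / (4 * (real r)\<^sup>2) * (d / 4) ^ (s - 1) \<le> real (card (shadow k F2)) * (d / 4) ^ (s - 1)"
      using low dpos by (intro mult_right_mono) auto
    also note up
    finally show ?thesis using r3 by (simp add: field_simps)
  qed
  moreover have "(d / 4) ^ (s - 1) = (e / \<sigma>) ^ (s - 1) / 8 ^ (s - 1)"
    by (simp add: d_def mult.commute flip: power_divide)
  ultimately have "\<sigma> * ((e / \<sigma>) ^ (s - 1) / 8 ^ (s - 1)) * 8 ^ (s - 1) \<le>
      4 * (real r)\<^sup>2 * (real r * real T * N ^ s * N ^ (r - 3)) * 8 ^ (s - 1)"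
    by (intro mult_right_mono) auto
  then have "\<sigma> * (e / \<sigma>) ^ (s - 1) \<le> ?C * (N ^ s * N ^ (r - 3))"
    by (simp add: power2_eq_square power3_eq_cube mult_ac)
  then have "\<sigma> * (e / \<sigma>) ^ (s - 1) * \<sigma> ^ q \<le> ?C * (N ^ s * N ^ (r - 3)) * \<sigma> ^ q"
    using \<sigma>pos by (intro mult_right_mono) auto
  moreover have "\<sigma> * (e / \<sigma>) ^ (s - 1) * \<sigma> ^ q = e ^ (q + 1)"
    using \<sigma>pos q by (simp add: power_divide)
  ultimately have main1: "e ^ (q + 1) \<le> ?C * (N ^ s * N ^ (r - 3)) * \<sigma> ^ q" by simp
  \<comment> \<open>The relation \<open>DQ\<close> turns N^(s-2) into
    \<open>(D * Q) ^ (s - 1)\<close>; here the particular size of \<open>D\<close> is used.\<close>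
  have "N ^ s * N ^ (r - 3) = N ^ (r - 1) * N ^ q"
  proof -
    have "s + (r - 3) = (r - 1) + q" using r3 q by simp
    then show ?thesis by (metis power_add)
  qed
  also have "N ^ q = (D * Q) ^ (q + 1)" using DQ q by simp
  finally have NN: "N ^ s * N ^ (r - 3) = E * Q * (D * Q) ^ q" by simp
  define K where "K = E * D * Q ^ 3"
  have Kpos: "K > 0" using E_gt0 D_gt0 Q_gt0 by (simp add: K_def)
  have "e\<^sup>2 \<le> ?C * Q * (E * D * Q * \<sigma>)"
  \<comment> \<open>Both sides are raised to the power \<open>q\<close>: \<open>main1\<close>
    supplies e^(q+1), and the remaining factor e^(q-1) is at most E^(q-1).\<close>
  proof (rule power_le_imp_le_base[of _ "q - 1"])
    have C1: "?C * Q \<ge> 1"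
    proof -
      have "1 \<le> ?C" using r3 T1 by (auto intro!: mult_ge1_I)
      then show ?thesis using Q_gt0 by (auto intro!: mult_ge1_I)
    qed
    have "(e\<^sup>2) ^ Suc (q - 1) = e ^ (q + 1) * e ^ (q - 1)"
    proof -
      have "2 * Suc (q - 1) = (q + 1) + (q - 1)" using q by simp
      then show ?thesis by (metis power_add power_mult)
    qed
    also have "\<dots> \<le> (?C * (E * Q * (D * Q) ^ q) * \<sigma> ^ q) * E ^ (q - 1)"
      using main1 eE epos D_gt0 Q_gt0 \<sigma>pos unfolding NN by (intro mult_mono power_mono) auto
    also have "\<dots> = (?C * Q) * (E * D * Q * \<sigma>) ^ q"
      using q by (cases q) (auto simp: power_mult_distrib mult_ac)
    also have "\<dots> \<le> (?C * Q) ^ q * (E * D * Q * \<sigma>) ^ q"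
    proof (rule mult_right_mono)
      show "?C * Q \<le> (?C * Q) ^ q" using self_le_power[OF C1, of q] q by simp
    qed (use E_gt0 D_gt0 Q_gt0 \<sigma>pos in simp)
    also have "\<dots> = (?C * Q * (E * D * Q * \<sigma>)) ^ Suc (q - 1)" using q by (simp add: power_mult_distrib)
    finally show "(e\<^sup>2) ^ Suc (q - 1) \<le> (?C * Q * (E * D * Q * \<sigma>)) ^ Suc (q - 1)" .
  qed (use E_gt0 D_gt0 Q_gt0 \<sigma>pos in simp)
  also have "\<dots> \<le> Q * Q * (E * D * Q * \<sigma>)"
    using Q_ge(1) E_gt0 D_gt0 Q_gt0 \<sigma>pos by (intro mult_right_mono) auto
  also have "\<dots> = \<sigma> * K" by (simp add: K_def power3_eq_cube mult_ac)
  finally have "1 / K \<le> \<sigma> / e\<^sup>2" using Kpos epos by (simp add: field_simps)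
  \<comment> \<open>Minimality once more, to return from \<open>(F', i')\<close> to
    \<open>(F, i)\<close>.\<close>
  also have "\<dots> \<le> real (card (shadow i F)) / (real (card F))\<^sup>2"
    unfolding e_def \<sigma>_def using min[OF _ Fne i] by simp
  finally show ?thesis unfolding K_def[symmetric] using Kpos e0 by (simp add: field_simps)
qed

text \<open>\<open>shadow_large\<close> bounds |F|^2 by (E/Q)^2. If \<open>F\<close> is too small
  for that lemma to apply, then |F| <= Q N^(r-1), and Q^2 <= D suffices.\<close>

lemma small_shadow_imp_small:
  assumes F: "F \<subseteq> G" and i: "i < r" and small: "real (card (shadow i F)) \<le> N ^ (r - 1) / Q ^ 5"
  shows "real (card F) \<le> E / Q"
proof (cases "8 * real s * N ^ (r - 1) \<le> real (card F)")
  case True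
  have "(real (card F))\<^sup>2 \<le> real (card (shadow i F)) * (E * D * Q ^ 3)"
    by (rule shadow_large[OF F True i])
  also have "\<dots> \<le> (N ^ (r - 1) / Q ^ 5) * (E * D * Q ^ 3)"
    using small E_gt0 D_gt0 Q_gt0 by (intro mult_right_mono) auto
  also have "\<dots> = (E / Q)\<^sup>2"
  proof -
    have q: "Q ^ 5 = Q ^ 3 * Q\<^sup>2" by (simp flip: power_add)
    have "n / (c * Q\<^sup>2) * (n * D * D * c) = (n * D / Q)\<^sup>2" if "c \<noteq> 0" for n c :: real
      using that Q_gt0 by (simp add: power2_eq_square)
    from this[of "Q ^ 3" "N ^ (r - 1)"] show ?thesis using Q_gt0 unfolding q by simp
  qed
  finally have sq: "(real (card F))\<^sup>2 \<le> (E / Q)\<^sup>2" .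
  have "0 \<le> E / Q" using E_gt0 Q_gt0(1) by (intro divide_nonneg_nonneg) linarith+
  with sq show ?thesis by (rule power2_le_imp_le)
next
  case False
  then have "real (card F) \<le> 8 * real s * N ^ (r - 1)" by simp
  also have "\<dots> \<le> Q * N ^ (r - 1)" using Q_ge(3) by (intro mult_right_mono) auto
  also have "\<dots> \<le> D / Q * N ^ (r - 1)"
  proof (rule mult_right_mono)
    have "Q * Q \<le> D" using D_ge_Q[of 2] by (simp add: power2_eq_square)
    then show "Q \<le> D / Q" using Q_gt0(1) pos_le_divide_eq by blast
  qed simp
  finally show ?thesis by (simp add: mult.commute)
qed

text \<open>By Markov, the tuples on lines or pairs whose degree exceeds the expected order by a
  factor Q^5 have a shadow of size at most N^(r-1) / Q^5, so there are at most E/Q of them for each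
  direction or pair of directions. Removing all of them costs at most E/16.\<close>

lemma regular_subset:
  "\<exists>G'\<subseteq>G. E / 8 \<le> real (card G') \<and>
     (\<forall>i<r. \<forall>x. real (card (nbrs G' i x)) \<le> D * Q ^ 5) \<and>
     (\<forall>i<r. \<forall>j<r. i \<noteq> j \<longrightarrow> (\<forall>a b. real (card {x \<in> G'. x i = a \<and> x j = b}) \<le> N ^ (r - 3) * D * Q ^ 5))"
proof -
  let ?J = "{(i, j). i < r \<and> j < r \<and> i \<noteq> j}"
  define H where "H i = {x \<in> G. D * Q ^ 5 < real (card (nbrs G i x))}" for i
  define P where "P p = {x \<in> G. N ^ (r - 3) * D * Q ^ 5 <
    real (card {x' \<in> G. x' (fst p) = x (fst p) \<and> x' (snd p) = x (snd p)})}" for p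
  have DQ5: "D * Q ^ 5 > 0" "N ^ (r - 3) * D * Q ^ 5 > 0" using D_gt0 Q_gt0 N_gt0 by auto
  have H: "real (card (H i)) \<le> E / Q" if i: "i < r" for i
  proof (rule small_shadow_imp_small[OF _ i])
    have "real (card (shadow i (H i))) * (D * Q ^ 5) \<le> real (card G)"
      by (rule card_shadow_heavy[OF G_sub]) (auto simp: H_def)
    also note G_upper
    finally have "real (card (shadow i (H i))) * Q ^ 5 * D \<le> N ^ (r - 1) * D" by (simp add: mult_ac)
    then have "real (card (shadow i (H i))) * Q ^ 5 \<le> N ^ (r - 1)"
      using D_gt0 mult_le_cancel_right_pos by blast
    then show "real (card (shadow i (H i))) \<le> N ^ (r - 1) / Q ^ 5" using Q_gt0 by (simp add: field_simps)
  qed (auto simp: H_def)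
  have P: "real (card (P p)) \<le> E / Q" if p: "p \<in> ?J" for p
  proof -
    obtain i j where ij: "p = (i, j)" "i < r" "j < r" "i \<noteq> j" using p by auto
    obtain k where k: "k < r" "k \<noteq> i" "k \<noteq> j"
    proof -
      have "card {i, j} \<le> 2" by (simp add: card_insert_if)
      then have "\<not> {..<r} \<subseteq> {i, j}" using r3 card_mono[of "{i, j}" "{..<r}"] by auto
      then show ?thesis using that by auto
    qed
    have PG: "P p \<subseteq> G" "P p \<subseteq> tuples" using G_sub by (auto simp: P_def)
    show ?thesis
    proof (rule small_shadow_imp_small[OF PG(1) k(1)])
      have "real (card (pair_shadow i j (P p))) * (N ^ (r - 3) * D * Q ^ 5) \<le> real (card G)"
        by (rule card_pair_shadow_heavy[OF G_sub PG(1)]) (auto simp: P_def ij)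
      also note G_upper
      finally have "(real (card (pair_shadow i j (P p))) * N ^ (r - 3)) * Q ^ 5 * D \<le> N ^ (r - 1) * D"
        by (simp add: mult_ac)
      then have "(real (card (pair_shadow i j (P p))) * N ^ (r - 3)) * Q ^ 5 \<le> N ^ (r - 1)"
        using D_gt0 mult_le_cancel_right_pos by blast
      then have "real (card (pair_shadow i j (P p))) * N ^ (r - 3) \<le> N ^ (r - 1) / Q ^ 5"
        using Q_gt0 by (simp add: field_simps)
      moreover have "real (card (shadow k (P p))) \<le> real (card (pair_shadow i j (P p))) * N ^ (r - 3)"
        using k ij by (intro card_shadow_le_pair_shadow[OF PG(2)]) auto
      ultimately show "real (card (shadow k (P p))) \<le> N ^ (r - 1) / Q ^ 5" by linarith
    qed
  qed
  have Jsub: "?J \<subseteq> {..<r} \<times> {..<r}" by auto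
  then have finJ: "finite ?J" by (rule finite_subset) simp
  have cJ: "card ?J \<le> r * r" using card_mono[OF _ Jsub] by (simp add: card_cartesian_product)
  define G' where "G' = G - ((\<Union>i<r. H i) \<union> (\<Union>p\<in>?J. P p))"
  have G'G: "G' \<subseteq> G" "G' \<subseteq> tuples" using G_sub by (auto simp: G'_def)
  have "real (card ((\<Union>i<r. H i) \<union> (\<Union>p\<in>?J. P p))) \<le> E / 16"
  proof -
    have "card ((\<Union>i<r. H i) \<union> (\<Union>p\<in>?J. P p)) \<le> card (\<Union>i<r. H i) + card (\<Union>p\<in>?J. P p)" by (rule card_Un_le)
    also have "\<dots> \<le> (\<Sum>i<r. card (H i)) + (\<Sum>p\<in>?J. card (P p))"
      using finJ by (intro add_mono card_UN_le) auto
    finally have "real (card ((\<Union>i<r. H i) \<union> (\<Union>p\<in>?J. P p))) \<le> real ((\<Sum>i<r. card (H i)) + (\<Sum>p\<in>?J. card (P p)))"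
      by (rule of_nat_mono)
    also have "\<dots> = (\<Sum>i<r. real (card (H i))) + (\<Sum>p\<in>?J. real (card (P p)))" by simp
    also have "\<dots> \<le> (\<Sum>i<r. E / Q) + (\<Sum>p\<in>?J. E / Q)"
      using H P by (intro add_mono sum_mono) auto
    also have "\<dots> = (real r + real (card ?J)) * (E / Q)" by (simp add: algebra_simps)
    also have "\<dots> \<le> (2 * real r ^ 2) * (E / Q)"
    proof (rule mult_right_mono)
      have "real (card ?J) \<le> real r * real r" using cJ by (rule of_nat_le_mult)
      moreover have "real r * 1 \<le> real r * real r" using r3 by (intro mult_left_mono) auto
      ultimately show "real r + real (card ?J) \<le> 2 * real r ^ 2" by (simp add: power2_eq_square)
    qed (use E_gt0 Q_gt0 in simp)
    also have "\<dots> \<le> (Q / 16) * (E / Q)" using Q_ge(2) E_gt0 Q_gt0 by (intro mult_right_mono) auto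
    also have "\<dots> = E / 16" using Q_gt0 by simp
    finally show ?thesis .
  qed
  moreover have "real (card G) \<le> real (card G') + real (card ((\<Union>i<r. H i) \<union> (\<Union>p\<in>?J. P p)))"
  proof -
    have "card G \<le> card (G' \<union> ((\<Union>i<r. H i) \<union> (\<Union>p\<in>?J. P p)))"
    proof (rule card_mono)
      have "G' \<union> ((\<Union>i<r. H i) \<union> (\<Union>p\<in>?J. P p)) \<subseteq> G" by (auto simp: G'_def H_def P_def)
      then show "finite (G' \<union> ((\<Union>i<r. H i) \<union> (\<Union>p\<in>?J. P p)))"
        using fin_sub[OF G_sub] finite_subset by blast
    qed (auto simp: G'_def)
    also have "\<dots> \<le> card G' + card ((\<Union>i<r. H i) \<union> (\<Union>p\<in>?J. P p))" by (rule card_Un_le)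
    finally show ?thesis by linarith
  qed
  ultimately have "E / 8 \<le> real (card G')" using G_lower E_gt0 by simp
  \<comment> \<open>The bound holds for every \<open>x\<close>, not only for tuples of
    \<open>G'\<close>: a nonempty line contains a tuple outside \<open>H i\<close>, and an empty
    line is trivial.\<close>
  moreover have "real (card (nbrs G' i x)) \<le> D * Q ^ 5" if i: "i < r" for i x
  proof (cases "nbrs G' i x = {}")
    case False
    then obtain y where "x(i := y) \<in> G'" by (auto simp: nbrs_def)
    then have "x(i := y) \<in> G" "x(i := y) \<notin> H i" using i by (auto simp: G'_def)
    then have "real (card (nbrs G i x)) \<le> D * Q ^ 5" by (auto simp: H_def)
    moreover have "card (nbrs G' i x) \<le> card (nbrs G i x)"
      using fin_nbrs[OF G_sub i] G'G by (intro card_mono nbrs_mono) auto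
    ultimately show ?thesis by linarith
  qed (use DQ5 in simp)
  moreover have "real (card {x \<in> G'. x i = a \<and> x j = b}) \<le> N ^ (r - 3) * D * Q ^ 5"
    if ij: "i < r" "j < r" "i \<noteq> j" for i j a b
  proof (cases "{x \<in> G'. x i = a \<and> x j = b} = {}")
    case False
    then obtain x where x: "x \<in> G'" "x i = a" "x j = b" by auto
    then have "x \<in> G" "x \<notin> P (i, j)" using ij by (auto simp: G'_def)
    then have "real (card {x' \<in> G. x' i = a \<and> x' j = b}) \<le> N ^ (r - 3) * D * Q ^ 5" using x by (auto simp: P_def)
    moreover have "card {x \<in> G'. x i = a \<and> x j = b} \<le> card {x' \<in> G. x' i = a \<and> x' j = b}"
      using fin_sub[OF G_sub] G'G by (intro card_mono) auto
    ultimately show ?thesis by linarith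
  next
    case True
    then show ?thesis using DQ5 by (simp only: card.empty)
  qed
  ultimately show ?thesis using G'G(1) by blast
qed

end

section \<open>Concentration of links\<close>

locale regular_system = dense_system V r s T S G D Q
  for V :: "'a set" and r s T :: nat and S :: "nat \<Rightarrow> 'a list \<Rightarrow> 'a set" and G :: "(nat \<Rightarrow> 'a) set"
    and D Q :: real +
  fixes G' :: "(nat \<Rightarrow> 'a) set"
  assumes G'G: "G' \<subseteq> G" and G'_lower: "E / 8 \<le> real (card G')"
    and codeg: "i < r \<Longrightarrow> real (card (nbrs G' i x)) \<le> D * Q ^ 5"
    and pairdeg: "i < r \<Longrightarrow> j < r \<Longrightarrow> i \<noteq> j \<Longrightarrow>
      real (card {x \<in> G'. x i = a \<and> x j = b}) \<le> N ^ (r - 3) * D * Q ^ 5"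
begin

text \<open>Counting \<open>(s - 1)\<close>-lists raises a lost factor \<open>Q\<close> to the power
  \<open>s - 1\<close>; \<open>R\<close> absorbs this with one \<open>Q\<close> to spare.\<close>

definition R :: real where "R = Q ^ s"

text \<open>The expected number of tuples through two prescribed entries is E / N^2 = N^(r-3) D;
  this is that number up to a permitted loss.\<close>

abbreviation \<Lambda> :: real where "\<Lambda> \<equiv> N ^ (r - 3) * D / (Q * R)"

text \<open>A relation between vertices in coordinate \<open>i\<close> that depends on one entry
  \<open>c\<close> of coordinate \<open>j\<close>; its neighbourhoods contain the later
  clusters.\<close>

definition close :: "nat \<Rightarrow> nat \<Rightarrow> 'a \<Rightarrow> 'a \<Rightarrow> 'a \<Rightarrow> bool" where
  "close i j c a b \<longleftrightarrow>
     \<Lambda> \<le> real (card {w \<in> shadow i G'. w j = c \<and> w(i := a) \<in> G' \<and> w(i := b) \<in> G'})"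

lemma close_sym: "close i j c a b \<Longrightarrow> close i j c b a"
  unfolding close_def by (simp add: conj_commute)

lemma N_split: "N ^ 2 * N ^ (r - 3) = N ^ (r - 1)"
proof -
  have "2 + (r - 3) = r - 1" using r3 by simp
  then show ?thesis by (metis power_add)
qed

lemma G'_sub: "G' \<subseteq> tuples" using G'G G_sub by blast

lemma R_ge_Q: "Q \<le> R"
  using self_le_power[of Q s] Q_gt0 s3 by (simp add: R_def)

lemma R_ge1: "R \<ge> 1" using R_ge_Q Q_gt0 by simp

lemma R_gt0: "R > 0" using R_ge1 by simp

lemma \<Lambda>_gt0: "\<Lambda> > 0" using N_gt0 D_gt0 Q_gt0 R_gt0 by simp

text \<open>Count the pairs of a line through \<open>c\<close> and \<open>a\<close> and a vertex
  \<open>b\<close> on it. \<open>pairdeg\<close> and \<open>codeg\<close> allow N^(r-3) D^2 Q^10 of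
  them, and every close \<open>b\<close> uses \<Lambda>, which leaves D Q^11 R.\<close>

lemma card_close_le:
  assumes ij: "i < r" "j < r" "i \<noteq> j"
  shows "real (card {b \<in> V. close i j c a b}) \<le> D * R ^ 12"
proof -
  let ?W = "{w \<in> shadow i G'. w j = c \<and> w(i := a) \<in> G'}"
  let ?P = "SIGMA w:?W. nbrs G' i w"
  have finW: "finite ?W" using fin_shadow[OF G'_sub] by simp
  have finP: "finite ?P" using finW fin_nbrs[OF G'_sub ij(1)] by auto
  have "inj_on (\<lambda>w. w(i := a)) ?W"
  proof (rule inj_onI)
    fix w w' assume "w \<in> ?W" "w' \<in> ?W" and eq: "w(i := a) = w'(i := a)"
    then have "w i = undefined" "w' i = undefined" by (auto simp: shadow_def)
    then show "w = w'" using eq by (metis fun_upd_triv fun_upd_upd)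
  qed
  moreover have "(\<lambda>w. w(i := a)) ` ?W \<subseteq> {x \<in> G'. x i = a \<and> x j = c}" using ij by auto
  ultimately have "card ?W \<le> card {x \<in> G'. x i = a \<and> x j = c}"
    using fin_sub[OF G'_sub] by (intro card_inj_on_le) auto
  then have cW: "real (card ?W) \<le> N ^ (r - 3) * D * Q ^ 5" using pairdeg[OF ij, of a c] by linarith
  have "real (card ?P) \<le> real (card ?W) * (D * Q ^ 5)"
    by (rule card_Sigma_le[OF finW]) (rule codeg[OF ij(1)])
  also have "\<dots> \<le> N ^ (r - 3) * D * Q ^ 5 * (D * Q ^ 5)"
    using cW D_gt0 Q_gt0 by (intro mult_right_mono) auto
  finally have cP: "real (card ?P) \<le> N ^ (r - 3) * D * Q ^ 5 * (D * Q ^ 5)" .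
  have "real (card {b \<in> V. close i j c a b}) \<le> real (card ?P) / \<Lambda>"
  proof (rule card_heavy_le[OF _ finP \<Lambda>_gt0])
    fix b assume "b \<in> {b \<in> V. close i j c a b}"
    then have "\<Lambda> \<le> real (card {w \<in> shadow i G'. w j = c \<and> w(i := a) \<in> G' \<and> w(i := b) \<in> G'})" (is "_ \<le> real (card ?L)")
      by (simp add: close_def)
    also have "card ?L = card ((\<lambda>w. (w, b)) ` ?L)" by (simp add: card_image inj_on_def)
    also have "\<dots> \<le> card {p \<in> ?P. snd p = b}"
      using finP by (intro card_mono) (auto simp: nbrs_def)
    finally show "\<Lambda> \<le> real (card {p \<in> ?P. snd p = b})" by simp
  qed (use finV in simp)
  also have "\<dots> \<le> N ^ (r - 3) * D * Q ^ 5 * (D * Q ^ 5) / \<Lambda>"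
    using cP \<Lambda>_gt0 by (intro divide_right_mono) auto
  also have "\<dots> = D * (Q ^ 11 * R)"
  proof -
    have "n * D * q5 * (D * q5) / (n * D / (Q * R)) = D * (q5 * q5 * Q * R)" if "n \<noteq> 0" for n q5 :: real
      using that D_gt0 Q_gt0 R_gt0 by (simp add: field_simps)
    from this[of "N ^ (r - 3)" "Q ^ 5"] show ?thesis using N_gt0 by (simp flip: power_add power_Suc2)
  qed
  also have "\<dots> \<le> D * (R ^ 11 * R)"
    using R_ge_Q D_gt0 Q_gt0 R_ge1 by (intro mult_left_mono mult_right_mono power_mono) auto
  finally show ?thesis by (simp flip: power_Suc2)
qed

text \<open>Once the full list is fixed, a tuple is given by its shadow point, which lies in the
  common link and takes a value of the cover in some coordinate. There are at most
  \<open>r * T\<close> choices of coordinate and value, and each light one leaves fewer than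
  \<open>L\<close> points.\<close>

lemma few_light_extensions:
  assumes F: "F \<subseteq> G" and i: "i < r" and L: "L \<ge> 0"
  shows "real (card {(x, Y). x \<in> F \<and> Y \<in> ext_lists F i x \<and>
      (\<forall>j<r. j \<noteq> i \<and> x j \<in> S i (x i # Y) \<longrightarrow> real (card {w \<in> common_link F i (x i # Y). w j = x j}) < L)})
    \<le> N ^ s * (real r * real T * L)" (is "real (card ?P) \<le> _")
proof -
  have tF: "F \<subseteq> tuples" using F G_sub by blast
  have "real (card ?P) \<le> real (card vlists) * (real r * real T * L)"
  proof (rule card_le_fibres[of _ "\<lambda>p. fst p i # snd p"])
    show "(\<lambda>p. fst p i # snd p) ` ?P \<subseteq> vlists" using ext_lists_cons(1)[OF F _ i] by auto
    fix Y' assume Y': "Y' \<in> vlists"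
    let ?I = "{(j, v). j < r \<and> v \<in> S i Y' \<and> real (card {w \<in> common_link F i Y'. w j = v}) < L}"
    let ?U = "\<Union>p\<in>?I. {w \<in> common_link F i Y'. w (fst p) = snd p}"
    let ?Fb = "{p \<in> ?P. fst p i # snd p = Y'}"
    have S: "finite (S i Y')" "card (S i Y') \<le> T"
      using Y' S_fin[OF i, of Y'] S_card[OF i, of Y'] by (auto simp: vlists_def)
    have Isub: "?I \<subseteq> {..<r} \<times> S i Y'" by auto
    then have finI: "finite ?I" using S(1) by (meson finite_SigmaI finite_lessThan finite_subset)
    have "card ?I \<le> r * card (S i Y')" using card_mono[OF _ Isub] S(1) by (simp add: card_cartesian_product)
    also have "\<dots> \<le> r * T" using S(2) by simp
    finally have cI: "real (card ?I) \<le> real r * real T" by (rule of_nat_le_mult)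
    have finlink: "finite (common_link F i Y')" unfolding common_link_def using fin_shadow[OF tF] by simp
    have "inj_on (\<lambda>p. (fst p)(i := undefined)) ?Fb"
    proof (rule inj_onI)
      fix p q assume p: "p \<in> ?Fb" and q: "q \<in> ?Fb" and eq: "(fst p)(i := undefined) = (fst q)(i := undefined)"
      have "fst p i # snd p = fst q i # snd q" using p q by simp
      then have "snd p = snd q" "fst p i = fst q i" by auto
      moreover have "fst p = fst q" using eq \<open>fst p i = fst q i\<close> by (metis fun_upd_triv fun_upd_upd)
      ultimately show "p = q" by (simp add: prod_eq_iff)
    qed
    moreover have "(\<lambda>p. (fst p)(i := undefined)) ` ?Fb \<subseteq> ?U"
    proof (rule image_subsetI)
      fix p assume p: "p \<in> ?Fb"
      obtain x Y where xY: "p = (x, Y)" by (cases p)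
      have x: "x \<in> F" "Y \<in> ext_lists F i x" "x i # Y = Y'"
        and light: "\<And>j. j < r \<Longrightarrow> j \<noteq> i \<Longrightarrow> x j \<in> S i Y' \<Longrightarrow> real (card {w \<in> common_link F i Y'. w j = x j}) < L"
        using p xY by auto
      obtain j where j: "j < r" "j \<noteq> i" "x j \<in> S i Y'" using ext_lists_cover[OF F x(1) i x(2)] x(3) by auto
      have "x(i := undefined) \<in> common_link F i Y'"
        using x ext_lists_cons(2)[OF F x(1) i x(2)] by (auto simp: common_link_def shadow_def)
      moreover have "(j, x j) \<in> ?I" using light j by simp
      ultimately have "x(i := undefined) \<in> ?U" using j by (intro UN_I[of "(j, x j)"]) auto
      then show "(fst p)(i := undefined) \<in> ?U" by (simp add: xY)
    qed
    moreover have "finite ?U" using finI finlink by auto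
    ultimately have "card ?Fb \<le> card ?U" by (rule card_inj_on_le)
    also have "\<dots> \<le> (\<Sum>p\<in>?I. card {w \<in> common_link F i Y'. w (fst p) = snd p})" by (rule card_UN_le[OF finI])
    finally have "real (card ?Fb) \<le> real (\<Sum>p\<in>?I. card {w \<in> common_link F i Y'. w (fst p) = snd p})" by (rule of_nat_mono)
    also have "\<dots> = (\<Sum>p\<in>?I. real (card {w \<in> common_link F i Y'. w (fst p) = snd p}))" by simp
    also have "\<dots> \<le> (\<Sum>p\<in>?I. L)" by (intro sum_mono) auto
    also have "\<dots> = real (card ?I) * L" by simp
    also have "\<dots> \<le> real r * real T * L" using cI L by (intro mult_right_mono) auto
    finally show "real (card ?Fb) \<le> real r * real T * L" .
  qed (rule fin_vlists)
  also have "\<dots> \<le> N ^ s * (real r * real T * L)"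
    using card_vlists L by (intro mult_right_mono) auto
  finally show ?thesis .
qed

text \<open>Few extensions are light, so for most tuples and every \<open>i\<close> at least half of
  the lists have a heavy cover vertex, a 1/r share of these in a common coordinate \<open>j\<close>.
  All entries of such lists are close to \<open>x i\<close> relative to \<open>x j\<close>, and so
  many lists require many close neighbours. A last pigeonhole over the r^r maps makes the choice
  \<pi> uniform.\<close>

lemma coloured_subset:
  "\<exists>F \<pi>. F \<subseteq> G' \<and> E / Q \<le> real (card F) \<and> (\<forall>i<r. \<pi> i < r \<and> \<pi> i \<noteq> i) \<and>
     (\<forall>x\<in>F. \<forall>i<r. D / Q \<le> real (card {b \<in> nbrs G' i x. close i (\<pi> i) (x (\<pi> i)) (x i) b}))"
proof -
  \<comment> \<open>Cleaning at this level removes at most E/16, half of the guaranteed size of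
    \<open>G'\<close>.\<close>
  define \<tau> where "\<tau> = D / (16 * real r)"
  have \<tau>0: "\<tau> > 0" using D_gt0 r3 by (simp add: \<tau>_def)
  obtain H where H: "H \<subseteq> G'" and mind: "\<And>x i. x \<in> H \<Longrightarrow> i < r \<Longrightarrow> \<tau> \<le> real (card (nbrs H i x))"
    and cH: "real (card G') - \<tau> * real r * N ^ (r - 1) \<le> real (card H)"
    using min_codegree_subset[OF G'_sub, of \<tau>] \<tau>0 by auto
  have HG: "H \<subseteq> G" and tH: "H \<subseteq> tuples" using H G'G G_sub by auto
  have cH2: "E / 16 \<le> real (card H)"
  proof -
    have "\<tau> * real r * N ^ (r - 1) = E / 16" using r3 by (simp add: \<tau>_def mult.commute)
    then show ?thesis using cH G'_lower by linarith
  qed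
  have \<tau>4: "4 * real s \<le> \<tau>"
  proof -
    have "4 * real s * (16 * real r) = (8 * real s) * (8 * real r)" by simp
    also have "\<dots> \<le> Q * Q"
    proof (rule mult_mono)
      have "real r * 1 \<le> real r * real r" using r3 by (intro mult_left_mono) auto
      then show "8 * real r \<le> Q" using Q_ge(2) by (simp add: power2_eq_square)
    qed (use Q_ge Q_gt0 in auto)
    also have "\<dots> \<le> D" using D_ge_Q[of 2] by (simp add: power2_eq_square)
    finally show ?thesis using r3 by (simp add: \<tau>_def pos_le_divide_eq)
  qed
  have ext_big: "(\<tau> / 4) ^ (s - 1) \<le> real (card (ext_lists H i x))" if "x \<in> H" "i < r" for i x
    using card_ext_lists_ge[OF tH that(2,1) \<tau>4 mind[OF that]] .
  define hv where "hv i x j Y \<longleftrightarrow> j \<noteq> i \<and> x j \<in> S i (x i # Y) \<and>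
    \<Lambda> \<le> real (card {w \<in> common_link H i (x i # Y). w j = x j})" for i x j Y
  define unc where "unc i x = {Y \<in> ext_lists H i x. \<forall>j<r. \<not> hv i x j Y}" for i x
  define bad where "bad i = {x \<in> H. card (ext_lists H i x) < 2 * card (unc i x)}" for i
  have fin_ext: "finite (ext_lists H i x)" if "i < r" for i x using fin_ext_lists[OF tH that] .
  define p where "p = (\<tau> / 4) ^ (s - 1)"
  have p0: "p > 0" using \<tau>0 by (simp add: p_def)
  have card_bad: "real r * real (card (bad i)) \<le> E / 32" if i: "i < r" for i
  proof -
    let ?P = "{(x, Y). x \<in> H \<and> Y \<in> ext_lists H i x \<and>
      (\<forall>j<r. j \<noteq> i \<and> x j \<in> S i (x i # Y) \<longrightarrow> real (card {w \<in> common_link H i (x i # Y). w j = x j}) < \<Lambda>)}"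
    have finbad: "finite (bad i)" using fin_sub[OF tH] by (simp add: bad_def)
    have "real (card (bad i)) * (p / 2) \<le> real (card (SIGMA x:bad i. unc i x))"
    proof (rule card_Sigma_ge[OF finbad])
      show "finite (unc i x)" for x using fin_ext[OF i] by (simp add: unc_def)
      fix x assume x: "x \<in> bad i"
      then show "p / 2 \<le> real (card (unc i x))" using ext_big[of x i] i by (simp add: bad_def p_def)
    qed
    also have "\<dots> \<le> real (card ?P)"
    proof -
      have "finite (SIGMA x:H. ext_lists H i x)" using fin_sub[OF tH] fin_ext[OF i] by auto
      then have "finite ?P" by (rule rev_finite_subset) auto
      then show ?thesis by (intro of_nat_mono card_mono) (auto simp: bad_def unc_def hv_def)
    qed
    also have "\<dots> \<le> N ^ s * (real r * real T * \<Lambda>)"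
      by (rule few_light_extensions[OF HG i]) (use \<Lambda>_gt0 in linarith)
    finally have 1: "real (card (bad i)) * (p / 2) \<le> N ^ s * (real r * real T * \<Lambda>)" .
    define C where "C = (64 * real r) ^ (s - 1)"
    have C0: "C > 0" using r3 by (simp add: C_def)
    have p: "p = D ^ (s - 1) / C" by (simp add: p_def C_def \<tau>_def power_divide)
    \<comment> \<open>By \<open>DQ\<close> the factor D^(s-1) cancels against \<open>p\<close>, and
      Q^(s-1) against the \<open>R\<close> in \<Lambda>, which leaves a constant times E /
      Q^2.\<close>
    have N: "N ^ s = N ^ 2 * D ^ (s - 1) * Q ^ (s - 1)"
    proof -
      have "2 + (s - 2) = s" using s3 by simp
      then have "N ^ s = N ^ 2 * N ^ (s - 2)" by (metis power_add)
      then show ?thesis using DQ by (simp add: power_mult_distrib)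
    qed
    have Rq: "R = Q ^ (s - 1) * Q" unfolding R_def using s3 by (cases s) auto
    have "real (card (bad i)) * (D ^ (s - 1) / C / 2) \<le> N ^ 2 * D ^ (s - 1) * Q ^ (s - 1) * (real r * real T * \<Lambda>)"
      using 1 unfolding p N .
    also have "\<dots> = 2 * C * N ^ 2 * Q ^ (s - 1) * (real r * real T * \<Lambda>) * (D ^ (s - 1) / C / 2)"
      using C0 by simp
    finally have "real (card (bad i)) \<le> 2 * C * N ^ 2 * Q ^ (s - 1) * (real r * real T * \<Lambda>)"
      by (rule mult_right_le_imp_le) (use C0 D_gt0 in simp)
    also have "\<dots> = (2 * C * real r * real T) * (N ^ 2 * N ^ (r - 3) * D) / Q ^ 2"
      using Q_gt0 by (simp add: Rq field_simps power2_eq_square)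
    also have "N ^ 2 * N ^ (r - 3) = N ^ (r - 1)" by (rule N_split)
    finally have "real r * real (card (bad i)) \<le> real r * ((2 * C * real r * real T) * E / Q ^ 2)"
      by (rule mult_left_mono) simp
    also have "\<dots> = (64 * real r ^ 2 * real T * C) * E / (32 * Q ^ 2)" by (simp add: power2_eq_square mult_ac)
    also have "\<dots> \<le> Q * E / (32 * Q ^ 2)"
      using Q_ge(5) E_gt0 Q_gt0 unfolding C_def by (intro divide_right_mono mult_right_mono) auto
    also have "\<dots> = E / (32 * Q)" using Q_gt0 by (simp add: power2_eq_square)
    also have "\<dots> \<le> E / (32 * 1)" using E_gt0 Q_gt0 by (intro divide_left_mono mult_left_mono) auto
    finally show ?thesis by simp
  qed
  define H' where "H' = H - (\<Union>i<r. bad i)"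
  have H'H: "H' \<subseteq> H" by (auto simp: H'_def)
  have cH': "E / 32 \<le> real (card H')"
  proof -
    have finU: "finite (\<Union>i<r. bad i)" using fin_sub[OF tH] by (auto simp: bad_def)
    have "card H \<le> card (H' \<union> (\<Union>i<r. bad i))"
      using finU fin_sub[OF tH] by (intro card_mono) (auto simp: H'_def)
    also have "\<dots> \<le> card H' + card (\<Union>i<r. bad i)" by (rule card_Un_le)
    also have "card (\<Union>i<r. bad i) \<le> (\<Sum>i<r. card (bad i))" by (rule card_UN_le) simp
    finally have "real (card H) \<le> real (card H' + (\<Sum>i<r. card (bad i)))" by (simp only: of_nat_le_iff)
    also have "\<dots> = real (card H') + (\<Sum>i<r. real (card (bad i)))" by simp
    also have "(\<Sum>i<r. real (card (bad i))) \<le> (\<Sum>i<r. E / 32 / real r)"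
    proof (rule sum_mono)
      fix i assume "i \<in> {..<r}"
      then show "real (card (bad i)) \<le> E / 32 / real r" using card_bad[of i] r3 by (simp add: field_simps)
    qed
    also have "\<dots> = E / 32" using r3 by simp
    finally show ?thesis using cH2 by simp
  qed
  have choose: "\<exists>j. j < r \<and> j \<noteq> i \<and> D / Q \<le> real (card {b \<in> nbrs G' i x. close i j (x j) (x i) b})"
    if x: "x \<in> H'" and i: "i < r" for x i
  proof -
    have xH: "x \<in> H" and "x \<notin> bad i" using x i by (auto simp: H'_def)
    then have nb: "2 * card (unc i x) \<le> card (ext_lists H i x)" by (simp add: bad_def not_less)
    let ?A = "ext_lists H i x - unc i x"
    have "\<exists>j\<in>{..<r}. card ?A \<le> card {..<r} * card {Y \<in> ?A. hv i x j Y}"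
      using fin_ext[OF i] r3 by (intro pigeonhole_cover) (auto simp: unc_def lessThan_empty_iff)
    then obtain j where j: "j < r" "card ?A \<le> r * card {Y \<in> ?A. hv i x j Y}" by auto
    have "card ?A = card (ext_lists H i x) - card (unc i x)"
      using fin_ext[OF i] by (intro card_Diff_subset) (auto simp: unc_def)
    then have "real (card (ext_lists H i x)) \<le> 2 * real (card ?A)" using nb by linarith
    moreover have "real (card ?A) \<le> real r * real (card {Y \<in> ?A. hv i x j Y})" using j(2) by (rule of_nat_le_mult)
    ultimately have low: "p \<le> 2 * real r * real (card {Y \<in> ?A. hv i x j Y})"
      using ext_big[OF xH i] unfolding p_def by linarith
    then have "{Y \<in> ?A. hv i x j Y} \<noteq> {}" using p0 by (metis card.empty mult_zero_right not_less of_nat_0)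
    then have ji: "j \<noteq> i" by (auto simp: hv_def)
    let ?B = "{b \<in> nbrs G' i x. close i j (x j) (x i) b}"
    have finB: "finite ?B" using fin_nbrs[OF G'_sub i] by simp
    have "{Y \<in> ?A. hv i x j Y} \<subseteq> {Y. length Y = s - 1 \<and> distinct Y \<and> set Y \<subseteq> ?B}"
    proof
      fix Y assume "Y \<in> {Y \<in> ?A. hv i x j Y}"
      then have Y: "Y \<in> ext_lists H i x" and h: "\<Lambda> \<le> real (card {w \<in> common_link H i (x i # Y). w j = x j})"
        by (auto simp: hv_def)
      have "close i j (x j) (x i) b" if b: "b \<in> set Y" for b
      proof -
        have "{w \<in> common_link H i (x i # Y). w j = x j} \<subseteq>
            {w \<in> shadow i G'. w j = x j \<and> w(i := x i) \<in> G' \<and> w(i := b) \<in> G'}"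
          using H b by (auto simp: common_link_def shadow_def)
        then have "card {w \<in> common_link H i (x i # Y). w j = x j} \<le>
            card {w \<in> shadow i G'. w j = x j \<and> w(i := x i) \<in> G' \<and> w(i := b) \<in> G'}"
          using fin_shadow[OF G'_sub] by (intro card_mono) auto
        then show ?thesis using h unfolding close_def by linarith
      qed
      moreover have "set Y \<subseteq> nbrs G' i x" using Y nbrs_mono[OF H, of i x] by (auto simp: ext_lists_def)
      ultimately show "Y \<in> {Y. length Y = s - 1 \<and> distinct Y \<and> set Y \<subseteq> ?B}"
        using Y by (auto simp: ext_lists_def)
    qed
    then have "card {Y \<in> ?A. hv i x j Y} \<le> card {Y. length Y = s - 1 \<and> distinct Y \<and> set Y \<subseteq> ?B}"
      using finite_bounded_lists[OF finB] by (rule card_mono[rotated])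
    then have "real (card {Y \<in> ?A. hv i x j Y}) \<le> real (card ?B) ^ (s - 1)"
      using card_bounded_lists_le[OF finB order_refl, of "s - 1"] by linarith
    then have pB: "p \<le> 2 * real r * real (card ?B) ^ (s - 1)"
      using low by (meson mult_left_mono of_nat_0_le_iff mult_nonneg_nonneg order_trans zero_le_numeral)
    \<comment> \<open>Otherwise \<open>?B\<close> would carry fewer than p/(2r) lists, since
      \<tau>/(8r) is \<tau>/4 divided by 2r and the exponent \<open>s - 1\<close> is at least
      1.\<close>
    have "\<tau> / (8 * real r) \<le> real (card ?B)"
    proof (rule ccontr)
      assume "\<not> ?thesis"
      then have "real (card ?B) ^ (s - 1) < (\<tau> / (8 * real r)) ^ (s - 1)"
        using s3 by (intro power_strict_mono) auto
      then have "2 * real r * real (card ?B) ^ (s - 1) < 2 * real r * (\<tau> / (8 * real r)) ^ (s - 1)"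
        using r3 by (intro mult_strict_left_mono) auto
      also have "(\<tau> / (8 * real r)) ^ (s - 1) = p / (2 * real r) ^ (s - 1)"
      proof -
        have eq: "\<tau> / (8 * real r) = (\<tau> / 4) / (2 * real r)" by simp
        show ?thesis unfolding p_def eq by (rule power_divide)
      qed
      also have "2 * real r * (p / (2 * real r) ^ (s - 1)) = 2 * real r * p / (2 * real r) ^ (s - 1)" by simp
      also have "\<dots> \<le> 2 * real r * p / (2 * real r) ^ 1"
        using r3 s3 p0 by (intro divide_left_mono power_increasing) auto
      also have "\<dots> = p" using r3 by simp
      finally show False using pB by linarith
    qed
    moreover have "D / Q \<le> \<tau> / (8 * real r)"
    proof -
      have "\<tau> / (8 * real r) = D / (128 * real r ^ 2)" by (simp add: \<tau>_def power2_eq_square)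
      moreover have "D / Q \<le> D / (128 * real r ^ 2)"
      proof (rule divide_left_mono)
        have "0 \<le> real r ^ 2" by simp
        then show "128 * real r ^ 2 \<le> Q" using Q_ge(7) by linarith
      qed (use D_gt0 Q_gt0 r3 in auto)
      ultimately show ?thesis by simp
    qed
    ultimately show ?thesis using j(1) ji by (intro exI[of _ j]) linarith
  qed
  let ?J = "PiE {..<r} (\<lambda>_. {..<r})"
  let ?ok = "\<lambda>x f. \<forall>i<r. f i \<noteq> i \<and> D / Q \<le> real (card {b \<in> nbrs G' i x. close i (f i) (x (f i)) (x i) b})"
  have J: "finite ?J" "card ?J = r ^ r" by (auto simp: card_PiE intro: finite_PiE)
  have "\<exists>f\<in>?J. ?ok x f" if x: "x \<in> H'" for x
  proof -
    obtain f where f: "\<And>i. i < r \<Longrightarrow> f i < r \<and> f i \<noteq> i \<and> D / Q \<le> real (card {b \<in> nbrs G' i x. close i (f i) (x (f i)) (x i) b})"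
      using choose[OF x] by metis
    then show ?thesis by (intro bexI[of _ "restrict f {..<r}"]) auto
  qed
  moreover have "?J \<noteq> {}" using r3 J(2) by (metis card.empty not_numeral_le_zero power_eq_0_iff)
  moreover have "finite H'" using fin_sub[OF tH] H'H finite_subset by blast
  ultimately have "\<exists>f\<in>?J. card H' \<le> card ?J * card {x \<in> H'. ?ok x f}"
    using J(1) by (intro pigeonhole_cover) auto
  then obtain f where f: "f \<in> ?J" "card H' \<le> r ^ r * card {x \<in> H'. ?ok x f}" unfolding J(2) by blast
  define F where "F = {x \<in> H'. ?ok x f}"
  have cF: "E / Q \<le> real (card F)"
  proof -
    have "real (card H') \<le> real (r ^ r) * real (card F)" using f(2) unfolding F_def by (rule of_nat_le_mult)
    then have "E / 32 \<le> real r ^ r * real (card F)" using cH' by simp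
    also have "\<dots> \<le> (Q / 32) * real (card F)" using Q_ge(6) Q_gt0 by (intro mult_right_mono) auto
    finally show ?thesis using Q_gt0 by (simp add: field_simps)
  qed
  have "F \<noteq> {}" using cF E_gt0 Q_gt0 by (metis card.empty divide_pos_pos not_less of_nat_0)
  then have "\<forall>i<r. f i < r \<and> f i \<noteq> i" using f(1) by (auto simp: F_def)
  moreover have "\<forall>x\<in>F. \<forall>i<r. D / Q \<le> real (card {b \<in> nbrs G' i x. close i (f i) (x (f i)) (x i) b})"
    by (auto simp: F_def)
  moreover have "F \<subseteq> G'" using H'H H by (auto simp: F_def)
  ultimately show ?thesis using cF by blast
qed

subsection \<open>Clusters\<close>

text \<open>The next level of loss: counting lists turns powers of \<open>R\<close> into powers of
  \<open>W\<close>, and \<open>D_big\<close> reads W^306 < D.\<close>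

definition W :: real where "W = R ^ s"

lemma W_ge_R: "R \<le> W"
  using self_le_power[of R s] R_ge1 s3 by (simp add: W_def)

lemma W_ge1: "W \<ge> 1" using W_ge_R R_ge1 by linarith

lemma R_big: "1000 \<le> R" "1000 * real r ^ 2 \<le> R" "20 * real r * real T \<le> R" "8 * real s \<le> R"
  using Q_ge R_ge_Q by linarith+

lemma r_le: "real r \<le> R / 1000"
proof -
  have "real r * 1 \<le> real r * real r" using r3 by (intro mult_left_mono) auto
  then show ?thesis using R_big(2) by (simp add: power2_eq_square)
qed

text \<open>For each value \<open>c\<close> of coordinate \<open>j\<close>, the labels \<open>\<phi> c\<close> partition part of \<open>V\<close> into small classes, and all
  tuples of \<open>F\<close> on a line in direction \<open>i\<close> have their \<open>i\<close>-th entries in the same class. Unlike the colouring, this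
  is inherited by subsets.\<close>

definition clustered :: "nat \<Rightarrow> nat \<Rightarrow> (nat \<Rightarrow> 'a) set \<Rightarrow> ('a \<Rightarrow> 'a \<Rightarrow> 'a option) \<Rightarrow> ((nat \<Rightarrow> 'a) \<Rightarrow> 'a) \<Rightarrow> bool" where
  "clustered i j F \<phi> \<psi> \<longleftrightarrow>
     (\<forall>x\<in>F. \<phi> (x j) (x i) = Some (\<psi> (x(i := undefined)))) \<and>
     (\<forall>c l. real (card {a \<in> V. \<phi> c a = Some l}) \<le> D * R ^ 12)"

lemma clustered_mono: "clustered i j F \<phi> \<psi> \<Longrightarrow> F' \<subseteq> F \<Longrightarrow> clustered i j F' \<phi> \<psi>"
  unfolding clustered_def by blast

text \<open>Choose random centres \<open>P\<close> and keep the tuples for which \<open>P\<close>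
  meets the close set of \<open>x i\<close> together with the line of \<open>x\<close> in exactly
  one vertex \<open>b\<close>, this being a close neighbour on the line. Then \<open>b\<close> can
  be read off from \<open>(x j, x i)\<close>, which defines \<phi>, and from the line alone, which
  defines \<psi>. A class consists of vertices close to its centre, hence is small.\<close>

lemma clustered_subset:
  assumes F: "F \<subseteq> G'" and ij: "i < r" "j < r" "i \<noteq> j"
    and many: "\<And>x. x \<in> F \<Longrightarrow> D / Q \<le> real (card {b \<in> nbrs G' i x. close i j (x j) (x i) b})"
  shows "\<exists>F'\<subseteq>F. \<exists>\<phi> \<psi>. clustered i j F' \<phi> \<psi> \<and> real (card F) / R ^ 14 \<le> real (card F')"
proof -
  define \<Delta> where "\<Delta> = D * R ^ 12"
  \<comment> \<open>\<open>U x\<close> has at most \<open>2 * \<Delta>\<close> elements, so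
    \<open>M >= 4 * \<Delta>\<close> makes \<open>P\<close> sparse enough for
    \<open>isolating_set_exists\<close>.\<close>
  define M where "M = nat \<lceil>4 * \<Delta>\<rceil>"
  define \<Gamma> where "\<Gamma> c a = {b \<in> V. close i j c a b}" for c a
  define U where "U x = \<Gamma> (x j) (x i) \<union> nbrs G' i x" for x
  define Tg where "Tg x = {b \<in> nbrs G' i x. close i j (x j) (x i) b}" for x
  have tF: "F \<subseteq> tuples" using F G'_sub by blast
  have \<Delta>1: "\<Delta> \<ge> 1" unfolding \<Delta>_def using D_ge1 R_ge1 by (simp add: mult_ge1_I)
  have M: "4 * \<Delta> \<le> real M" "real M \<le> 5 * \<Delta>" unfolding M_def using \<Delta>1 by linarith+
  have M0: "M > 0" using M \<Delta>1 by (intro gr0I) simp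
  have \<Gamma>: "real (card (\<Gamma> c a)) \<le> \<Delta>" for c a
    unfolding \<Gamma>_def \<Delta>_def by (rule card_close_le[OF ij])
  have U_card: "2 * card (U x) \<le> M" for x
  proof -
    have "card (U x) \<le> card (\<Gamma> (x j) (x i)) + card (nbrs G' i x)" unfolding U_def by (rule card_Un_le)
    then have "real (card (U x)) \<le> real (card (\<Gamma> (x j) (x i))) + real (card (nbrs G' i x))" by linarith
    also have "\<dots> \<le> \<Delta> + D * Q ^ 5" by (rule add_mono[OF \<Gamma> codeg[OF ij(1)]])
    also have "D * Q ^ 5 \<le> \<Delta>"
    proof -
      have "Q ^ 5 \<le> R ^ 5" using R_ge_Q Q_gt0 by (intro power_mono) auto
      also have "\<dots> \<le> R ^ 12" using R_ge1 by (intro power_increasing) auto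
      finally show ?thesis unfolding \<Delta>_def using D_gt0 by (intro mult_left_mono) auto
    qed
    finally show ?thesis using M(1) by linarith
  qed
  have "\<exists>P\<subseteq>V. real (card F) * (D / Q) / (2 * real M) \<le> real (card {x \<in> F. \<exists>b\<in>Tg x. P \<inter> U x = {b}})"
  proof (rule isolating_set_exists[OF finV fin_sub[OF tF] M0])
    show "U x \<subseteq> V" for x using nbrs_sub[OF G'_sub ij(1), of x] by (auto simp: U_def \<Gamma>_def)
    then show "Tg x \<subseteq> U x" for x by (auto simp: Tg_def U_def)
    show "D / Q \<le> real (card (Tg x))" if "x \<in> F" for x unfolding Tg_def by (rule many[OF that])
  qed (rule U_card)
  then obtain P where P: "P \<subseteq> V"
    "real (card F) * (D / Q) / (2 * real M) \<le> real (card {x \<in> F. \<exists>b\<in>Tg x. P \<inter> U x = {b}})" by blast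
  define F' where "F' = {x \<in> F. \<exists>b\<in>Tg x. P \<inter> U x = {b}}"
  define \<phi> where "\<phi> c a = (if \<exists>b. P \<inter> \<Gamma> c a = {b} then Some (THE b. P \<inter> \<Gamma> c a = {b}) else None)" for c a
  define \<psi> where "\<psi> w = (THE b. P \<inter> nbrs G' i w = {b})" for w
  have "clustered i j F' \<phi> \<psi>"
    unfolding clustered_def
  proof (intro conjI ballI allI)
    fix x assume "x \<in> F'"
    then obtain b where b: "b \<in> nbrs G' i x" "close i j (x j) (x i) b" "P \<inter> U x = {b}"
      by (auto simp: F'_def Tg_def)
    have bV: "b \<in> V" using b(1) nbrs_sub[OF G'_sub ij(1), of x] by blast
    have 1: "P \<inter> \<Gamma> (x j) (x i) = {b}" and 2: "P \<inter> nbrs G' i x = {b}"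
      using b bV unfolding U_def \<Gamma>_def by auto
    have "\<phi> (x j) (x i) = Some b" unfolding \<phi>_def 1 by auto
    moreover have "\<psi> (x(i := undefined)) = b" unfolding \<psi>_def nbrs_upd 2 by auto
    ultimately show "\<phi> (x j) (x i) = Some (\<psi> (x(i := undefined)))" by simp
  next
    fix c l
    have "close i j c l a" if a: "\<phi> c a = Some l" for a
    proof -
      obtain b where b: "P \<inter> \<Gamma> c a = {b}" using a unfolding \<phi>_def by (auto split: if_splits)
      then have "b = l" using a unfolding \<phi>_def by auto
      then show ?thesis using b close_sym unfolding \<Gamma>_def by blast
    qed
    then have "card {a \<in> V. \<phi> c a = Some l} \<le> card {a \<in> V. close i j c l a}"
      using finV by (intro card_mono) auto
    then show "real (card {a \<in> V. \<phi> c a = Some l}) \<le> D * R ^ 12"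
      using card_close_le[OF ij, of c l] by linarith
  qed
  moreover have "real (card F) / R ^ 14 \<le> real (card F')"
  proof -
    \<comment> \<open>The share kept is at least 1 / (10 Q R^12), and 10 Q <= R^2.\<close>
    have "real (card F) / R ^ 14 \<le> real (card F) * (D / Q) / (10 * \<Delta>)"
    proof -
      have "10 * Q * R ^ 12 \<le> R * R * R ^ 12"
        using R_big(1) R_ge_Q Q_gt0 by (intro mult_right_mono mult_mono) auto
      also have "\<dots> = R ^ 14" by (simp add: eval_nat_numeral)
      finally have "1 / R ^ 14 \<le> 1 / (10 * Q * R ^ 12)"
        using Q_gt0 R_gt0 by (intro divide_left_mono) auto
      also have "\<dots> = (D / Q) / (10 * \<Delta>)" using D_gt0 by (simp add: \<Delta>_def)
      finally have "real (card F) * (1 / R ^ 14) \<le> real (card F) * ((D / Q) / (10 * \<Delta>))"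
        by (rule mult_left_mono) simp
      then show ?thesis by simp
    qed
    also have "\<dots> \<le> real (card F) * (D / Q) / (2 * real M)"
      using M M0 \<Delta>1 D_gt0 Q_gt0 by (intro divide_left_mono mult_nonneg_nonneg mult_pos_pos) auto
    also note P(2)
    finally show ?thesis unfolding F'_def .
  qed
  moreover have "F' \<subseteq> F" by (auto simp: F'_def)
  ultimately show ?thesis by blast
qed

text \<open>Count the pairs \<open>(x, a)\<close> for which replacing \<open>x i\<close> by
  \<open>a\<close> keeps the label \<psi>. Given the resulting point \<open>w\<close>, the entry
  \<open>x j\<close> lies in the class of \<open>\<phi> (w k)\<close> labelled
  \<open>\<psi> w\<close>, and \<open>x i\<close> on a line of \<open>G'\<close>: at most D R^12
  times D Q^5 choices. Reading \<open>x k\<close> off \<open>w\<close> requires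
  \<open>k \<noteq> i\<close>, which is why \<pi> must not be an involution.\<close>

lemma small_fibres:
  assumes F: "F \<subseteq> G'" and ijk: "i < r" "j < r" "k < r" "i \<noteq> j" "j \<noteq> k" "i \<noteq> k"
    and cl: "clustered j k F \<phi> \<psi>"
  shows "real (card {x \<in> F. D * R ^ 50 < real (card {a \<in> V. \<psi> (x(i := a, j := undefined)) = \<psi> (x(j := undefined))})})
    \<le> E / R ^ 33"
proof -
  define A where "A x = {a \<in> V. \<psi> (x(i := a, j := undefined)) = \<psi> (x(j := undefined))}" for x
  let ?B = "{x \<in> F. D * R ^ 50 < real (card (A x))}"
  let ?P = "SIGMA x:F. A x"
  have tF: "F \<subseteq> tuples" using F G'_sub by blast
  have finF: "finite F" using fin_sub[OF tF] .
  have finA: "finite (A x)" for x using finV by (simp add: A_def)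
  let ?T = "PiE ({..<r} - {j}) (\<lambda>_. V)"
  have finT: "finite ?T" using finV by (intro finite_PiE) auto
  have "real (card ?P) \<le> real (card ?T) * (D * R ^ 12 * (D * Q ^ 5))"
  proof (rule card_le_fibres[of _ "\<lambda>p. (fst p)(i := snd p, j := undefined)", OF finT])
    show "(\<lambda>p. (fst p)(i := snd p, j := undefined)) ` ?P \<subseteq> ?T"
    proof (rule image_subsetI)
      fix p assume p: "p \<in> ?P"
      then have "fst p \<in> F" "snd p \<in> V" by (auto simp: A_def)
      then have "fst p \<in> tuples" "snd p \<in> V" using tF by blast+
      then show "(fst p)(i := snd p, j := undefined) \<in> ?T"
        using ijk by (auto simp: PiE_iff extensional_def)
    qed
    fix w assume "w \<in> ?T"
    let ?Fb = "{p \<in> ?P. (fst p)(i := snd p, j := undefined) = w}"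
    let ?C = "SIGMA b:{b \<in> V. \<phi> (w k) b = Some (\<psi> w)}. nbrs G' i (w(j := b))"
    have finC: "finite ?C" using finV fin_nbrs[OF G'_sub ijk(1)] by auto
    have fb: "(fst p) l = w l" if "p \<in> ?Fb" "l \<noteq> i" "l \<noteq> j" for p l
      using that by (auto split: prod.splits)
    have fbi: "snd p = w i" if "p \<in> ?Fb" for p
    proof -
      have "w = (fst p)(i := snd p, j := undefined)" using that by simp
      then show ?thesis using ijk by simp
    qed
    have "inj_on (\<lambda>p. (fst p j, fst p i)) ?Fb"
    proof (rule inj_onI)
      fix p q assume p: "p \<in> ?Fb" and q: "q \<in> ?Fb" and eq: "(fst p j, fst p i) = (fst q j, fst q i)"
      have "fst p = fst q"
      proof
        fix l show "fst p l = fst q l" using fb[OF p, of l] fb[OF q, of l] eq by (cases "l = i"; cases "l = j") auto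
      qed
      moreover have "snd p = w i" "snd q = w i" using fbi p q by blast+
      ultimately show "p = q" by (simp add: prod_eq_iff)
    qed
    moreover have "(\<lambda>p. (fst p j, fst p i)) ` ?Fb \<subseteq> ?C"
    proof (rule image_subsetI)
      fix p assume p: "p \<in> ?Fb"
      obtain x a where xa: "p = (x, a)" by (cases p)
      have x: "x \<in> F" and a: "a \<in> A x" and w: "w = x(i := a, j := undefined)" using p xa by auto
      have "\<phi> (x k) (x j) = Some (\<psi> (x(j := undefined)))" using cl x by (auto simp: clustered_def)
      then have "\<phi> (w k) (x j) = Some (\<psi> w)" using a w ijk by (auto simp: A_def)
      moreover have "x j \<in> V" using tuple_mem[OF tF x ijk(2)] .
      moreover have "w(j := x j, i := x i) = x" using w ijk by auto
      then have "x i \<in> nbrs G' i (w(j := x j))" using x F by (auto simp: nbrs_def)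
      ultimately show "(fst p j, fst p i) \<in> ?C" by (simp add: xa)
    qed
    ultimately have "card ?Fb \<le> card ?C" using finC by (intro card_inj_on_le)
    then have "real (card ?Fb) \<le> real (card ?C)" by simp
    also have "\<dots> \<le> real (card {b \<in> V. \<phi> (w k) b = Some (\<psi> w)}) * (D * Q ^ 5)"
      using finV codeg[OF ijk(1)] by (intro card_Sigma_le) auto
    also have "\<dots> \<le> D * R ^ 12 * (D * Q ^ 5)"
      using cl D_gt0 Q_gt0 by (intro mult_right_mono) (auto simp: clustered_def)
    finally show "real (card ?Fb) \<le> D * R ^ 12 * (D * Q ^ 5)" .
  qed
  also have "real (card ?T) = N ^ (r - 1)" using card_partial_tuples[of "{j}"] ijk by simp
  finally have up: "real (card ?P) \<le> N ^ (r - 1) * (D * R ^ 12 * (D * Q ^ 5))" .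
  have "real (card ?B) * (D * R ^ 50) \<le> real (card (SIGMA x:?B. A x))"
    using finF finA by (intro card_Sigma_ge) auto
  also have "\<dots> \<le> real (card ?P)" using finF finA by (intro of_nat_mono card_mono) auto
  also note up
  also have "N ^ (r - 1) * (D * R ^ 12 * (D * Q ^ 5)) = E * (D * R ^ 12) * Q ^ 5" by (simp add: mult_ac)
  also have "\<dots> \<le> E * (D * R ^ 12) * R ^ 5"
    using E_gt0 D_gt0 R_ge_Q R_ge1 Q_gt0 by (intro mult_left_mono power_mono) auto
  also have "\<dots> = E / R ^ 33 * (D * R ^ 50)"
  proof -
    have "R ^ 12 * R ^ 5 * R ^ 33 = R ^ 50" by (simp only: power_add[symmetric]) simp
    moreover have "R ^ 33 > 0" using R_gt0 by simp
    ultimately have "R ^ 12 * R ^ 5 = R ^ 50 / R ^ 33" by (intro eq_divide_imp) simp_all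
    then show ?thesis by (simp add: mult_ac)
  qed
  finally have "real (card ?B) \<le> E / R ^ 33"
    by (rule mult_right_le_imp_le) (use D_gt0 R_gt0 in simp)
  then show ?thesis unfolding A_def .
qed

text \<open>By \<open>cl1\<close> the extensions of \<open>x\<close> in direction \<open>i\<close>
  stay in one class determined by \<open>x i\<close> and \<open>x j\<close>; by \<open>cl2\<close>
  they stay in one small fibre determined by \<open>x\<close> without its \<open>j\<close>-th entry.
  Hence for most lists the link has about N^(r-3) D points at each of about \<open>D\<close> entries
  in coordinate \<open>j\<close>. There are too few such lists for the N^2 D^(s-1), up to powers of
  \<open>W\<close>, that the cover count demands.\<close>

lemma no_consecutive_clusters:
  assumes F: "F \<subseteq> G'" and cF: "E / R ^ 29 \<le> real (card F)"
    and ijk: "i < r" "j < r" "k < r" "i \<noteq> j" "j \<noteq> k" "i \<noteq> k"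
    and cl1: "clustered i j F \<phi>\<^sub>1 \<psi>\<^sub>1" and cl2: "clustered j k F \<phi>\<^sub>2 \<psi>\<^sub>2"
  shows False
proof -
  have R0: "R > 0" and W0: "W > 0" using R_ge1 W_ge1 by linarith+
  define fib where "fib w = {a \<in> V. \<psi>\<^sub>2 (w(i := a)) = \<psi>\<^sub>2 w}" for w
  have fib_eq: "{a \<in> V. \<psi>\<^sub>2 (x(i := a, j := undefined)) = \<psi>\<^sub>2 (x(j := undefined))} = fib (x(j := undefined))" for x
    unfolding fib_def using ijk by (simp add: fun_upd_twist)
  let ?B = "{x \<in> F. D * R ^ 50 < real (card (fib (x(j := undefined))))}"
  have cB: "real (card ?B) \<le> E / R ^ 33"
    using small_fibres[OF F ijk cl2] unfolding fib_eq .
  define F3 where "F3 = F - ?B"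
  have tF: "F \<subseteq> tuples" using F G'_sub by blast
  have F3: "F3 \<subseteq> F" "F3 \<subseteq> tuples" using tF by (auto simp: F3_def)
  have cF3: "E / R ^ 29 / 2 \<le> real (card F3)"
  proof -
    have "card F3 = card F - card ?B" unfolding F3_def using fin_sub[OF tF] by (intro card_Diff_subset) auto
    then have "real (card F) - real (card ?B) \<le> real (card F3)" by linarith
    moreover have "E / R ^ 33 \<le> E / R ^ 29 / 2"
    proof -
      have "R ^ 29 * 2 \<le> R ^ 29 * R ^ 4"
      proof (rule mult_left_mono)
        have "2 \<le> R" using R_big(1) by linarith
        also have "R \<le> R ^ 4" using R_ge1 by (intro self_le_power) auto
        finally show "2 \<le> R ^ 4" .
      qed (use R0 in simp)
      also have "\<dots> = R ^ 33" by (simp only: power_add[symmetric]) simp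
      finally have "E / R ^ 33 \<le> E / (R ^ 29 * 2)"
        using E_gt0 R0 by (intro divide_left_mono) auto
      then show ?thesis by simp
    qed
    ultimately show ?thesis using cF cB by linarith
  qed
  \<comment> \<open>Since 1 + r <= R^2 / 2, cleaning at this level still keeps E / R^31
    tuples.\<close>
  define \<tau> where "\<tau> = D / R ^ 31"
  have \<tau>0: "\<tau> \<ge> 0" unfolding \<tau>_def using D_gt0 R0 by simp
  obtain H where H: "H \<subseteq> F3" and mind: "\<And>x l. x \<in> H \<Longrightarrow> l < r \<Longrightarrow> \<tau> \<le> real (card (nbrs H l x))"
    and cH: "real (card F3) - \<tau> * real r * N ^ (r - 1) \<le> real (card H)"
    using min_codegree_subset[OF F3(2) \<tau>0] by auto
  have HF: "H \<subseteq> F" and HG': "H \<subseteq> G'" and HG: "H \<subseteq> G" and tH: "H \<subseteq> tuples"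
    using H F3 F G'G tF by auto
  have cH31: "E / R ^ 31 \<le> real (card H)"
  proof -
    have "E / R ^ 31 + \<tau> * real r * N ^ (r - 1) = E / R ^ 31 * (1 + real r)"
      by (simp add: \<tau>_def algebra_simps add_divide_distrib)
    also have "\<dots> \<le> E / R ^ 31 * (R ^ 2 / 2)"
    proof (rule mult_left_mono)
      have "1 + real r \<le> R / 2" using r_le R_big(1) by linarith
      also have "\<dots> \<le> R ^ 2 / 2" using R_ge1 by (simp add: self_le_power)
      finally show "1 + real r \<le> R ^ 2 / 2" .
    qed (use E_gt0 R0 in simp)
    also have "\<dots> = E / R ^ 29 / 2"
    proof -
      have eq: "R ^ 31 = R ^ 29 * R ^ 2" by (simp only: power_add[symmetric]) simp
      have "e / (a * b) * (b / 2) = e / a / 2" if "b \<noteq> 0" for e a b :: real using that by simp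
      then show ?thesis unfolding eq using R0 by (metis less_irrefl zero_less_power)
    qed
    finally show ?thesis using cH cF3 by linarith
  qed
  have R32: "R * R ^ 31 = R ^ 32" using power_Suc[of R 31] by simp
  have cW: "R ^ m \<le> W ^ m" for m using W_ge_R R0 by (intro power_mono) auto
  have Ws: "(R ^ m) ^ (s - 1) \<le> W ^ m" for m
  proof -
    have "(R ^ m) ^ (s - 1) = (R ^ (s - 1)) ^ m" by (simp only: power_mult[symmetric] mult.commute)
    also have "\<dots> \<le> W ^ m" unfolding W_def using R_ge1 by (intro power_mono power_increasing) auto
    finally show ?thesis .
  qed
  have Dbig: "W ^ 306 < D" using D_big by (simp add: W_def R_def)
  have \<tau>4: "4 * real s \<le> \<tau>"
  proof -
    have "4 * real s * R ^ 31 \<le> R * R ^ 31" using R_big(4) R0 by (intro mult_right_mono) auto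
    also have "\<dots> = R ^ 32" by (rule R32)
    also have "\<dots> \<le> W ^ 32" by (rule cW)
    also have "\<dots> \<le> W ^ 306" using W_ge1 by (intro power_increasing) auto
    finally show ?thesis using Dbig R0 by (simp add: \<tau>_def pos_le_divide_eq)
  qed
  define p where "p = (\<tau> / 4) ^ (s - 1)"
  have p_low: "D ^ (s - 1) / W ^ 32 \<le> p"
  proof -
    have "D ^ (s - 1) / W ^ 32 \<le> D ^ (s - 1) / (R ^ 32) ^ (s - 1)"
      using Ws[of 32] D_gt0 R0 W0 by (intro divide_left_mono) auto
    also have "\<dots> = (D / R ^ 32) ^ (s - 1)" by (simp add: power_divide)
    also have "\<dots> \<le> p" unfolding p_def
    proof (rule power_mono)
      have "4 * R ^ 31 \<le> R ^ 32" unfolding R32[symmetric] using R_big(1) R0 by (intro mult_right_mono) auto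
      then have "D / R ^ 32 \<le> D / (4 * R ^ 31)" using D_gt0 R0 by (intro divide_left_mono) auto
      then show "D / R ^ 32 \<le> \<tau> / 4" by (simp add: \<tau>_def mult.commute)
    qed (use D_gt0 R0 in simp)
    finally show ?thesis .
  qed
  have p0: "p > 0" using p_low D_gt0 W0 by (meson divide_pos_pos less_le_trans zero_less_power)
  have ext_big: "p \<le> real (card (ext_lists H i x))" if "x \<in> H" for x
    unfolding p_def using card_ext_lists_ge[OF tH ijk(1) that \<tau>4 mind[OF that ijk(1)]] .
  have fin_ext: "finite (ext_lists H i x)" for x using fin_ext_lists[OF tH ijk(1)] .
  \<comment> \<open>115 = 50 + 65: counting lists loses at most W^50, and the remaining W^65 = W^32
    W^33 pays for the W^32 in \<open>p_low\<close> and leaves W^33 to beat the size E / R^31 of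
    \<open>H\<close>.\<close>
  define L where "L = N ^ (r - 3) * D / W ^ 115"
  define \<theta> where "\<theta> = D / W ^ 115"
  have L0: "L > 0" and \<theta>0: "\<theta> > 0" unfolding L_def \<theta>_def using N_gt0 D_gt0 W0 by auto
  define lk where "lk Y b = {w \<in> common_link H i Y. w j = b}" for Y b
  \<comment> \<open>For a shadow point \<open>w\<close> in direction \<open>j\<close>: the entries
    \<open>b\<close> that can stand at \<open>j\<close> for the entire list \<open>w i # Y\<close>
    and carry a heavy part of its link.\<close>
  define NB where "NB w Y = {b \<in> V. (\<forall>y\<in>set (w i # Y). w(j := b, i := y) \<in> H) \<and> L \<le> real (card (lk (w i # Y) b))}" for w Y
  have finlk: "finite (lk Y b)" for Y b
    unfolding lk_def common_link_def using fin_shadow[OF tH] by simp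
  have finNB: "finite (NB w Y)" for w Y unfolding NB_def using finV by simp
  define X where "X = (SIGMA x:H. ext_lists H i x)"
  have finX: "finite X" unfolding X_def using fin_sub[OF tH] fin_ext by auto
  \<comment> \<open>An extension fails in one of two ways: its link is light at \<open>x j\<close>,
    or it is heavy there but at too few entries on the same line in direction
    \<open>j\<close>.\<close>
  define P1 where "P1 = {(x, Y) \<in> X. real (card (lk (x i # Y) (x j))) < L}"
  define P2 where "P2 = {(x, Y) \<in> X. L \<le> real (card (lk (x i # Y) (x j))) \<and>
    real (card (NB (x(j := undefined)) Y)) < \<theta>}"
  have ext_mem: "x(i := y) \<in> H" if "x \<in> H" "Y \<in> ext_lists H i x" "y \<in> set (x i # Y)" for x Y y
    using ext_lists_cons(2)[OF HG that(1) ijk(1) that(2,3)] .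
  have in_lk: "x(i := undefined) \<in> lk (x i # Y) (x j)" if "x \<in> H" "Y \<in> ext_lists H i x" for x Y
    unfolding lk_def common_link_def shadow_def using that ext_mem[OF that] ijk by auto
  \<comment> \<open>Given \<open>x i\<close> and \<open>x j\<close>, the first clustering confines
    \<open>Y\<close> to one class; what remains to be chosen is a point of a light link.\<close>
  have cP1: "real (card P1) \<le> N ^ 2 * (D * R ^ 12) ^ (s - 1) * L"
  proof -
    let ?cls = "\<lambda>p. {a \<in> V. \<phi>\<^sub>1 (snd p) a = \<phi>\<^sub>1 (snd p) (fst p) \<and> \<phi>\<^sub>1 (snd p) (fst p) \<noteq> None}"
    let ?C = "SIGMA p:V \<times> V. {Y. length Y = s - 1 \<and> distinct Y \<and> set Y \<subseteq> ?cls p}"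
    have cls: "real (card (?cls p)) \<le> D * R ^ 12" for p
    proof (cases "\<phi>\<^sub>1 (snd p) (fst p)")
      case None
      then show ?thesis using D_gt0 R0 by simp
    next
      case (Some l)
      then show ?thesis using cl1 by (auto simp: clustered_def)
    qed
    have finC: "finite ?C" using finV by (intro finite_SigmaI finite_bounded_lists) auto
    have "real (card P1) \<le> real (card ?C) * L"
    proof (rule card_le_fibres[of _ "\<lambda>q. ((fst q i, fst q j), snd q)", OF finC])
      show "(\<lambda>q. ((fst q i, fst q j), snd q)) ` P1 \<subseteq> ?C"
      proof (rule image_subsetI)
        fix q assume q: "q \<in> P1"
        obtain x Y where xY: "q = (x, Y)" by (cases q)
        have x: "x \<in> H" and Y: "Y \<in> ext_lists H i x" using q xY by (auto simp: P1_def X_def)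
        have "\<phi>\<^sub>1 (x j) y = Some (\<psi>\<^sub>1 (x(i := undefined)))" if y: "y \<in> set (x i # Y)" for y
        proof -
          have "x(i := y) \<in> F" using ext_mem[OF x Y y] HF by blast
          then have "\<phi>\<^sub>1 ((x(i := y)) j) ((x(i := y)) i) = Some (\<psi>\<^sub>1 ((x(i := y))(i := undefined)))"
            using cl1 unfolding clustered_def by blast
          then show ?thesis using ijk by simp
        qed
        then have "set Y \<subseteq> ?cls (x i, x j)"
          using ext_lists_cons(1)[OF HG x ijk(1) Y] by (auto simp: vlists_def)
        moreover have "x i \<in> V" "x j \<in> V" using tuple_mem[OF tH x] ijk by auto
        ultimately show "((fst q i, fst q j), snd q) \<in> ?C" using Y by (auto simp: xY ext_lists_def)
      qed
      fix c assume "c \<in> ?C"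
      let ?Fb = "{q \<in> P1. ((fst q i, fst q j), snd q) = c}"
      show "real (card ?Fb) \<le> L"
      proof (cases "?Fb = {}")
        case False
        then obtain x0 Y0 where x0: "(x0, Y0) \<in> P1" "c = ((x0 i, x0 j), Y0)" by auto
        have "inj_on (\<lambda>q. (fst q)(i := undefined)) ?Fb"
        proof (rule inj_onI)
          fix q q' assume q: "q \<in> ?Fb" and q': "q' \<in> ?Fb" and eq: "(fst q)(i := undefined) = (fst q')(i := undefined)"
          have "((fst q i, fst q j), snd q) = ((fst q' i, fst q' j), snd q')" using q q' by simp
          then have "fst q i = fst q' i" "snd q = snd q'" by auto
          moreover have "fst q = fst q'" using eq \<open>fst q i = fst q' i\<close> by (metis fun_upd_triv fun_upd_upd)
          ultimately show "q = q'" by (simp add: prod_eq_iff)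
        qed
        moreover have "(\<lambda>q. (fst q)(i := undefined)) ` ?Fb \<subseteq> lk (x0 i # Y0) (x0 j)"
        proof (rule image_subsetI)
          fix q assume q: "q \<in> ?Fb"
          obtain x Y where xY: "q = (x, Y)" by (cases q)
          have x: "x \<in> H" and Y: "Y \<in> ext_lists H i x" using q xY by (auto simp: P1_def X_def)
          have "x i = x0 i" "x j = x0 j" "Y = Y0" using q xY x0(2) by auto
          then show "(fst q)(i := undefined) \<in> lk (x0 i # Y0) (x0 j)" using in_lk[OF x Y] xY by simp
        qed
        ultimately have "card ?Fb \<le> card (lk (x0 i # Y0) (x0 j))" using finlk by (rule card_inj_on_le)
        moreover have "real (card (lk (x0 i # Y0) (x0 j))) < L" using x0(1) by (simp add: P1_def)
        ultimately show ?thesis by linarith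
      next
        case True
        show ?thesis using L0 unfolding True by simp
      qed
    qed
    also have "real (card ?C) \<le> real (card (V \<times> V)) * (D * R ^ 12) ^ (s - 1)"
      using finV cls by (intro card_Sigma_le card_bounded_lists_le) auto
    also have "real (card (V \<times> V)) = N ^ 2" by (simp add: card_cartesian_product power2_eq_square)
    finally show ?thesis using L0 by simp
  qed
  \<comment> \<open>Given the line in direction \<open>j\<close>, the second clustering confines
    \<open>Y\<close> to \<open>fib\<close>, and \<open>x j\<close> is one of fewer than \<theta>
    entries of \<open>NB\<close>.\<close>
  have cP2: "real (card P2) \<le> N ^ (r - 1) * (D * R ^ 50) ^ (s - 1) * \<theta>"
  proof -
    let ?C = "SIGMA w:shadow j H. {Y. length Y = s - 1 \<and> distinct Y \<and> set Y \<subseteq> fib w}"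
    have finfib: "finite (fib w)" for w using finV by (simp add: fib_def)
    have finC: "finite ?C" using fin_shadow[OF tH] finfib by (intro finite_SigmaI finite_bounded_lists) auto
    have "real (card P2) \<le> real (card ?C) * \<theta>"
    proof (rule card_le_fibres[of _ "\<lambda>q. ((fst q)(j := undefined), snd q)", OF finC])
      show "(\<lambda>q. ((fst q)(j := undefined), snd q)) ` P2 \<subseteq> ?C"
      proof (rule image_subsetI)
        fix q assume q: "q \<in> P2"
        obtain x Y where xY: "q = (x, Y)" by (cases q)
        have x: "x \<in> H" and Y: "Y \<in> ext_lists H i x" using q xY by (auto simp: P2_def X_def)
        \<comment> \<open>Changing entry \<open>i\<close> affects neither \<open>x k\<close> nor
          \<open>x j\<close>, so all these tuples receive the same label.\<close>
        have eq: "Some (\<psi>\<^sub>2 (x(i := y, j := undefined))) = \<phi>\<^sub>2 (x k) (x j)" if y: "y \<in> set (x i # Y)" for y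
        proof -
          have "x(i := y) \<in> F" using ext_mem[OF x Y y] HF by blast
          then have "\<phi>\<^sub>2 ((x(i := y)) k) ((x(i := y)) j) = Some (\<psi>\<^sub>2 ((x(i := y))(j := undefined)))"
            using cl2 unfolding clustered_def by blast
          then show ?thesis using ijk by simp
        qed
        have "y \<in> fib (x(j := undefined))" if y: "y \<in> set Y" for y
        proof -
          have "Some (\<psi>\<^sub>2 (x(i := y, j := undefined))) = Some (\<psi>\<^sub>2 (x(j := undefined)))"
            using eq[of y] eq[of "x i"] y by (metis fun_upd_triv list.set_intros)
          then have "\<psi>\<^sub>2 (x(i := y, j := undefined)) = \<psi>\<^sub>2 (x(j := undefined))" by simp
          moreover have "y \<in> V" using y ext_lists_cons(1)[OF HG x ijk(1) Y] by (auto simp: vlists_def)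
          ultimately show ?thesis using ijk by (simp add: fib_def fun_upd_twist)
        qed
        then show "((fst q)(j := undefined), snd q) \<in> ?C"
          using x Y by (auto simp: xY ext_lists_def shadow_def)
      qed
      fix c assume "c \<in> ?C"
      let ?Fb = "{q \<in> P2. ((fst q)(j := undefined), snd q) = c}"
      show "real (card ?Fb) \<le> \<theta>"
      proof (cases "?Fb = {}")
        case False
        then obtain x0 Y0 where x0: "(x0, Y0) \<in> P2" "c = (x0(j := undefined), Y0)" by auto
        have "inj_on (\<lambda>q. fst q j) ?Fb"
        proof (rule inj_onI)
          fix q q' assume q: "q \<in> ?Fb" and q': "q' \<in> ?Fb" and eq: "fst q j = fst q' j"
          have "((fst q)(j := undefined), snd q) = ((fst q')(j := undefined), snd q')" using q q' by simp
          then have "(fst q)(j := undefined) = (fst q')(j := undefined)" "snd q = snd q'" by auto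
          moreover have "fst q = fst q'" using calculation(1) eq by (metis fun_upd_triv fun_upd_upd)
          ultimately show "q = q'" by (simp add: prod_eq_iff)
        qed
        moreover have "(\<lambda>q. fst q j) ` ?Fb \<subseteq> NB (x0(j := undefined)) Y0"
        proof (rule image_subsetI)
          fix q assume q: "q \<in> ?Fb"
          obtain x Y where xY: "q = (x, Y)" by (cases q)
          have x: "x \<in> H" and Y: "Y \<in> ext_lists H i x" and Lx: "L \<le> real (card (lk (x i # Y) (x j)))"
            using q xY by (auto simp: P2_def X_def)
          have e: "x(j := undefined) = x0(j := undefined)" "Y = Y0" using q xY x0(2) by auto
          have "x j \<in> V" using tuple_mem[OF tH x ijk(2)] .
          moreover have "(x(j := undefined))(j := x j, i := y) \<in> H" if "y \<in> set (x i # Y)" for y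
            using ext_mem[OF x Y that] by simp
          ultimately have "x j \<in> NB (x(j := undefined)) Y" using Lx ijk x unfolding NB_def by simp
          then show "fst q j \<in> NB (x0(j := undefined)) Y0" using e xY by simp
        qed
        ultimately have "card ?Fb \<le> card (NB (x0(j := undefined)) Y0)" using finNB by (rule card_inj_on_le)
        moreover have "real (card (NB (x0(j := undefined)) Y0)) < \<theta>" using x0(1) by (simp add: P2_def)
        ultimately show ?thesis by linarith
      next
        case True
        show ?thesis using \<theta>0 unfolding True by simp
      qed
    qed
    also have "real (card ?C) \<le> real (card (shadow j H)) * (D * R ^ 50) ^ (s - 1)"
    proof (rule card_Sigma_le[OF fin_shadow[OF tH]])
      fix w assume "w \<in> shadow j H"
      then obtain x where x: "x \<in> H" "w = x(j := undefined)" by (auto simp: shadow_def)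
      have "real (card (fib w)) \<le> D * R ^ 50" using x H by (auto simp: F3_def)
      then show "real (card {Y. length Y = s - 1 \<and> distinct Y \<and> set Y \<subseteq> fib w}) \<le> (D * R ^ 50) ^ (s - 1)"
        by (rule card_bounded_lists_le[OF finfib])
    qed
    also have "\<dots> \<le> N ^ (r - 1) * (D * R ^ 50) ^ (s - 1)"
      using card_shadow_le[OF tH ijk(2)] D_gt0 R0 by (intro mult_right_mono) auto
    finally show ?thesis using \<theta>0 by simp
  qed
  have cP: "real (card P1) + real (card P2) \<le> 2 * (E * D ^ (s - 1) / W ^ 65)"
  proof -
    have W65: "W ^ 50 / W ^ 115 = 1 / W ^ 65"
    proof -
      have eq: "W ^ 115 = W ^ 50 * W ^ 65" by (simp only: power_add[symmetric]) simp
      have "b / (b * a) = 1 / a" if "b \<noteq> 0" for a b :: real using that by simp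
      then show ?thesis unfolding eq using W0 by (metis less_irrefl zero_less_power)
    qed
    have pw: "(D * R ^ m) ^ (s - 1) \<le> D ^ (s - 1) * W ^ 50" if "m \<le> 50" for m
    proof -
      have "(D * R ^ m) ^ (s - 1) = D ^ (s - 1) * (R ^ m) ^ (s - 1)" by (rule power_mult_distrib)
      also have "\<dots> \<le> D ^ (s - 1) * W ^ 50"
      proof (rule mult_left_mono)
        have "W ^ m \<le> W ^ 50" using W_ge1 that by (intro power_increasing) auto
        then show "(R ^ m) ^ (s - 1) \<le> W ^ 50" using Ws[of m] by linarith
      qed (use D_gt0 in simp)
      finally show ?thesis .
    qed
    have fin: "D ^ (s - 1) * W ^ 50 * (c / W ^ 115) = c * D ^ (s - 1) / W ^ 65" for c
    proof -
      have "d * a * (c / b) = c * d * (a / b)" for a b d :: real by simp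
      from this[of "D ^ (s - 1)" "W ^ 50" "W ^ 115"] show ?thesis unfolding W65 by simp
    qed
    have "N ^ 2 * (D * R ^ 12) ^ (s - 1) * L \<le> N ^ 2 * (D ^ (s - 1) * W ^ 50) * L"
      using pw[of 12] L0 by (intro mult_right_mono mult_left_mono) auto
    also have "\<dots> = D ^ (s - 1) * W ^ 50 * (N ^ 2 * N ^ (r - 3) * D / W ^ 115)" by (simp add: L_def mult_ac)
    also have "\<dots> = E * D ^ (s - 1) / W ^ 65" unfolding N_split by (rule fin)
    finally have 1: "real (card P1) \<le> E * D ^ (s - 1) / W ^ 65" using cP1 by linarith
    have "N ^ (r - 1) * (D * R ^ 50) ^ (s - 1) * \<theta> \<le> N ^ (r - 1) * (D ^ (s - 1) * W ^ 50) * \<theta>"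
      using pw[of 50] \<theta>0 by (intro mult_right_mono mult_left_mono) auto
    also have "\<dots> = D ^ (s - 1) * W ^ 50 * (E / W ^ 115)" by (simp add: \<theta>_def mult_ac)
    also have "\<dots> = E * D ^ (s - 1) / W ^ 65" by (rule fin)
    finally have "real (card P2) \<le> E * D ^ (s - 1) / W ^ 65" using cP2 by linarith
    from add_mono[OF 1 this] show ?thesis by (simp only: mult_2)
  qed
  define poor where "poor x = {Y \<in> ext_lists H i x. (x, Y) \<in> P1 \<union> P2}" for x
  define bad where "bad = {x \<in> H. card (ext_lists H i x) < 2 * card (poor x)}"
  have cbad: "real (card bad) \<le> E / R ^ 31 / 2"
  proof -
    have "real (card bad) * (p / 2) \<le> real (card (SIGMA x:bad. poor x))"
    proof (rule card_Sigma_ge)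
      show "finite bad" using fin_sub[OF tH] by (simp add: bad_def)
      show "finite (poor x)" for x using fin_ext by (simp add: poor_def)
      show "p / 2 \<le> real (card (poor x))" if "x \<in> bad" for x
        using that ext_big[of x] by (simp add: bad_def)
    qed
    also have "\<dots> \<le> real (card (P1 \<union> P2))"
    proof (intro of_nat_mono card_mono)
      show "finite (P1 \<union> P2)" using finX by (rule rev_finite_subset) (auto simp: P1_def P2_def)
    qed (auto simp: poor_def)
    also have "\<dots> \<le> real (card P1) + real (card P2)" using card_Un_le[of P1 P2] by linarith
    also note cP
    finally have 1: "real (card bad) * (p / 2) \<le> 2 * (E * D ^ (s - 1) / W ^ 65)" .
    have "real (card bad) * (D ^ (s - 1) / W ^ 32 / 2) \<le> real (card bad) * (p / 2)"
      using p_low by (intro mult_left_mono) auto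
    also note 1
    also have "2 * (E * D ^ (s - 1) / W ^ 65) = 4 * E / W ^ 33 * (D ^ (s - 1) / W ^ 32 / 2)"
    proof -
      have eq: "W ^ 65 = W ^ 33 * W ^ 32" by (simp only: power_add[symmetric]) simp
      have "2 * (e * d / (a * b)) = 4 * e / a * (d / b / 2)" for e d a b :: real by simp
      then show ?thesis unfolding eq by blast
    qed
    finally have "real (card bad) \<le> 4 * E / W ^ 33"
      by (rule mult_right_le_imp_le) (use D_gt0 W0 in simp)
    also have "\<dots> \<le> E / (W ^ 31 * 2)"
    proof -
      have W8: "8 \<le> W ^ 2"
      proof -
        have "8 \<le> W" using W_ge_R R_big(1) by linarith
        also have "W \<le> W ^ 2" using W_ge1 by (intro self_le_power) auto
        finally show ?thesis .
      qed
      have "W ^ 33 = W ^ 31 * W ^ 2" by (simp only: power_add[symmetric]) simp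
      then have "4 * E / W ^ 33 = 4 * E / (W ^ 31 * W ^ 2)" by (rule arg_cong)
      also have "\<dots> \<le> 4 * E / (W ^ 31 * 8)"
        using W8 E_gt0 W0 by (intro divide_left_mono mult_left_mono) auto
      finally show ?thesis by (simp add: mult.commute)
    qed
    also have "\<dots> \<le> E / (R ^ 31 * 2)"
      using cW[of 31] E_gt0 R0 W0 by (intro divide_left_mono mult_right_mono) auto
    finally show ?thesis by simp
  qed
  define F5 where "F5 = H - bad"
  have F5H: "F5 \<subseteq> H" by (auto simp: F5_def)
  have cF5: "E / R ^ 31 / 2 \<le> real (card F5)"
  proof -
    have "card F5 = card H - card bad" unfolding F5_def using fin_sub[OF tH]
      by (intro card_Diff_subset) (auto simp: bad_def)
    then have "real (card H) - real (card bad) \<le> real (card F5)" by linarith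
    moreover define u where "u = E / R ^ 31"
    ultimately show ?thesis using cH31 cbad unfolding u_def[symmetric] by linarith
  qed
  \<comment> \<open>The rich lists: \<open>L\<close> points at each of \<theta> entries in
    coordinate \<open>j\<close> give a link of size about N^(r-3) D^2.\<close>
  define A where "A = {Y \<in> vlists. \<theta> * L \<le> real (card (common_link H i Y))}"
  have rich: "x i # Y \<in> A" if x: "x \<in> H" and Y: "Y \<in> ext_lists H i x" and np: "Y \<notin> poor x" for x Y
  proof -
    have nb: "\<theta> \<le> real (card (NB (x(j := undefined)) Y))"
      using x Y np unfolding poor_def P1_def P2_def X_def by (auto simp: not_less)
    have "\<theta> * L \<le> real (card (NB (x(j := undefined)) Y)) * L" using nb L0 by (intro mult_right_mono) auto
    also have "\<dots> \<le> real (card (common_link H i (x i # Y)))"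
    proof (rule card_ge_fibres[of _ _ _ "\<lambda>w. w j"])
      show "finite (common_link H i (x i # Y))" unfolding common_link_def using fin_shadow[OF tH] by simp
      show "finite (NB (x(j := undefined)) Y)" by (rule finNB)
      fix b assume "b \<in> NB (x(j := undefined)) Y"
      then show "L \<le> real (card {w \<in> common_link H i (x i # Y). w j = b})"
        using ijk unfolding NB_def lk_def by simp
    qed
    finally show ?thesis using ext_lists_cons(1)[OF HG x ijk(1) Y] by (simp add: A_def)
  qed
  \<comment> \<open>A line carries at most \<open>(D * Q ^ 5) ^ s\<close> lists, and each rich list
    occurs on at least \<open>\<theta> * L\<close> lines.\<close>
  have cA: "real (card A) \<le> N ^ (r - 1) * (D * Q ^ 5) ^ s / (\<theta> * L)"
  proof -
    let ?P = "SIGMA w:shadow i H. {Y. length Y = s \<and> distinct Y \<and> set Y \<subseteq> nbrs H i w}"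
    have finP: "finite ?P" using fin_shadow[OF tH] fin_nbrs[OF tH ijk(1)]
      by (intro finite_SigmaI finite_bounded_lists) auto
    have "real (card A) \<le> real (card ?P) / (\<theta> * L)"
    proof (rule card_heavy_le[OF _ finP])
      show "finite A" unfolding A_def using fin_vlists by simp
      show "\<theta> * L > 0" using \<theta>0 L0 by simp
      fix Y assume Y: "Y \<in> A"
      have "card (common_link H i Y) = card ((\<lambda>w. (w, Y)) ` common_link H i Y)"
        by (simp add: card_image inj_on_def)
      also have "\<dots> \<le> card {p \<in> ?P. snd p = Y}"
        using finP Y by (intro card_mono) (auto simp: common_link_def nbrs_def A_def vlists_def)
      finally show "\<theta> * L \<le> real (card {p \<in> ?P. snd p = Y})" using Y by (simp add: A_def)
    qed
    also have "\<dots> \<le> N ^ (r - 1) * (D * Q ^ 5) ^ s / (\<theta> * L)"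
    proof (rule divide_right_mono)
      have "real (card ?P) \<le> real (card (shadow i H)) * (D * Q ^ 5) ^ s"
      proof (rule card_Sigma_le[OF fin_shadow[OF tH]])
        fix w
        have "card (nbrs H i w) \<le> card (nbrs G' i w)"
          using fin_nbrs[OF G'_sub ijk(1)] by (intro card_mono nbrs_mono HG')
        then have "real (card (nbrs H i w)) \<le> D * Q ^ 5" using codeg[OF ijk(1), of w] by linarith
        then show "real (card {Y. length Y = s \<and> distinct Y \<and> set Y \<subseteq> nbrs H i w}) \<le> (D * Q ^ 5) ^ s"
          by (rule card_bounded_lists_le[OF fin_nbrs[OF tH ijk(1)]])
      qed
      also have "\<dots> \<le> N ^ (r - 1) * (D * Q ^ 5) ^ s"
        using card_shadow_le[OF tH ijk(1)] D_gt0 Q_gt0 by (intro mult_right_mono) auto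
      finally show "real (card ?P) \<le> N ^ (r - 1) * (D * Q ^ 5) ^ s" .
    qed (use \<theta>0 L0 in simp)
    finally show ?thesis .
  qed
  define good where "good m x = {Y \<in> ext_lists H i x. x i # Y \<in> A \<and> m \<noteq> i \<and> x m \<in> S i (x i # Y)}" for m x
  have "\<exists>m\<in>{..<r}. p / (2 * real r) \<le> real (card (good m x))" if x: "x \<in> F5" for x
  proof -
    have xH: "x \<in> H" and "x \<notin> bad" using x by (auto simp: F5_def)
    then have nb: "2 * card (poor x) \<le> card (ext_lists H i x)" by (simp add: bad_def not_less)
    let ?A = "ext_lists H i x - poor x"
    have "\<exists>m\<in>{..<r}. card ?A \<le> card {..<r} * card {Y \<in> ?A. Y \<in> good m x}"
    proof (rule pigeonhole_cover)
      fix Y assume Y: "Y \<in> ?A"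
      then obtain m where "m < r" "m \<noteq> i" "x m \<in> S i (x i # Y)"
        using ext_lists_cover[OF HG xH ijk(1), of Y] by auto
      then show "\<exists>m\<in>{..<r}. Y \<in> good m x" using Y rich[OF xH] by (auto simp: good_def)
    qed (use fin_ext r3 in \<open>auto simp: lessThan_empty_iff\<close>)
    then obtain m where m: "m < r" "card ?A \<le> r * card {Y \<in> ?A. Y \<in> good m x}" by auto
    have "card ?A = card (ext_lists H i x) - card (poor x)"
      using fin_ext by (intro card_Diff_subset) (auto simp: poor_def)
    then have "real (card (ext_lists H i x)) \<le> 2 * real (card ?A)" using nb by linarith
    moreover have "real (card ?A) \<le> real r * real (card {Y \<in> ?A. Y \<in> good m x})" using m(2) by (rule of_nat_le_mult)
    moreover have "real r * real (card {Y \<in> ?A. Y \<in> good m x}) \<le> real r * real (card (good m x))"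
      using fin_ext by (intro mult_left_mono of_nat_mono card_mono) (auto simp: good_def)
    ultimately have "p \<le> 2 * real r * real (card (good m x))" using ext_big[OF xH] by linarith
    then have "p / (2 * real r) \<le> real (card (good m x))" using r3 by (simp add: divide_le_eq mult.commute)
    then show ?thesis using m(1) by auto
  qed
  moreover have tF5: "F5 \<subseteq> tuples" using F5H tH by blast
  ultimately have "\<exists>m\<in>{..<r}. card F5 \<le> card {..<r} * card {x \<in> F5. p / (2 * real r) \<le> real (card (good m x))}"
    using fin_sub[OF tF5] r3 by (intro pigeonhole_cover) (auto simp: lessThan_empty_iff)
  then obtain m where m: "m < r" "card F5 \<le> r * card {x \<in> F5. p / (2 * real r) \<le> real (card (good m x))}" by auto
  define F6 where "F6 = {x \<in> F5. p / (2 * real r) \<le> real (card (good m x))}"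
  have F6H: "F6 \<subseteq> H" "F6 \<subseteq> tuples" "F6 \<subseteq> G'" using F5H tH HG' by (auto simp: F6_def)
  have cF6: "E / W ^ 33 \<le> real (card F6)"
  proof -
    have "real (card F5) \<le> real r * real (card F6)" using m(2) unfolding F6_def by (rule of_nat_le_mult)
    also have "\<dots> \<le> R / 2 * real (card F6)" using r_le R0 by (intro mult_right_mono) auto
    finally have "E / R ^ 31 / 2 \<le> R / 2 * real (card F6)" using cF5 by linarith
    then have "E / R ^ 31 \<le> real (card F6) * R" by (simp add: mult.commute)
    then have "E / (R ^ 31 * R) \<le> real (card F6)"
      using R0 by (simp only: pos_divide_le_eq divide_divide_eq_left[symmetric])
    moreover have "E / W ^ 33 \<le> E / (R ^ 31 * R)"
    proof (rule divide_left_mono)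
      have "R ^ 31 * R = R ^ 32" using R32 by (simp only: mult.commute)
      also have "\<dots> \<le> W ^ 32" by (rule cW)
      also have "\<dots> \<le> W ^ 33" using W_ge1 by (intro power_increasing) auto
      finally show "R ^ 31 * R \<le> W ^ 33" .
    qed (use E_gt0 R0 W0 in auto)
    ultimately show ?thesis by (rule order_trans[rotated])
  qed
  have mi: "m \<noteq> i"
  proof
    assume "m = i"
    have "E / W ^ 33 > 0" using E_gt0 W0 by simp
    then have "F6 \<noteq> {}" using cF6 by (metis card.empty not_less of_nat_0)
    then obtain x where "x \<in> F6" by auto
    then have "p / (2 * real r) \<le> real (card (good m x))" by (simp add: F6_def)
    moreover have "good m x = {}" using \<open>m = i\<close> by (simp add: good_def)
    moreover have "p / (2 * real r) > 0" using p0 r3 by simp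
    ultimately show False by simp
  qed
  \<comment> \<open>\<open>F6\<close> has size E up to a power of \<open>W\<close> and pair degrees
    are bounded, so up to such a power all N^2 pairs occur.\<close>
  have ps_low: "E / W ^ 33 \<le> real (card (pair_shadow i m F6)) * (N ^ (r - 3) * D * Q ^ 5)"
  proof -
    have "real (card F6) \<le> real (card (pair_shadow i m F6)) * (N ^ (r - 3) * D * Q ^ 5)"
    proof (rule card_le_pair_shadow[OF F6H(2)])
      fix x
      have "card {x' \<in> F6. x' i = x i \<and> x' m = x m} \<le> card {x' \<in> G'. x' i = x i \<and> x' m = x m}"
        using fin_sub[OF G'_sub] F6H(3) by (intro card_mono) auto
      then show "real (card {x' \<in> F6. x' i = x i \<and> x' m = x m}) \<le> N ^ (r - 3) * D * Q ^ 5"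
        using pairdeg[OF ijk(1) m(1) mi[symmetric], of "x i" "x m"] by linarith
    qed
    then show ?thesis using cF6 by linarith
  qed
  have ps_up: "real (card (pair_shadow i m F6)) * (p / (2 * real r)) \<le> real T * real (card A)"
  proof (rule pair_shadow_ext_count[OF F6H(1) HG ijk(1)])
    show "A \<subseteq> vlists" by (auto simp: A_def)
    fix x assume "x \<in> F6"
    then have "p / (2 * real r) \<le> real (card (good m x))" by (simp add: F6_def)
    also have "\<dots> \<le> real (card {Y \<in> ext_lists H i x. x i # Y \<in> A \<and> x m \<in> S i (x i # Y)})"
      using fin_ext by (intro of_nat_mono card_mono) (auto simp: good_def)
    finally show "p / (2 * real r) \<le> real (card {Y \<in> ext_lists H i x. x i # Y \<in> A \<and> x m \<in> S i (x i # Y)})" .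
  qed
  define z where "z = real (card (pair_shadow i m F6))"
  define n where "n = N ^ (r - 3)"
  have n0: "n > 0" using N_gt0 by (simp add: n_def)
  have E_eq: "E = N ^ 2 * n * D" by (simp add: n_def N_split)
  have z_low: "N ^ 2 / W ^ 38 \<le> z"
  proof -
    have Q5: "Q ^ 5 \<le> W ^ 5" using R_ge_Q W_ge_R Q_gt0 by (intro power_mono) auto
    have "N ^ 2 / W ^ 33 * (n * D) \<le> z * (n * D * Q ^ 5)" using ps_low unfolding E_eq z_def n_def by (simp add: mult_ac)
    also have "\<dots> \<le> z * (n * D * W ^ 5)" using Q5 n0 D_gt0 by (intro mult_left_mono) (auto simp: z_def)
    also have "\<dots> = z * W ^ 5 * (n * D)" by simp
    finally have "N ^ 2 / W ^ 33 \<le> z * W ^ 5" by (rule mult_right_le_imp_le) (use n0 D_gt0 in simp)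
    then have "N ^ 2 / W ^ 33 / W ^ 5 \<le> z" using W0 by (simp only: pos_divide_le_eq zero_less_power)
    moreover have "W ^ 38 = W ^ 33 * W ^ 5" by (simp only: power_add[symmetric]) simp
    ultimately show ?thesis by (simp only: divide_divide_eq_left)
  qed
  define d where "d = D ^ (s - 1)"
  have d0: "d > 0" using D_gt0 by (simp add: d_def)
  \<comment> \<open>Comparing the two counts, everything cancels except one factor \<open>D\<close>;
    the losses are 38 + 32 on one side and 1 + 5 + 115 + 115 on the other, together 306.\<close>
  have "N ^ 2 / W ^ 38 * (d / W ^ 32) \<le> z * p"
    using z_low p_low d0 W0 by (intro mult_mono) (auto simp: d_def z_def)
  also have "\<dots> \<le> 2 * real r * real T * real (card A)"
    using ps_up r3 unfolding z_def by (simp add: field_simps)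
  also have "\<dots> \<le> 2 * real r * real T * (N ^ (r - 1) * (D * Q ^ 5) ^ s / (\<theta> * L))"
    using cA by (intro mult_left_mono) auto
  also have "\<dots> \<le> W * (N ^ (r - 1) * (D * Q ^ 5) ^ s / (\<theta> * L))"
  proof (rule mult_right_mono)
    have "0 \<le> real r * real T" by simp
    then show "2 * real r * real T \<le> W" using R_big(3) W_ge_R by linarith
  qed (use D_gt0 Q_gt0 \<theta>0 L0 in simp)
  also have "(D * Q ^ 5) ^ s = d * D * R ^ 5"
  proof -
    have "D ^ s = d * D" using s3 by (cases s) (auto simp: d_def)
    moreover have "(Q ^ 5) ^ s = R ^ 5" unfolding R_def by (simp only: power_mult[symmetric] mult.commute)
    ultimately show ?thesis by (simp add: power_mult_distrib)
  qed
  also have "W * (N ^ (r - 1) * (d * D * R ^ 5) / (\<theta> * L)) \<le> W * (N ^ (r - 1) * (d * D * W ^ 5) / (\<theta> * L))"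
    using cW[of 5] d0 D_gt0 W0 \<theta>0 L0 by (intro mult_left_mono divide_right_mono) auto
  also have "\<dots> = N ^ 2 * d / D * (W * W ^ 5 * W ^ 115 * W ^ 115)"
  proof -
    have "w * (N2 * n * (d * D * w5) / (D / v * (n * D / v))) = N2 * d / D * (w * w5 * v * v)"
      if "v > 0" for w w5 v N2 :: real
      using that D_gt0 n0 by (simp add: field_simps)
    from this[of "W ^ 115" W "N ^ 2" "W ^ 5"] show ?thesis
      using W0 unfolding \<theta>_def L_def n_def[symmetric] by (simp add: n_def N_split)
  qed
  finally have "N ^ 2 * d / (W ^ 38 * W ^ 32) \<le> N ^ 2 * d / D * (W * W ^ 5 * W ^ 115 * W ^ 115)" by simp
  then have "N ^ 2 * d * (1 / (W ^ 38 * W ^ 32)) \<le> N ^ 2 * d * ((W * W ^ 5 * W ^ 115 * W ^ 115) / D)" by simp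
  then have "1 / (W ^ 38 * W ^ 32) \<le> (W * W ^ 5 * W ^ 115 * W ^ 115) / D"
    by (rule mult_left_le_imp_le) (use N_gt0 d0 in simp)
  then have "D \<le> (W * W ^ 5 * W ^ 115 * W ^ 115) * (W ^ 38 * W ^ 32)"
    using D_gt0 W0 by (simp add: field_simps)
  also have "\<dots> = W ^ 306" by (simp only: power_add[symmetric] power_Suc[symmetric] mult.assoc) simp
  finally show False using Dbig by linarith
qed

end

section \<open>Parity of the uniformity\<close>

context dense_system
begin

text \<open>For odd \<open>r\<close> the map \<pi> is not an involution, so some \<open>i\<close>,
  \<open>j = \<pi> i\<close> and \<open>k = \<pi> j\<close> are distinct. Clustering
  \<open>i\<close> by \<open>j\<close>, and within the result \<open>j\<close> by \<open>k\<close>,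
  costs Q R^28 <= R^29, which is what \<open>no_consecutive_clusters\<close> tolerates.\<close>

theorem even_uniformity: "even r"
proof (rule ccontr)
  assume odd: "odd r"
  obtain G' where G': "G' \<subseteq> G" "E / 8 \<le> real (card G')"
    "\<forall>i<r. \<forall>x. real (card (nbrs G' i x)) \<le> D * Q ^ 5"
    "\<forall>i<r. \<forall>j<r. i \<noteq> j \<longrightarrow> (\<forall>a b. real (card {x \<in> G'. x i = a \<and> x j = b}) \<le> N ^ (r - 3) * D * Q ^ 5)"
    using regular_subset by blast
  interpret regular_system V r s T S G D Q G'
    by unfold_locales (use G' in auto)
  obtain F \<pi> where F: "F \<subseteq> G'" "E / Q \<le> real (card F)"
    and \<pi>: "\<And>i. i < r \<Longrightarrow> \<pi> i < r" "\<And>i. i < r \<Longrightarrow> \<pi> i \<noteq> i"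
    and close: "\<And>x i. x \<in> F \<Longrightarrow> i < r \<Longrightarrow> D / Q \<le> real (card {b \<in> nbrs G' i x. close i (\<pi> i) (x (\<pi> i)) (x i) b})"
    using coloured_subset by blast
  obtain i where i: "i < r" "\<pi> (\<pi> i) \<noteq> i"
    using even_card_involution[of "{..<r}" \<pi>] \<pi> odd by auto
  define j where "j = \<pi> i"
  define k where "k = \<pi> j"
  have ijk: "i < r" "j < r" "k < r" "i \<noteq> j" "j \<noteq> k" "i \<noteq> k"
    using i \<pi>[of i] \<pi>[of j] unfolding j_def k_def by metis+
  obtain F1 \<phi>1 \<psi>1 where F1: "F1 \<subseteq> F" "clustered i j F1 \<phi>1 \<psi>1" "real (card F) / R ^ 14 \<le> real (card F1)"
    using clustered_subset[OF F(1) ijk(1,2,4)] close[of _ i] ijk unfolding j_def[symmetric] by blast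
  have F1G': "F1 \<subseteq> G'" using F1(1) F(1) by blast
  obtain F2 \<phi>2 \<psi>2 where F2: "F2 \<subseteq> F1" "clustered j k F2 \<phi>2 \<psi>2" "real (card F1) / R ^ 14 \<le> real (card F2)"
    using clustered_subset[OF F1G' ijk(2,3,5)] close[of _ j] ijk F1(1) unfolding k_def[symmetric] by blast
  have "E / R ^ 29 = E / R / R ^ 14 / R ^ 14"
  proof -
    have "R ^ 29 = R * R ^ 14 * R ^ 14"
      using power_Suc[of R 28] by (simp add: mult.assoc power_add[symmetric])
    then show ?thesis by (simp only: divide_divide_eq_left)
  qed
  also have "\<dots> \<le> E / Q / R ^ 14 / R ^ 14"
    using R_ge_Q R_gt0 Q_gt0 E_gt0 by (intro divide_right_mono divide_left_mono) auto
  also have "\<dots> \<le> real (card F) / R ^ 14 / R ^ 14"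
    using F(2) R_gt0 by (intro divide_right_mono) auto
  also have "\<dots> \<le> real (card F1) / R ^ 14"
    using F1(3) R_gt0 by (intro divide_right_mono) auto
  also note F2(3)
  finally show False
    using no_consecutive_clusters[of F2, OF _ _ ijk clustered_mono[OF F1(2) F2(1)] F2(2)] F2(1) F1G' by blast
qed

end

section \<open>Hypergraphs\<close>

text \<open>The entries of \<open>f l\<close> away from \<open>i\<close> become the part with index
  \<open>l\<close>, and \<open>Y\<close> becomes the common set. Vertices within one part, or in a
  part and in \<open>Y\<close>, are distinct because the edge tuples are injective.\<close>

lemma copy_of_disjoint_links:
  fixes Gh :: "'a hypergraph" and f :: "nat \<Rightarrow> nat \<Rightarrow> 'a" and Y :: "'a list"
  assumes i: "i < r" and Y: "distinct Y" "length Y = s" "s \<ge> 1"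
    and inj: "\<And>l y. l < t \<Longrightarrow> y \<in> set Y \<Longrightarrow> inj_on ((f l)(i := y)) {..<r}"
    and edge: "\<And>l y. l < t \<Longrightarrow> y \<in> set Y \<Longrightarrow> ((f l)(i := y)) ` {..<r} \<in> edges Gh"
    and uni: "uniform_hypergraph r Gh" and t: "t \<ge> 1"
    and disj: "\<And>l l'. l < t \<Longrightarrow> l' < t \<Longrightarrow> l \<noteq> l' \<Longrightarrow> f l ` ({..<r} - {i}) \<inter> f l' ` ({..<r} - {i}) = {}"
  shows "contains_copy Gh (K_hyp r s t)"
proof -
  \<comment> \<open>Enumerates the coordinates other than \<open>i\<close>, to match the
    \<open>r - 1\<close> vertices of a part.\<close>
  define skip where "skip q = (if q < i then q else Suc q)" for q :: nat
  have skip_inj: "skip q = skip q' \<Longrightarrow> q = q'" for q q' by (auto simp: skip_def split: if_splits)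
  have skip_img: "skip ` {..<r - 1} = {..<r} - {i}"
  proof
    show "skip ` {..<r - 1} \<subseteq> {..<r} - {i}" using i by (auto simp: skip_def)
    show "{..<r} - {i} \<subseteq> skip ` {..<r - 1}"
    proof
      fix l assume l: "l \<in> {..<r} - {i}"
      show "l \<in> skip ` {..<r - 1}"
      proof (cases "l < i")
        case True
        then show ?thesis using i by (intro image_eqI[of _ _ l]) (auto simp: skip_def)
      next
        case False
        then show ?thesis using l by (intro image_eqI[of _ _ "l - 1"]) (auto simp: skip_def)
      qed
    qed
  qed
  have skip_mem: "skip q \<in> {..<r} - {i}" if "q < r - 1" for q using that skip_img by auto
  define g where "g v = (case v of Inl p \<Rightarrow> f (fst p) (skip (snd p)) | Inr y \<Rightarrow> Y ! y)" for v :: "nat \<times> nat + nat"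
  have gL: "g (Inl (l, q)) = f l (skip q)" and gR: "g (Inr y) = Y ! y" for l q y by (auto simp: g_def)
  have part: "g ` K_part r l = f l ` ({..<r} - {i})" for l
  proof -
    have "K_part r l = (\<lambda>q. Inl (l, q)) ` {..<r - 1}" by (auto simp: K_part_def)
    then show ?thesis unfolding skip_img[symmetric] by (simp add: image_image gL)
  qed
  have edge_img: "g ` (K_part r l \<union> {Inr y}) = ((f l)(i := Y ! y)) ` {..<r}" for l y
  proof -
    have "((f l)(i := Y ! y)) ` {..<r} = f l ` ({..<r} - {i}) \<union> {Y ! y}" using i by auto
    then show ?thesis using part[of l] by (simp add: gR image_Un)
  qed
  have Ymem: "Y ! y \<in> set Y" if "y < s" for y using that Y by auto
  have edges: "g ` e \<in> edges Gh" if e: "e \<in> edges (K_hyp r s t)" for e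
  proof -
    obtain l y where ly: "l < t" "y < s" "e = K_part r l \<union> {Inr y}" using e by (auto simp: K_hyp_def)
    show ?thesis unfolding ly(3) edge_img by (rule edge[OF ly(1) Ymem[OF ly(2)]])
  qed
  have LR: "f l (skip q) \<noteq> Y ! y" if "l < t" "q < r - 1" "y < s" for l q y
  proof
    assume eq: "f l (skip q) = Y ! y"
    have "((f l)(i := Y ! y)) (skip q) = ((f l)(i := Y ! y)) i" using eq skip_mem[OF that(2)] by auto
    then have "skip q = i" using inj_onD[OF inj[OF that(1) Ymem[OF that(3)]]] skip_mem[OF that(2)] i by blast
    then show False using skip_mem[OF that(2)] by auto
  qed
  have LL: "l = l' \<and> q = q'" if "l < t" "l' < t" "q < r - 1" "q' < r - 1" and eq: "f l (skip q) = f l' (skip q')" for l l' q q'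
  proof -
    have "f l (skip q) \<in> f l ` ({..<r} - {i}) \<inter> f l' ` ({..<r} - {i})"
      using eq skip_mem[OF that(3)] skip_mem[OF that(4)] by (metis IntI imageI)
    then have ll: "l = l'" using disj[OF that(1,2)] by blast
    have "((f l)(i := Y ! 0)) (skip q) = ((f l)(i := Y ! 0)) (skip q')"
      using eq ll skip_mem[OF that(3)] skip_mem[OF that(4)] by auto
    moreover have "inj_on ((f l)(i := Y ! 0)) {..<r}" using inj[OF that(1) Ymem] Y(3) by auto
    ultimately have "skip q = skip q'"
      using skip_mem[OF that(3)] skip_mem[OF that(4)] by (meson DiffD1 inj_onD)
    then show ?thesis using ll skip_inj by auto
  qed
  have verts: "v \<in> verts (K_hyp r s t) \<longleftrightarrow> (\<exists>l q. v = Inl (l, q) \<and> l < t \<and> q < r - 1) \<or> (\<exists>y. v = Inr y \<and> y < s)" for v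
    by (auto simp: K_hyp_def K_part_def)
  have "inj_on g (verts (K_hyp r s t))"
  proof (rule inj_onI)
    fix u v assume u: "u \<in> verts (K_hyp r s t)" and v: "v \<in> verts (K_hyp r s t)" and eq: "g u = g v"
    consider l q l' q' where "u = Inl (l, q)" "v = Inl (l', q')" "l < t" "l' < t" "q < r - 1" "q' < r - 1"
      | l q y where "u = Inl (l, q)" "v = Inr y" "l < t" "q < r - 1" "y < s"
      | l q y where "v = Inl (l, q)" "u = Inr y" "l < t" "q < r - 1" "y < s"
      | y y' where "u = Inr y" "v = Inr y'" "y < s" "y' < s"
      using u v unfolding verts by blast
    then show "u = v"
    proof cases
      case 1
      then show ?thesis using LL[OF 1(3-6)] eq by (simp add: gL)
    next
      case 2
      then show ?thesis using LR[OF 2(3-5)] eq by (simp add: gL gR)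
    next
      case 3
      then show ?thesis using LR[OF 3(3-5)] eq by (simp add: gL gR)
    next
      case 4
      then show ?thesis using eq Y(1,2) by (simp add: gR nth_eq_iff_index_eq)
    qed
  qed
  moreover have "g ` verts (K_hyp r s t) \<subseteq> verts Gh"
  proof
    fix z assume "z \<in> g ` verts (K_hyp r s t)"
    then obtain v where v: "v \<in> verts (K_hyp r s t)" "z = g v" by auto
    have e: "K_part r l \<union> {Inr y} \<in> edges (K_hyp r s t)" if "l < t" "y < s" for l y
      using that by (auto simp: K_hyp_def)
    \<comment> \<open>That every vertex lies in an edge uses \<open>s >= 1\<close> for the parts and
      \<open>t >= 1\<close> for \<open>Y\<close>.\<close>
    have "\<exists>e\<in>edges (K_hyp r s t). v \<in> e"
    proof -
      consider l q where "v = Inl (l, q)" "l < t" "q < r - 1" | y where "v = Inr y" "y < s"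
        using v(1) unfolding verts by blast
      then show ?thesis
      proof cases
        case 1
        then show ?thesis using e[of l 0] Y(3) by (intro bexI[of _ "K_part r l \<union> {Inr 0}"]) (auto simp: K_part_def)
      next
        case 2
        then show ?thesis using e[of 0 y] t by (intro bexI[of _ "K_part r 0 \<union> {Inr y}"]) auto
      qed
    qed
    then obtain e where "e \<in> edges (K_hyp r s t)" "v \<in> e" by blast
    then have "z \<in> g ` e" "g ` e \<in> edges Gh" using edges v by auto
    then show "z \<in> verts Gh" using uni unfolding uniform_hypergraph_def by blast
  qed
  ultimately show ?thesis using edges unfolding contains_copy_def by blast
qed

text \<open>A maximal family of pairwise disjoint link tuples has fewer than \<open>t\<close>
  members, since \<open>t\<close> of them would yield a copy. By maximality its vertices meet every
  link tuple.\<close>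

lemma bounded_cover_exists:
  fixes Gh :: "'a hypergraph"
  assumes uni: "uniform_hypergraph r Gh" and free: "\<not> contains_copy Gh (K_hyp r s t)"
    and A: "\<And>x. x \<in> A \<Longrightarrow> inj_on x {..<r} \<and> x ` {..<r} \<in> edges Gh"
    and i: "i < r" and Y: "distinct Y" "length Y = s" and st: "s \<ge> 1" "t \<ge> 1"
  shows "\<exists>C. finite C \<and> card C \<le> t * r \<and>
    (\<forall>x. (\<forall>y\<in>set Y. x(i := y) \<in> A) \<longrightarrow> (\<exists>j<r. j \<noteq> i \<and> x j \<in> C))"
proof -
  define good where "good x \<longleftrightarrow> (\<forall>y\<in>set Y. x(i := y) \<in> A)" for x
  define im where "im x = x ` ({..<r} - {i})" for x :: "nat \<Rightarrow> 'a"
  define Dis where "Dis m \<longleftrightarrow> (\<exists>f. (\<forall>l<m. good (f l)) \<and> (\<forall>l<m. \<forall>l'<m. l \<noteq> l' \<longrightarrow> im (f l) \<inter> im (f l') = {}))" for m :: nat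
  have notDis: "\<not> Dis t"
  proof
    assume "Dis t"
    then obtain f where f: "\<And>l. l < t \<Longrightarrow> good (f l)"
      "\<And>l l'. l < t \<Longrightarrow> l' < t \<Longrightarrow> l \<noteq> l' \<Longrightarrow> im (f l) \<inter> im (f l') = {}" unfolding Dis_def by blast
    have fA: "(f l)(i := y) \<in> A" if "l < t" "y \<in> set Y" for l y using f(1)[OF that(1)] that(2) by (simp add: good_def)
    have "contains_copy Gh (K_hyp r s t)"
    proof (rule copy_of_disjoint_links[OF i Y st(1) _ _ uni st(2), of f])
      show "inj_on ((f l)(i := y)) {..<r}" "((f l)(i := y)) ` {..<r} \<in> edges Gh" if "l < t" "y \<in> set Y" for l y
        using A[OF fA[OF that]] by blast+
      show "f l ` ({..<r} - {i}) \<inter> f l' ` ({..<r} - {i}) = {}" if "l < t" "l' < t" "l \<noteq> l'" for l l'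
        using f(2)[OF that] by (simp add: im_def)
    qed
    then show False using free by simp
  qed
  have "\<exists>m<t. Dis m \<and> \<not> Dis (Suc m)"
  proof (rule ccontr)
    assume none: "\<not> ?thesis"
    have "Dis m" if "m \<le> t" for m
      using that
    proof (induction m)
      case 0
      then show ?case unfolding Dis_def by simp
    next
      case (Suc m)
      then show ?case using none by auto
    qed
    then show False using notDis by simp
  qed
  then obtain m where m: "m < t" "Dis m" "\<not> Dis (Suc m)" by blast
  obtain f where f: "\<And>l. l < m \<Longrightarrow> good (f l)"
    "\<And>l l'. l < m \<Longrightarrow> l' < m \<Longrightarrow> l \<noteq> l' \<Longrightarrow> im (f l) \<inter> im (f l') = {}"
    using m(2) unfolding Dis_def by blast
  let ?C = "\<Union>l<m. im (f l)"
  have "card ?C \<le> (\<Sum>l<m. card (im (f l)))" by (rule card_UN_le) simp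
  also have "\<dots> \<le> (\<Sum>l<m. r)"
  proof (rule sum_mono)
    fix l
    have "card (im (f l)) \<le> card ({..<r} - {i})" unfolding im_def by (rule card_image_le) simp
    also have "\<dots> \<le> r" using card_mono[of "{..<r}" "{..<r} - {i}"] by auto
    finally show "card (im (f l)) \<le> r" .
  qed
  also have "\<dots> \<le> t * r" using m(1) by simp
  finally have "card ?C \<le> t * r" .
  moreover have "finite ?C" by (auto simp: im_def)
  moreover have "\<exists>j<r. j \<noteq> i \<and> x j \<in> ?C" if x: "good x" for x
  proof (rule ccontr)
    assume "\<not> ?thesis"
    then have "im x \<inter> ?C = {}" unfolding im_def by auto
    then have new: "im x \<inter> im (f l) = {}" if "l < m" for l using that by blast
    let ?f = "f(m := x)"
    have "good (?f l)" if "l < Suc m" for l using that f(1) x by (cases "l = m") auto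
    moreover have "im (?f l) \<inter> im (?f l') = {}" if "l < Suc m" "l' < Suc m" "l \<noteq> l'" for l l'
      using that f(2)[of l l'] new[of l] new[of l'] by (cases "l = m"; cases "l' = m") auto
    ultimately have "Dis (Suc m)" unfolding Dis_def by blast
    then show False using m(3) by simp
  qed
  ultimately show ?thesis unfolding good_def by blast
qed

lemma edges_enumeration:
  assumes uni: "uniform_hypergraph r Gh"
  shows "\<exists>A \<subseteq> PiE {..<r} (\<lambda>_. verts Gh). card A = card (edges Gh) \<and>
    (\<forall>x\<in>A. inj_on x {..<r} \<and> x ` {..<r} \<in> edges Gh)"
proof -
  have "\<exists>x. x \<in> PiE {..<r} (\<lambda>_. verts Gh) \<and> inj_on x {..<r} \<and> x ` {..<r} = e" if e: "e \<in> edges Gh" for e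
  proof -
    have es: "e \<subseteq> verts Gh" "card e = r" "finite e"
      using uni e finite_subset by (auto simp: uniform_hypergraph_def)
    then obtain h where h: "bij_betw h {0..<r} e" using ex_bij_betw_nat_finite by metis
    have z: "{0..<r} = {..<r}" by auto
    have h': "inj_on h {..<r}" "h ` {..<r} = e" using h unfolding z bij_betw_def by auto
    show ?thesis
    proof (intro exI[of _ "restrict h {..<r}"] conjI)
      show "restrict h {..<r} \<in> PiE {..<r} (\<lambda>_. verts Gh)" using h'(2) es(1) by (intro restrict_PiE_iff[THEN iffD2]) auto
      show "inj_on (restrict h {..<r}) {..<r}" using h'(1) by (simp add: inj_on_restrict_eq)
      show "restrict h {..<r} ` {..<r} = e" using h'(2) by simp
    qed
  qed
  then obtain en where en: "\<And>e. e \<in> edges Gh \<Longrightarrow> en e \<in> PiE {..<r} (\<lambda>_. verts Gh) \<and> inj_on (en e) {..<r} \<and> en e ` {..<r} = e"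
    by metis
  have "inj_on en (edges Gh)" by (rule inj_onI) (metis en)
  then have "card (en ` edges Gh) = card (edges Gh)" by (rule card_image)
  moreover have "en ` edges Gh \<subseteq> PiE {..<r} (\<lambda>_. verts Gh)" using en by blast
  moreover have "\<forall>x\<in>en ` edges Gh. inj_on x {..<r} \<and> x ` {..<r} \<in> edges Gh" using en by simp
  ultimately show ?thesis by blast
qed

text \<open>\<open>dense_system\<close> needs density bounds from both sides, so only about
  \<open>E\<close> of the edge tuples are kept. The covers are built for all of \<open>A\<close> and
  remain valid for the subset \<open>G\<close>.\<close>

lemma few_edges:
  fixes Gh :: "'a hypergraph" and D Q :: real
  assumes uni: "uniform_hypergraph r Gh" and free: "\<not> contains_copy Gh (K_hyp r s t)"
    and r: "odd r" "r \<ge> 3" and st: "s \<ge> 3" "t \<ge> 1" and n: "card (verts Gh) = n"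
    and DQ: "(D * Q) ^ (s - 1) = real n ^ (s - 2)"
    and Q_big: "real (100 * r ^ r * (t * r) * (64 * r) ^ s) \<le> Q"
    and D_big: "((Q ^ s) ^ s) ^ 306 < D"
    and E2: "2 \<le> real n ^ (r - 1) * D"
  shows "real (card (edges Gh)) \<le> real n ^ (r - 1) * D"
proof (rule ccontr)
  assume "\<not> ?thesis"
  then have big: "real n ^ (r - 1) * D < real (card (edges Gh))" by simp
  define E where "E = real n ^ (r - 1) * D"
  obtain A where A: "A \<subseteq> PiE {..<r} (\<lambda>_. verts Gh)" "card A = card (edges Gh)"
    "\<And>x. x \<in> A \<Longrightarrow> inj_on x {..<r} \<and> x ` {..<r} \<in> edges Gh"
    using edges_enumeration[OF uni] by blast
  \<comment> \<open>By \<open>E2\<close>, rounding down loses at most half of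
    \<open>E\<close>.\<close>
  define m where "m = nat \<lfloor>E\<rfloor>"
  have m: "real m \<le> E" "E / 2 \<le> real m" using E2 unfolding m_def E_def[symmetric] by linarith+
  then have "m \<le> card A" using big A(2) unfolding E_def[symmetric] by linarith
  then obtain G where G: "G \<subseteq> A" "card G = m" by (meson obtain_subset_with_card_n)
  define S where "S i Y = (SOME C. finite C \<and> card C \<le> t * r \<and>
    (\<forall>x. (\<forall>y\<in>set Y. x(i := y) \<in> A) \<longrightarrow> (\<exists>j<r. j \<noteq> i \<and> x j \<in> C)))" for i Y
  have S: "finite (S i Y) \<and> card (S i Y) \<le> t * r \<and>
    (\<forall>x. (\<forall>y\<in>set Y. x(i := y) \<in> A) \<longrightarrow> (\<exists>j<r. j \<noteq> i \<and> x j \<in> S i Y))"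
    if "i < r" "distinct Y" "length Y = s" for i Y
    unfolding S_def by (rule someI_ex, rule bounded_cover_exists[OF uni free A(3)]) (use that st in auto)
  interpret dense_system "verts Gh" r s "t * r" S G D Q
  proof unfold_locales
    show "finite (verts Gh)" using uni by (simp add: uniform_hypergraph_def)
    show "1 \<le> t * r" using st r by simp
    show "\<exists>j<r. j \<noteq> i \<and> x j \<in> S i Y"
      if "i < r" "length Y = s" "distinct Y" "\<And>y. y \<in> set Y \<Longrightarrow> x(i := y) \<in> G" for i Y x
      using S[of i Y] that G(1) by blast
    show "real (card G) \<le> real (card (verts Gh)) ^ (r - 1) * D"
      "real (card (verts Gh)) ^ (r - 1) * D / 2 \<le> real (card G)"
      using m G(2) n by (auto simp: E_def)
  qed (use r st S G A DQ Q_big D_big n in auto)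
  show False using even_uniformity r(1) by simp
qed

section \<open>Choice of the exponent and treatment of small vertex numbers\<close>

theorem theorem1p1:
  fixes s :: nat
  assumes "s \<ge> 3"
  shows "\<exists>\<epsilon>::real. \<epsilon> > 0 \<and>
           (\<forall>r::nat. odd r \<and> r \<ge> 3 \<longrightarrow>
             (\<forall>t::nat. t \<ge> 1 \<longrightarrow>
               (\<exists>C::real. \<forall>n::nat.
                  real (extremal_number r n (K_hyp r s t))
                    \<le> C * real n powr (real r - 1 / (real s - 1) - \<epsilon>))))"
proof -
  \<comment> \<open>\<open>D_big\<close> requires 306 s^2 \<epsilon> to be less than the exponent of
    \<open>D\<close>. The former becomes 0.306, while the latter is at least 1/2 - \<epsilon>
    because 1/(s-1) <= 1/2.\<close>
  define \<epsilon> :: real where "\<epsilon> = 1 / (1000 * real s ^ 2)"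
  have s2: "9 \<le> real s ^ 2" using power_mono[of 3 "real s" 2] assms by simp
  have \<epsilon>0: "\<epsilon> > 0" using assms by (simp add: \<epsilon>_def)
  have \<epsilon>1: "\<epsilon> \<le> 1 / 9000" unfolding \<epsilon>_def using s2 assms by (intro divide_left_mono) auto
  have \<epsilon>s: "\<epsilon> * (real s * real s * 306) = 306 / 1000"
    using assms by (simp add: \<epsilon>_def power2_eq_square)
  have half: "1 / (real s - 1) \<le> 1 / 2" using assms by (intro divide_left_mono) auto
  show ?thesis
  proof (rule exI[of _ \<epsilon>], intro conjI allI impI \<epsilon>0)
    fix r t :: nat assume "odd r \<and> 3 \<le> r" and t: "1 \<le> t"
    then have r: "odd r" "r \<ge> 3" by auto
    define \<alpha> where "\<alpha> = real r - 1 / (real s - 1) - \<epsilon>"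
    have \<alpha>0: "\<alpha> \<ge> 0" using half \<epsilon>1 r unfolding \<alpha>_def by linarith
    define K where "K = real (100 * r ^ r * (t * r) * (64 * r) ^ s)"
    \<comment> \<open>From K^(1/\<epsilon>) on, \<open>Q\<close> exceeds the constant
      \<open>K\<close>; the summand 2 makes the base of the powers larger than 1.\<close>
    define n0 where "n0 = nat \<lceil>K powr (1 / \<epsilon>)\<rceil> + 2"
    have "K_part r 0 \<union> {Inr 0} \<in> edges (K_hyp r s t)" unfolding K_hyp_def snd_conv using t assms
      by (intro CollectI exI[of _ 0]) simp
    then have ne: "edges (K_hyp r s t) \<noteq> {}" by blast
    have large: "real (extremal_number r n (K_hyp r s t)) \<le> real n powr \<alpha>" if n: "n \<ge> n0" for n
    proof -
      obtain Gh :: "nat hypergraph" where Gh: "uniform_hypergraph r Gh" "card (verts Gh) = n"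
        "\<not> contains_copy Gh (K_hyp r s t)" "card (edges Gh) = extremal_number r n (K_hyp r s t)"
        using extremal_number_attained[OF ne] by blast
      have n2: "n \<ge> 2" and nK: "K powr (1 / \<epsilon>) \<le> real n" using n unfolding n0_def by linarith+
      define \<beta> where "\<beta> = 1 - 1 / (real s - 1) - \<epsilon>"
      have \<beta>: "\<beta> > 306 / 1000" unfolding \<beta>_def using half \<epsilon>1 by linarith
      define Q where "Q = real n powr \<epsilon>"
      define D where "D = real n powr \<beta>"
      have E: "real n ^ (r - 1) * D = real n powr \<alpha>"
      proof -
        have "real n ^ (r - 1) = real n powr real (r - 1)" using n2 by (simp add: powr_realpow)
        moreover have "real (r - 1) + \<beta> = \<alpha>" using r by (simp add: \<alpha>_def \<beta>_def of_nat_diff)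
        ultimately show ?thesis by (simp add: D_def flip: powr_add)
      qed
      have "real (card (edges Gh)) \<le> real n ^ (r - 1) * D"
      proof (rule few_edges[OF Gh(1,3) r assms t Gh(2)])
        show "(D * Q) ^ (s - 1) = real n ^ (s - 2)"
        proof -
          have "D * Q = real n powr (1 - 1 / (real s - 1))" by (simp add: D_def Q_def \<beta>_def flip: powr_add)
          then have "(D * Q) ^ (s - 1) = real n powr ((1 - 1 / (real s - 1)) * real (s - 1))"
            using n2 by (simp add: powr_powr flip: powr_realpow)
          also have "(1 - 1 / (real s - 1)) * real (s - 1) = real (s - 2)"
            using assms by (simp add: of_nat_diff field_simps)
          also have "real n powr real (s - 2) = real n ^ (s - 2)" using n2 by (simp add: powr_realpow)
          finally show ?thesis .
        qed
        show "real (100 * r ^ r * (t * r) * (64 * r) ^ s) \<le> Q"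
        proof -
          have "K = (K powr (1 / \<epsilon>)) powr \<epsilon>" using \<epsilon>0 by (simp add: powr_powr K_def)
          also have "\<dots> \<le> Q" unfolding Q_def using nK \<epsilon>0 by (intro powr_mono2) auto
          finally show ?thesis unfolding K_def .
        qed
        show "((Q ^ s) ^ s) ^ 306 < D"
        proof -
          have "((Q ^ s) ^ s) ^ 306 = Q ^ (s * s * 306)" by (simp add: power_mult)
          also have "\<dots> = real n powr (\<epsilon> * real (s * s * 306))"
            unfolding Q_def using n2 by (simp add: powr_powr flip: powr_realpow)
          also have "\<epsilon> * real (s * s * 306) = 306 / 1000" using \<epsilon>s by (simp only: of_nat_mult of_nat_numeral)
          also have "real n powr (306 / 1000) < D" unfolding D_def using n2 \<beta> by (intro powr_less_mono) auto
          finally show ?thesis .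
        qed
        show "2 \<le> real n ^ (r - 1) * D"
        proof -
          have "\<alpha> \<ge> 1" using half \<epsilon>1 r unfolding \<alpha>_def by linarith
          then have "real n powr 1 \<le> real n powr \<alpha>" using n2 by (intro powr_mono) auto
          then show ?thesis unfolding E using n2 by simp
        qed
      qed
      then show ?thesis unfolding E Gh(4) .
    qed
    have bound: "real (extremal_number r n (K_hyp r s t)) \<le> 2 ^ n0 * real n powr \<alpha>" for n
    proof -
      obtain Gh :: "nat hypergraph" where Gh: "uniform_hypergraph r Gh" "card (verts Gh) = n"
        "\<not> contains_copy Gh (K_hyp r s t)" "card (edges Gh) = extremal_number r n (K_hyp r s t)"
        using extremal_number_attained[OF ne] by blast
      \<comment> \<open>Below \<open>n0\<close> the trivial bound 2^n goes into the constant. At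
        \<open>n = 0\<close> the right-hand side gives no room, but without vertices there are no
        edges.\<close>
      consider "n = 0" | "1 \<le> n" "n < n0" | "n \<ge> n0" by linarith
      then show ?thesis
      proof cases
        case 1
        have "verts Gh = {}" using Gh(1,2) 1 by (simp add: uniform_hypergraph_def)
        then have "edges Gh = {}" using Gh(1) r(2) unfolding uniform_hypergraph_def by fastforce
        then show ?thesis using Gh(4) by simp
      next
        case 2
        have "real (card (edges Gh)) \<le> real (2 ^ n)" using card_edges_le_two_power[OF Gh(1)] Gh(2) by (simp only: of_nat_le_iff)
        also have "\<dots> \<le> 2 ^ n0" using 2 by simp
        also have "\<dots> \<le> 2 ^ n0 * real n powr \<alpha>" using 2 \<alpha>0 by (simp add: ge_one_powr_ge_zero)
        finally show ?thesis unfolding Gh(4) .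
      next
        case 3
        have "real n powr \<alpha> = 1 * real n powr \<alpha>" by simp
        also have "\<dots> \<le> 2 ^ n0 * real n powr \<alpha>" by (intro mult_right_mono) auto
        finally show ?thesis using large[OF 3] by linarith
      qed
    qed
    show "\<exists>C::real. \<forall>n::nat. real (extremal_number r n (K_hyp r s t))
        \<le> C * real n powr (real r - 1 / (real s - 1) - \<epsilon>)"
      using bound unfolding \<alpha>_def by blast
  qed
qed

end
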